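(* Let $M$ be a complete Riemannian manifold and let $(X_n)_{n\ge0}$ be a stationary $\mathrm{R\text{-}AR}(\mu,\phi)$ process on $M$ with $|\phi|<1$. Let $\lambda$ denote its stationary probability measure and assume that $\mu$ is the unique Fréchet mean of $\lambda$, i.e. the unique minimiser over $p\in M$ of $\mathcal F(p)=\int_M d^2(x,p)\,\lambda(dx)$. Let $\mu_n$ be a sample Fréchet mean of $X_1,\dots,X_n$, i.e. a minimiser over $p\in M$ of $\frac1n\sum_{k=1}^n d^2(X_k,p)$. Then $\mu_n\to\mu$ $P$-almost surely as $n\to\infty$.
   Context: Manifolds are finite-dimensional, smooth and connected; $d$ is the Riemannian distance, $\exp_\mu$ the Riemannian exponential map, $\operatorname{inj}(M)\in[0,\infty]$ the global injectivity radius, $B_\mu(r)$ the open geodesic ball of radius $r$ about $\mu$ (with $B_\mu(\infty)=M$ when $\operatorname{inj}(M)=\infty$), and $\log_\mu$ the inverse of $\exp_\mu$ within the injectivity radius. Riemannian autoregressive process $\mathrm{R\text{-}AR}(\mu,\phi)$: let $\mu\in M$, $\phi\in\mathbb R$, and let $(\varepsilon_n)_{n\ge1}$ be i.i.d. non-degenerate (i.e. not almost surely constant) $T_\mu M$-valued random variables on a probability space $(\Omega,\mathcal A,P)$ with $E[\varepsilon_n]=0$, $E\|\varepsilon_n\|^2<\infty$. Let $X_0$ be an $M$-valued random variable independent of $(\varepsilon_n)_{n\ge1}$ with $E[d^2(X_0,\mu)]<\infty$. The $M$-valued process $(X_n)_{n\ge0}$ is an $\mathrm{R\text{-}AR}(\mu,\phi)$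 process if there is $0<r\le\operatorname{inj}(M)$ with $X_0\in B_\mu(r)$ a.s. and, for all $n\ge1$, $X_n=\exp_\mu(\phi\log_\mu(X_{n-1})+\varepsilon_n)$ and $X_n\in B_\mu(r)$ a.s., the update lying within the injectivity radius in the sense that $\|\phi\log_\mu(X_{n-1})+\varepsilon_n\|<r$ a.s. (so $\log_\mu X_n=\phi\log_\mu X_{n-1}+\varepsilon_n$ a.s.). The process is stationary with stationary (invariant) probability measure $\lambda$ if $X_n\sim\lambda$ for every $n\ge0$. *)

theory Defs
  imports "HOL-Probability.Probability"
begin

section \<open>Smooth maps between Euclidean spaces\<close>

primrec Ck_on :: "nat \<Rightarrow> 'a::euclidean_space set \<Rightarrow> ('a \<Rightarrow> 'b::euclidean_space) \<Rightarrow> bool" where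
  "Ck_on 0 S f \<longleftrightarrow> continuous_on S f"
| "Ck_on (Suc k) S f \<longleftrightarrow>
     f differentiable_on S \<and> (\<forall>v. Ck_on k S (\<lambda>x. frechet_derivative f (at x) v))"

definition smooth_on :: "'a::euclidean_space set \<Rightarrow> ('a \<Rightarrow> 'b::euclidean_space) \<Rightarrow> bool" where
  "smooth_on S f \<longleftrightarrow> open S \<and> (\<forall>k. Ck_on k S f)"

section \<open>Riemannian manifolds\<close>

text \<open>
  The underlying set of the manifold is the whole type \<open>'m\<close>, and \<open>'e\<close> is the model space
  \<open>\<real>\<^sup>d\<close>.  A chart is a pair of its domain and its coordinate map.

  Every point \<open>p\<close> has a preferred chart \<open>chart_at M p\<close>.  The tangent space \<open>T\<^sub>p M\<close> is the vector
  space \<open>'e\<close>, a tangent vector being represented by its components in the preferred chart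
  \<^emph>\<open>at its base point\<close>.  \<open>metric M p\<close> is the inner product on \<open>T\<^sub>p M\<close>.
  (The model space has positive dimension.  On a zero-dimensional manifold there are no
  non-degenerate tangent-valued random variables.)
\<close>

type_synonym ('m, 'e) chart = "'m set \<times> ('m \<Rightarrow> 'e)"

record ('m, 'e) riem =
  atlas :: "('m, 'e) chart set"
  chart_at :: "'m \<Rightarrow> ('m, 'e) chart"
  metric :: "'m \<Rightarrow> 'e \<Rightarrow> 'e \<Rightarrow> real"

definition chart_inv :: "('m, 'e) chart \<Rightarrow> 'e \<Rightarrow> 'm" where
  "chart_inv c = inv_into (fst c) (snd c)"

definition is_chart :: "('m::topological_space, 'e::euclidean_space) chart \<Rightarrow> bool" where
  "is_chart c \<longleftrightarrow> open (fst c) \<and> open (snd c ` fst c) \<and>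
     homeomorphism (fst c) (snd c ` fst c) (snd c) (chart_inv c)"

definition smooth_atlas :: "('m::topological_space, 'e::euclidean_space) chart set \<Rightarrow> bool" where
  "smooth_atlas A \<longleftrightarrow> (\<forall>c\<in>A. is_chart c) \<and> (\<Union>c\<in>A. fst c) = UNIV \<and>
     (\<forall>c\<in>A. \<forall>c'\<in>A. smooth_on (snd c ` (fst c \<inter> fst c')) (snd c' \<circ> chart_inv c))"

text \<open>
  The tangent vector at the point with \<open>c\<close>-coordinates \<open>x\<close> whose components in the chart \<open>c\<close>
  are \<open>u\<close>.
\<close>

definition tangent_of_chart ::
  "('m, 'e::euclidean_space) riem \<Rightarrow> ('m, 'e) chart \<Rightarrow> 'e \<Rightarrow> 'e \<Rightarrow> 'e" where
  "tangent_of_chart M c x u =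
     frechet_derivative (snd (chart_at M (chart_inv c x)) \<circ> chart_inv c) (at x) u"

text \<open>The metric in the coordinates of the chart \<open>c\<close>: \<open>g\<^sub>i\<^sub>j(x) = gram M c x e\<^sub>i e\<^sub>j\<close>.\<close>

definition gram ::
  "('m, 'e::euclidean_space) riem \<Rightarrow> ('m, 'e) chart \<Rightarrow> 'e \<Rightarrow> 'e \<Rightarrow> 'e \<Rightarrow> real" where
  "gram M c x u w =
     metric M (chart_inv c x) (tangent_of_chart M c x u) (tangent_of_chart M c x w)"

definition riemannian_manifold ::
  "('m::{t2_space,second_countable_topology}, 'e::euclidean_space) riem \<Rightarrow> bool" where
  "riemannian_manifold M \<longleftrightarrow>
     connected (UNIV :: 'm set) \<and> smooth_atlas (atlas M) \<and>
     (\<forall>p. chart_at M p \<in> atlas M \<and> p \<in> fst (chart_at M p)) \<and>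
     (\<forall>p. bilinear (metric M p) \<and> (\<forall>u w. metric M p u w = metric M p w u) \<and>
          (\<forall>u. u \<noteq> 0 \<longrightarrow> 0 < metric M p u u)) \<and>
     (\<forall>c\<in>atlas M. \<forall>u w. smooth_on (snd c ` fst c) (\<lambda>x. gram M c x u w))"

definition rnorm :: "('m, 'e) riem \<Rightarrow> 'm \<Rightarrow> 'e \<Rightarrow> real" where
  "rnorm M p v = sqrt (metric M p v v)"

subsection \<open>Riemannian distance\<close>

text \<open>Derivatives are one-sided at the end points; \<open>v\<close> is the velocity in the chart \<open>c\<close>.\<close>

definition C1_curve_on ::
  "('m::topological_space, 'e::euclidean_space) riem \<Rightarrow> real \<Rightarrow> real \<Rightarrow> (real \<Rightarrow> 'm) \<Rightarrow> bool" where
  "C1_curve_on M a b \<gamma> \<longleftrightarrow> continuous_on {a..b} \<gamma> \<and>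
     (\<forall>c\<in>atlas M. \<exists>v. continuous_on {t\<in>{a..b}. \<gamma> t \<in> fst c} v \<and>
        (\<forall>t\<in>{a..b}. \<gamma> t \<in> fst c \<longrightarrow>
           ((snd c \<circ> \<gamma>) has_vector_derivative v t) (at t within {a..b})))"

definition piecewise_C1_curve ::
  "('m::topological_space, 'e::euclidean_space) riem \<Rightarrow> (real \<Rightarrow> 'm) \<Rightarrow> bool" where
  "piecewise_C1_curve M \<gamma> \<longleftrightarrow>
     (\<exists>S. finite S \<and>
        (\<forall>a b. 0 \<le> a \<and> a \<le> b \<and> b \<le> 1 \<and> {a<..<b} \<inter> S = {} \<longrightarrow> C1_curve_on M a b \<gamma>))"

definition curve_length ::
  "('m, 'e::euclidean_space) riem \<Rightarrow> (real \<Rightarrow> 'm) \<Rightarrow> real" where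
  "curve_length M \<gamma> =
     integral {0..1}
       (\<lambda>t. rnorm M (\<gamma> t) (vector_derivative (snd (chart_at M (\<gamma> t)) \<circ> \<gamma>) (at t)))"

definition rdist ::
  "('m::topological_space, 'e::euclidean_space) riem \<Rightarrow> 'm \<Rightarrow> 'm \<Rightarrow> real" where
  "rdist M p q = Inf {curve_length M \<gamma> |\<gamma>. piecewise_C1_curve M \<gamma> \<and> \<gamma> 0 = p \<and> \<gamma> 1 = q}"

text \<open>
  Metric completeness, which by the Hopf--Rinow theorem is the same as geodesic completeness.
\<close>

definition complete_riemannian_manifold ::
  "('m::{t2_space,second_countable_topology}, 'e::euclidean_space) riem \<Rightarrow> bool" where
  "complete_riemannian_manifold M \<longleftrightarrow>
     riemannian_manifold M \<and> Metric_space.mcomplete UNIV (rdist M)"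

definition geodesic_ball ::
  "('m::topological_space, 'e::euclidean_space) riem \<Rightarrow> 'm \<Rightarrow> ennreal \<Rightarrow> 'm set" where
  "geodesic_ball M p r = {q. ennreal (rdist M p q) < r}"

subsection \<open>Geodesics and the exponential map\<close>

text \<open>
  The Christoffel symbols of the Levi-Civita connection as a bilinear map, in Koszul form:
  \<open>christoffel M c x u w\<close> has the components \<open>\<Gamma>\<^sup>k\<^sub>i\<^sub>j(x) u\<^sup>i w\<^sup>j\<close>.
\<close>

definition christoffel ::
  "('m, 'e::euclidean_space) riem \<Rightarrow> ('m, 'e) chart \<Rightarrow> 'e \<Rightarrow> 'e \<Rightarrow> 'e \<Rightarrow> 'e" where
  "christoffel M c x u w =
     (THE z. \<forall>y. gram M c x z y =
        (frechet_derivative (\<lambda>x. gram M c x w y) (at x) u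
         + frechet_derivative (\<lambda>x. gram M c x u y) (at x) w
         - frechet_derivative (\<lambda>x. gram M c x u w) (at x) y) / 2)"

text \<open>In each chart: \<open>x'' + \<Gamma>(x)(x', x') = 0\<close>, with \<open>x = snd c \<circ> \<gamma>\<close> and \<open>x' = v\<close>.\<close>

definition geodesic_on ::
  "('m::topological_space, 'e::euclidean_space) riem \<Rightarrow> real set \<Rightarrow> (real \<Rightarrow> 'm) \<Rightarrow> bool" where
  "geodesic_on M I \<gamma> \<longleftrightarrow> continuous_on I \<gamma> \<and>
     (\<forall>c\<in>atlas M. \<exists>v. \<forall>t\<in>I. \<gamma> t \<in> fst c \<longrightarrow>
        ((snd c \<circ> \<gamma>) has_vector_derivative v t) (at t within I) \<and>
        (v has_vector_derivative - christoffel M c (snd c (\<gamma> t)) (v t) (v t)) (at t within I))"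

definition geodesic_reaches ::
  "('m::topological_space, 'e::euclidean_space) riem \<Rightarrow> 'm \<Rightarrow> 'e \<Rightarrow> 'm \<Rightarrow> bool" where
  "geodesic_reaches M p v q \<longleftrightarrow>
     (\<exists>\<gamma>. geodesic_on M {0..1} \<gamma> \<and> \<gamma> 0 = p \<and>
        ((snd (chart_at M p) \<circ> \<gamma>) has_vector_derivative v) (at 0 within {0..1}) \<and> \<gamma> 1 = q)"

definition rexp :: "('m::topological_space, 'e::euclidean_space) riem \<Rightarrow> 'm \<Rightarrow> 'e \<Rightarrow> 'm" where
  "rexp M p v = (THE q. geodesic_reaches M p v q)"

definition tangent_ball ::
  "('m, 'e) riem \<Rightarrow> 'm \<Rightarrow> ennreal \<Rightarrow> 'e set" where
  "tangent_ball M p r = {v. ennreal (rnorm M p v) < r}"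

text \<open>\<open>f\<close> is a diffeomorphism from the open set \<open>D\<close> onto an open subset of the manifold.\<close>

definition diffeo_onto_image ::
  "('m::topological_space, 'e::euclidean_space) riem \<Rightarrow> 'e set \<Rightarrow> ('e \<Rightarrow> 'm) \<Rightarrow> bool" where
  "diffeo_onto_image M D f \<longleftrightarrow>
     open D \<and> open (f ` D) \<and> inj_on f D \<and> continuous_on D f \<and>
     (\<forall>c\<in>atlas M. smooth_on (D \<inter> f -` fst c) (snd c \<circ> f) \<and>
        smooth_on (snd c ` (fst c \<inter> f ` D)) (inv_into D f \<circ> chart_inv c))"

definition inj_radius_at ::
  "('m::topological_space, 'e::euclidean_space) riem \<Rightarrow> 'm \<Rightarrow> ennreal" where
  "inj_radius_at M p =
     Sup {r. (\<forall>v\<in>tangent_ball M p r. \<exists>q. geodesic_reaches M p v q) \<and>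
             diffeo_onto_image M (tangent_ball M p r) (rexp M p)}"

definition inj_radius :: "('m::topological_space, 'e::euclidean_space) riem \<Rightarrow> ennreal" where
  "inj_radius M = (INF p. inj_radius_at M p)"

definition rlog :: "('m::topological_space, 'e::euclidean_space) riem \<Rightarrow> 'm \<Rightarrow> 'm \<Rightarrow> 'e" where
  "rlog M p = inv_into (tangent_ball M p (inj_radius M)) (rexp M p)"

section \<open>Riemannian autoregressive processes\<close>

text \<open>
  The library's \<open>indep_var\<close> requires both random variables to have the same range type, so the
  independence of \<open>X 0\<close> and the whole sequence \<open>(\<epsilon> n)\<^sub>n\<^sub>\<ge>\<^sub>1\<close> is stated through the generated
  \<open>\<sigma>\<close>-algebras.
\<close>

definition R_AR ::
  "('m::{t2_space,second_countable_topology}, 'e::euclidean_space) riem \<Rightarrow> 'w measure \<Rightarrow>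
   'm \<Rightarrow> real \<Rightarrow> (nat \<Rightarrow> 'w \<Rightarrow> 'e) \<Rightarrow> (nat \<Rightarrow> 'w \<Rightarrow> 'm) \<Rightarrow> bool" where
  "R_AR M P \<mu> \<phi> \<epsilon> X \<longleftrightarrow>
     (\<forall>n\<ge>1. \<epsilon> n \<in> borel_measurable P) \<and>
     prob_space.indep_vars P (\<lambda>_. borel) \<epsilon> {1..} \<and>
     (\<forall>n\<ge>1. distr P borel (\<epsilon> n) = distr P borel (\<epsilon> 1)) \<and>
     (\<forall>n\<ge>1. \<not> (\<exists>v. AE \<omega> in P. \<epsilon> n \<omega> = v)) \<and>
     (\<forall>n\<ge>1. has_bochner_integral P (\<epsilon> n) 0) \<and>
     (\<forall>n\<ge>1. integrable P (\<lambda>\<omega>. (rnorm M \<mu> (\<epsilon> n \<omega>))\<^sup>2)) \<and>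
     (\<forall>n. X n \<in> borel_measurable P) \<and>
     prob_space.indep_set P
       (sets (vimage_algebra (space P) (X 0) borel))
       (sets (vimage_algebra (space P) (\<lambda>\<omega>. \<lambda>n\<in>{1..}. \<epsilon> n \<omega>) (PiM {1..} (\<lambda>_. borel)))) \<and>
     integrable P (\<lambda>\<omega>. (rdist M (X 0 \<omega>) \<mu>)\<^sup>2) \<and>
     (\<exists>r. 0 < r \<and> r \<le> inj_radius M \<and>
        (AE \<omega> in P. X 0 \<omega> \<in> geodesic_ball M \<mu> r) \<and>
        (\<forall>n\<ge>1. AE \<omega> in P.
           X n \<omega> = rexp M \<mu> (\<phi> *\<^sub>R rlog M \<mu> (X (n - 1) \<omega>) + \<epsilon> n \<omega>) \<and>
           X n \<omega> \<in> geodesic_ball M \<mu> r \<and>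
           ennreal (rnorm M \<mu> (\<phi> *\<^sub>R rlog M \<mu> (X (n - 1) \<omega>) + \<epsilon> n \<omega>)) < r))"

definition stationary_with :: "'w measure \<Rightarrow> (nat \<Rightarrow> 'w \<Rightarrow> 'm::topological_space) \<Rightarrow> 'm measure \<Rightarrow> bool" where
  "stationary_with P X \<Lambda> \<longleftrightarrow> (\<forall>n. distr P borel (X n) = \<Lambda>)"

section \<open>Frechet means\<close>

definition frechet_functional ::
  "('m::topological_space, 'e::euclidean_space) riem \<Rightarrow> 'm measure \<Rightarrow> 'm \<Rightarrow> ennreal" where
  "frechet_functional M \<Lambda> p = (\<integral>\<^sup>+ x. ennreal ((rdist M x p)\<^sup>2) \<partial>\<Lambda>)"

definition is_frechet_mean ::
  "('m::topological_space, 'e::euclidean_space) riem \<Rightarrow> 'm measure \<Rightarrow> 'm \<Rightarrow> bool" where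
  "is_frechet_mean M \<Lambda> p \<longleftrightarrow> (\<forall>q. frechet_functional M \<Lambda> p \<le> frechet_functional M \<Lambda> q)"

definition is_sample_frechet_mean ::
  "('m::topological_space, 'e::euclidean_space) riem \<Rightarrow> nat \<Rightarrow> (nat \<Rightarrow> 'm) \<Rightarrow> 'm \<Rightarrow> bool" where
  "is_sample_frechet_mean M n x p \<longleftrightarrow>
     (\<forall>q. 1 / real n * (\<Sum>k=1..n. (rdist M (x k) p)\<^sup>2)
        \<le> 1 / real n * (\<Sum>k=1..n. (rdist M (x k) q)\<^sup>2))"

end

theory Submission
  imports Defs
begin

text \<open>
  In the coordinates \<open>log\<^sub>\<mu>\<close> the process is a stationary linear autoregression
  \<open>Y\<^sub>n = \<phi> Y\<^sub>n\<^sub>-\<^sub>1 + \<epsilon>\<^sub>n\<close>, and \<open>d\<^sup>2(X\<^sub>n, p)\<close> is an integrable function of \<open>Y\<^sub>n\<close>.  For Lipschitz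
  functions of \<open>Y\<^sub>n\<close> the contraction \<open>|\<phi>| < 1\<close> makes the limiting behaviour of averages independent of
  the initial value and of finitely many innovations, so it is almost surely constant by Kolmogorov's
  0-1 law, and the maximal ergodic lemma identifies the constant.  The maximal inequality carries the
  strong law from Lipschitz functions to all integrable ones.  Hence the sample Frechet functionals
  converge almost surely at \<open>\<mu>\<close> and on a countable dense set.  Sample means are bounded, closed balls
  are compact by the Hopf--Rinow argument for length spaces, and every limit point of the sample
  means minimises the limiting functional, so it is \<open>\<mu>\<close>.  Nothing about geodesics enters beyond
  the definition of the injectivity radius.
\<close>

section \<open>Coordinate changes and the metric in coordinates\<close>

text \<open>The 0-1 law lives on the innovations alone, and forgetting the initial value is a
  comparison that works for functions controlled by distance. The squared distance read in
  logarithmic coordinates need not be Lipschitz or even continuous, since the exponential map is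
  extended by a constant outside its ball. This forces the passage from Lipschitz functions through
  indicators to integrable ones. The exceptional null set depends on \<open>p\<close>, so only
  countably many base points can be treated at once. The bridge to all other points is the
  inequality d(x,p)^2 \<le> (1 + \<eta>) d(x,q)^2 + (1 + 1/\<eta>) d(q,p)^2: it passes with the same
  constants to sample averages and to expectations, and its factor tends to 1 in a limit taken last.
  The rest is then deterministic, along one fixed sample path. Distances are infima of curve
  lengths, so compactness of balls is derived from almost shortest curves and not from minimising
  geodesics.\<close>

lemma smooth_on_imp_has_derivative:
  assumes "smooth_on S f" "x \<in> S"
  shows "(f has_derivative frechet_derivative f (at x)) (at x)"
proof -
  have "open S" and "Ck_on (Suc 0) S f"
    using assms(1) unfolding smooth_on_def by auto
  then show ?thesis
    using assms(2) by (auto simp: differentiable_on_eq_differentiable_at frechet_derivative_works)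
qed

lemma smooth_on_imp_continuous_derivative:
  assumes "smooth_on S f"
  shows "continuous_on S (\<lambda>x. frechet_derivative f (at x) v)"
proof -
  have "Ck_on (Suc 0) S f"
    using assms unfolding smooth_on_def by auto
  then show ?thesis
    by auto
qed

lemma smooth_on_imp_continuous_on: "smooth_on S f \<Longrightarrow> continuous_on S f"
  unfolding smooth_on_def by (metis Ck_on.simps(1))

locale riemannian =
  fixes M :: "('m::{t2_space,second_countable_topology}, 'e::euclidean_space) riem"
  assumes riemannian: "riemannian_manifold M"
begin

lemma connected_UNIV: "connected (UNIV :: 'm set)"
  and smooth_atlas: "smooth_atlas (atlas M)"
  and chart_at_atlas: "chart_at M p \<in> atlas M"
  and mem_chart_at: "p \<in> fst (chart_at M p)"
  and bilinear_metric: "bilinear (metric M p)"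
  and metric_pos: "u \<noteq> 0 \<Longrightarrow> 0 < metric M p u u"
  and smooth_gram: "c \<in> atlas M \<Longrightarrow> smooth_on (snd c ` fst c) (\<lambda>x. gram M c x u w)"
  using riemannian unfolding riemannian_manifold_def by blast+

lemma is_chart: "c \<in> atlas M \<Longrightarrow> is_chart c"
  and smooth_transition: "c \<in> atlas M \<Longrightarrow> c' \<in> atlas M \<Longrightarrow>
        smooth_on (snd c ` (fst c \<inter> fst c')) (snd c' \<circ> chart_inv c)"
  using smooth_atlas unfolding smooth_atlas_def by blast+

lemma
  assumes "c \<in> atlas M"
  shows open_chart: "open (fst c)" and open_chart_image: "open (snd c ` fst c)"
    and continuous_on_chart: "continuous_on (fst c) (snd c)"
    and continuous_on_chart_inv: "continuous_on (snd c ` fst c) (chart_inv c)"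
    and chart_inv_chart: "q \<in> fst c \<Longrightarrow> chart_inv c (snd c q) = q"
    and chart_chart_inv: "x \<in> snd c ` fst c \<Longrightarrow> snd c (chart_inv c x) = x"
    and chart_inv_in: "x \<in> snd c ` fst c \<Longrightarrow> chart_inv c x \<in> fst c"
  using is_chart[OF assms] unfolding is_chart_def homeomorphism_def by auto

abbreviation (input) dtrans :: "('m, 'e) chart \<Rightarrow> ('m, 'e) chart \<Rightarrow> 'e \<Rightarrow> 'e \<Rightarrow> 'e" where
  "dtrans c c' x \<equiv> frechet_derivative (snd c' \<circ> chart_inv c) (at x)"

lemma transition_has_derivative:
  assumes "c \<in> atlas M" "c' \<in> atlas M" "q \<in> fst c" "q \<in> fst c'"
  shows "(snd c' \<circ> chart_inv c has_derivative dtrans c c' (snd c q)) (at (snd c q))"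
  using assms by (intro smooth_on_imp_has_derivative[OF smooth_transition]) auto

lemma continuous_on_dtrans:
  assumes "c \<in> atlas M" "c' \<in> atlas M"
  shows "continuous_on (snd c ` (fst c \<inter> fst c')) (\<lambda>x. dtrans c c' x v)"
  using assms by (intro smooth_on_imp_continuous_derivative smooth_transition)

lemma linear_dtrans:
  assumes "c \<in> atlas M" "c' \<in> atlas M" "q \<in> fst c" "q \<in> fst c'"
  shows "linear (dtrans c c' (snd c q))"
  using transition_has_derivative[OF assms] has_derivative_linear by blast

text \<open>The two transition maps are mutually inverse on the open overlap, so the chain rule
  applies. The left inverse shows that a transition differential kills no vector, from which
  \<open>gram_pos\<close> gets definiteness in every chart.\<close>

lemma dtrans_inverse:
  assumes "c \<in> atlas M" "c' \<in> atlas M" "q \<in> fst c" "q \<in> fst c'"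
  shows "dtrans c' c (snd c' q) (dtrans c c' (snd c q) u) = u"
proof -
  let ?f = "snd c' \<circ> chart_inv c" and ?g = "snd c \<circ> chart_inv c'"
  have fq: "?f (snd c q) = snd c' q"
    using assms by (simp add: chart_inv_chart)
  have 1: "(?g \<circ> ?f has_derivative (dtrans c' c (snd c' q) \<circ> dtrans c c' (snd c q))) (at (snd c q))"
    using transition_has_derivative[OF assms] transition_has_derivative[OF assms(2,1,4,3)]
    by (intro diff_chain_at) (simp_all only: fq)
  have op: "open (snd c ` (fst c \<inter> fst c'))"
    using smooth_transition[OF assms(1,2)] unfolding smooth_on_def by blast
  have "(?g \<circ> ?f has_derivative (\<lambda>x. x)) (at (snd c q))"
  proof (rule has_derivative_transform_within_open[OF has_derivative_ident op])
    show "snd c q \<in> snd c ` (fst c \<inter> fst c')"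
      using assms by auto
    show "x = (?g \<circ> ?f) x" if "x \<in> snd c ` (fst c \<inter> fst c')" for x
      using that assms by (auto simp: chart_inv_chart)
  qed
  then have "(dtrans c' c (snd c' q) \<circ> dtrans c c' (snd c q)) = (\<lambda>x. x)"
    using 1 has_derivative_unique by blast
  then show ?thesis
    by (metis comp_apply)
qed

lemma gram_chart:
  assumes "c \<in> atlas M" "q \<in> fst c"
  shows "gram M c (snd c q) u w =
    metric M q (dtrans c (chart_at M q) (snd c q) u) (dtrans c (chart_at M q) (snd c q) w)"
  using assms unfolding gram_def tangent_of_chart_def by (simp add: chart_inv_chart)

lemma bilinear_gram:
  assumes "c \<in> atlas M" "x \<in> snd c ` fst c"
  shows "bilinear (gram M c x)"
proof -
  obtain q where q: "q \<in> fst c" "x = snd c q"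
    using assms by auto
  have lin: "linear (dtrans c (chart_at M q) (snd c q))"
    using linear_dtrans assms q chart_at_atlas mem_chart_at by blast
  have m: "bilinear (metric M q)"
    by (rule bilinear_metric)
  show ?thesis
    unfolding bilinear_def q(2) gram_chart[OF assms(1) q(1)]
    using linear_compose[OF lin, of "\<lambda>y. metric M q _ y"] linear_compose[OF lin, of "\<lambda>y. metric M q y _"] m
    unfolding bilinear_def comp_def by blast
qed

lemma gram_pos:
  assumes "c \<in> atlas M" "x \<in> snd c ` fst c" "u \<noteq> 0"
  shows "0 < gram M c x u u"
proof -
  obtain q where q: "q \<in> fst c" "x = snd c q"
    using assms by auto
  let ?d = "dtrans c (chart_at M q) (snd c q)"
  have "?d u \<noteq> 0"
  proof
    assume "?d u = 0"
    moreover have "linear (dtrans (chart_at M q) c (snd (chart_at M q) q))"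
      using linear_dtrans assms q chart_at_atlas mem_chart_at by blast
    ultimately show False
      using dtrans_inverse[OF assms(1) chart_at_atlas q(1) mem_chart_at, of u] assms(3)
      by (metis linear_0)
  qed
  then show ?thesis
    unfolding q(2) gram_chart[OF assms(1) q(1)] using metric_pos by blast
qed

lemma gram_scale:
  assumes "c \<in> atlas M" "x \<in> snd c ` fst c"
  shows "gram M c x (a *\<^sub>R u) (a *\<^sub>R u) = a\<^sup>2 * gram M c x u u"
  using bilinear_gram[OF assms] by (simp add: bilinear_lmul bilinear_rmul power2_eq_square)

text \<open>Smoothness is given for \<open>gram\<close> with fixed vectors only; bilinearity turns
  it into joint continuity in point and vector, as needed for moving velocities.\<close>

lemma gram_expand:
  assumes "c \<in> atlas M" "x \<in> snd c ` fst c"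
  shows "gram M c x u w = (\<Sum>i\<in>Basis. \<Sum>j\<in>Basis. (u \<bullet> i) * (w \<bullet> j) * gram M c x i j)"
proof -
  have b: "bilinear (gram M c x)"
    by (rule bilinear_gram[OF assms])
  have "gram M c x u w = gram M c x (\<Sum>i\<in>Basis. (u \<bullet> i) *\<^sub>R i) (\<Sum>j\<in>Basis. (w \<bullet> j) *\<^sub>R j)"
    by (simp add: euclidean_representation)
  also have "\<dots> = (\<Sum>(i,j)\<in>Basis \<times> Basis. gram M c x ((u \<bullet> i) *\<^sub>R i) ((w \<bullet> j) *\<^sub>R j))"
    by (rule bilinear_sum[OF b])
  also have "\<dots> = (\<Sum>i\<in>Basis. \<Sum>j\<in>Basis. (u \<bullet> i) * (w \<bullet> j) * gram M c x i j)"
    by (simp add: sum.cartesian_product bilinear_lmul[OF b] bilinear_rmul[OF b] mult_ac)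
  finally show ?thesis .
qed

lemma continuous_on_gram_compose:
  assumes "c \<in> atlas M" "continuous_on S x" "continuous_on S v" "x ` S \<subseteq> snd c ` fst c"
  shows "continuous_on S (\<lambda>s. gram M c (x s) (v s) (v s))"
proof -
  have "continuous_on S (\<lambda>s. gram M c (x s) i j)" for i j
    using continuous_on_compose2[OF smooth_on_imp_continuous_on[OF smooth_gram[OF assms(1)]] assms(2,4)] .
  then have "continuous_on S (\<lambda>s. \<Sum>i\<in>Basis. \<Sum>j\<in>Basis. (v s \<bullet> i) * (v s \<bullet> j) * gram M c (x s) i j)"
    using assms(3) by (intro continuous_intros) auto
  moreover have "gram M c (x s) (v s) (v s)
      = (\<Sum>i\<in>Basis. \<Sum>j\<in>Basis. (v s \<bullet> i) * (v s \<bullet> j) * gram M c (x s) i j)" if "s \<in> S" for s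
    using assms(1,4) that by (intro gram_expand) auto
  ultimately show ?thesis
    by (simp cong: continuous_on_cong)
qed

text \<open>On the compact product of the ball with the unit sphere the norm attains positive
  extrema, and homogeneity extends the comparison with the Euclidean norm to all vectors.\<close>

lemma gram_bounds:
  assumes "c \<in> atlas M" "cball x0 r \<subseteq> snd c ` fst c"
  obtains l L where "0 < l" "0 < L"
    "\<And>x u. x \<in> cball x0 r \<Longrightarrow> l * norm u \<le> sqrt (gram M c x u u)"
    "\<And>x u. x \<in> cball x0 r \<Longrightarrow> sqrt (gram M c x u u) \<le> L * norm u"
proof (cases "0 \<le> r")
  case False
  then show ?thesis
    by (intro that[of 1 1]) auto
next
  case True
  define K where "K = cball x0 r \<times> sphere (0::'e) 1"
  define f where "f = (\<lambda>z. sqrt (gram M c (fst z) (snd z) (snd z)))"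
  have K: "compact K"
    unfolding K_def by (intro compact_Times) auto
  obtain b :: 'e where "b \<in> Basis"
    using nonempty_Basis by blast
  then have "(x0, b) \<in> K"
    using True by (simp add: K_def)
  then have Kne: "K \<noteq> {}"
    by blast
  have cont: "continuous_on K f"
    unfolding f_def using assms
    by (intro continuous_on_real_sqrt continuous_on_gram_compose continuous_intros) (auto simp: K_def)
  have pos: "0 < f z" if "z \<in> K" for z
    using that assms gram_pos[OF assms(1), of "fst z" "snd z"] by (force simp: K_def f_def)
  obtain z1 where z1: "z1 \<in> K" "\<And>z. z \<in> K \<Longrightarrow> f z1 \<le> f z"
    using continuous_attains_inf[OF K Kne cont] by blast
  obtain z2 where z2: "z2 \<in> K" "\<And>z. z \<in> K \<Longrightarrow> f z \<le> f z2"
    using continuous_attains_sup[OF K Kne cont] by blast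
  have hom: "sqrt (gram M c x u u) = norm u * f (x, u /\<^sub>R norm u)"
    if "x \<in> cball x0 r" "u \<noteq> 0" for x u
  proof -
    have "x \<in> snd c ` fst c"
      using that assms by auto
    from gram_scale[OF assms(1) this, of "norm u" "u /\<^sub>R norm u"] show ?thesis
      using that by (simp add: f_def real_sqrt_mult)
  qed
  have zero: "gram M c x 0 0 = 0" if "x \<in> cball x0 r" for x
    using gram_scale[OF assms(1), of x 0 0] that assms(2) by auto
  have inK: "(x, u /\<^sub>R norm u) \<in> K" if "x \<in> cball x0 r" "u \<noteq> 0" for x u
    using that by (auto simp: K_def)
  show ?thesis
  proof (rule that[of "f z1" "f z2"])
    fix x u assume x: "x \<in> cball x0 r"
    show "f z1 * norm u \<le> sqrt (gram M c x u u)"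
      using hom[OF x, of u] z1(2)[OF inK[OF x, of u]] zero[OF x]
      by (cases "u = 0") (auto simp: mult.commute intro: mult_left_mono)
    show "sqrt (gram M c x u u) \<le> f z2 * norm u"
      using hom[OF x, of u] z2(2)[OF inK[OF x, of u]] zero[OF x]
      by (cases "u = 0") (auto simp: mult.commute intro: mult_left_mono)
  qed (use z1 z2 pos in auto)
qed

section \<open>Velocities in different charts\<close>

lemma vector_derivative_change_chart:
  assumes "c \<in> atlas M" "c' \<in> atlas M" "\<gamma> t \<in> fst c" "\<gamma> t \<in> fst c'" "t \<in> I"
    and cont: "continuous (at t within I) \<gamma>"
    and der: "((snd c \<circ> \<gamma>) has_vector_derivative v) (at t within I)"
  shows "((snd c' \<circ> \<gamma>) has_vector_derivative dtrans c c' (snd c (\<gamma> t)) v) (at t within I)"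
proof -
  let ?f = "snd c' \<circ> chart_inv c"
  have 1: "(?f has_derivative dtrans c c' (snd c (\<gamma> t))) (at ((snd c \<circ> \<gamma>) t) within (snd c \<circ> \<gamma>) ` I)"
    using transition_has_derivative[OF assms(1-4)] by (simp add: has_derivative_at_withinI)
  have "(?f \<circ> (snd c \<circ> \<gamma>) has_derivative (dtrans c c' (snd c (\<gamma> t)) \<circ> (\<lambda>h. h *\<^sub>R v))) (at t within I)"
    using der 1 unfolding has_vector_derivative_def by (intro diff_chain_within)
  moreover have "dtrans c c' (snd c (\<gamma> t)) \<circ> (\<lambda>h. h *\<^sub>R v) = (\<lambda>h. h *\<^sub>R dtrans c c' (snd c (\<gamma> t)) v)"
    using linear_dtrans[OF assms(1-4)] by (auto simp: linear_cmul)
  ultimately have 2: "(?f \<circ> (snd c \<circ> \<gamma>) has_vector_derivative dtrans c c' (snd c (\<gamma> t)) v) (at t within I)"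
    unfolding has_vector_derivative_def by simp
  have "\<forall>\<^sub>F s in at t within I. \<gamma> s \<in> fst c"
    using cont open_chart[OF assms(1)] assms(3) unfolding continuous_within
    by (rule topological_tendstoD)
  then have "\<forall>\<^sub>F s in at t within I. (?f \<circ> (snd c \<circ> \<gamma>)) s = (snd c' \<circ> \<gamma>) s"
    by eventually_elim (simp add: chart_inv_chart assms)
  with 2 show ?thesis
    using assms unfolding has_vector_derivative_def
    by (elim has_derivative_transform_eventually) (auto simp: chart_inv_chart)
qed

definition speed :: "(real \<Rightarrow> 'm) \<Rightarrow> real \<Rightarrow> real" where
  "speed \<gamma> t = rnorm M (\<gamma> t) (vector_derivative (snd (chart_at M (\<gamma> t)) \<circ> \<gamma>) (at t))"

lemma curve_length_speed: "curve_length M \<gamma> = integral {0..1} (speed \<gamma>)"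
  unfolding curve_length_def speed_def ..

lemma metric_nonneg: "0 \<le> metric M p u u"
  using metric_pos[of u p] bilinear_lzero[OF bilinear_metric, of p u] by (cases "u = 0") auto

lemma speed_nonneg: "0 \<le> speed \<gamma> t"
  unfolding speed_def rnorm_def using metric_nonneg by simp

text \<open>\<open>speed\<close> measures each velocity in the preferred chart of its own base
  point, and this choice need not vary continuously. Passing to one fixed chart yields an expression
  in which continuity in time is visible.\<close>

lemma speed_chart:
  assumes "c \<in> atlas M" "\<gamma> t \<in> fst c" "isCont \<gamma> t"
    and der: "((snd c \<circ> \<gamma>) has_vector_derivative v) (at t)"
  shows "speed \<gamma> t = sqrt (gram M c (snd c (\<gamma> t)) v v)"
proof -
  have "((snd (chart_at M (\<gamma> t)) \<circ> \<gamma>) has_vector_derivative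
      dtrans c (chart_at M (\<gamma> t)) (snd c (\<gamma> t)) v) (at t)"
    using assms chart_at_atlas mem_chart_at
    by (intro vector_derivative_change_chart) auto
  then have "vector_derivative (snd (chart_at M (\<gamma> t)) \<circ> \<gamma>) (at t)
      = dtrans c (chart_at M (\<gamma> t)) (snd c (\<gamma> t)) v"
    by (rule vector_derivative_at)
  then show ?thesis
    unfolding speed_def rnorm_def gram_chart[OF assms(1,2)] by simp
qed

end

section \<open>Piecewise C1 curves\<close>

context riemannian
begin

text \<open>Interval and break points are parameters, so that curves can be restricted,
  reparametrised and concatenated. Break points may be end points of the tested intervals, which
  enforces one-sided C1 behaviour there.\<close>

definition pC1 :: "real \<Rightarrow> real \<Rightarrow> (real \<Rightarrow> 'm) \<Rightarrow> real set \<Rightarrow> bool" where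
  "pC1 a b \<gamma> S \<longleftrightarrow> finite S \<and>
     (\<forall>c d. a \<le> c \<and> c \<le> d \<and> d \<le> b \<and> {c<..<d} \<inter> S = {} \<longrightarrow> C1_curve_on M c d \<gamma>)"

lemma piecewise_C1_curve_iff: "piecewise_C1_curve M \<gamma> \<longleftrightarrow> (\<exists>S. pC1 0 1 \<gamma> S)"
  unfolding piecewise_C1_curve_def pC1_def by blast

lemma pC1D: "pC1 a b \<gamma> S \<Longrightarrow> a \<le> c \<Longrightarrow> c \<le> d \<Longrightarrow> d \<le> b \<Longrightarrow> {c<..<d} \<inter> S = {} \<Longrightarrow> C1_curve_on M c d \<gamma>"
  unfolding pC1_def by blast

lemma pC1_finite: "pC1 a b \<gamma> S \<Longrightarrow> finite S"
  unfolding pC1_def by blast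

lemma C1_curve_on_subset:
  assumes "C1_curve_on M a b \<gamma>" "a \<le> c" "d \<le> b"
  shows "C1_curve_on M c d \<gamma>"
  unfolding C1_curve_on_def
proof (intro conjI ballI)
  have sub: "{c..d} \<subseteq> {a..b}"
    using assms by auto
  show "continuous_on {c..d} \<gamma>"
    using assms(1) sub unfolding C1_curve_on_def by (blast intro: continuous_on_subset)
  fix ch assume "ch \<in> atlas M"
  then obtain v where v: "continuous_on {t\<in>{a..b}. \<gamma> t \<in> fst ch} v"
    "\<And>t. t\<in>{a..b} \<Longrightarrow> \<gamma> t \<in> fst ch \<Longrightarrow> ((snd ch \<circ> \<gamma>) has_vector_derivative v t) (at t within {a..b})"
    using assms(1) unfolding C1_curve_on_def by blast
  show "\<exists>v. continuous_on {t\<in>{c..d}. \<gamma> t \<in> fst ch} v \<and>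
        (\<forall>t\<in>{c..d}. \<gamma> t \<in> fst ch \<longrightarrow>
           ((snd ch \<circ> \<gamma>) has_vector_derivative v t) (at t within {c..d}))"
  proof (intro exI[of _ v] conjI ballI impI)
    show "continuous_on {t \<in> {c..d}. \<gamma> t \<in> fst ch} v"
      by (rule continuous_on_subset[OF v(1)]) (use sub in auto)
    show "((snd ch \<circ> \<gamma>) has_vector_derivative v t) (at t within {c..d})"
      if "t \<in> {c..d}" "\<gamma> t \<in> fst ch" for t
      by (rule has_vector_derivative_within_subset[OF v(2) sub]) (use that sub in auto)
  qed
qed

lemma C1_curve_on_cong:
  assumes "C1_curve_on M a b \<gamma>" "\<And>t. t \<in> {a..b} \<Longrightarrow> \<gamma>' t = \<gamma> t"
  shows "C1_curve_on M a b \<gamma>'"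
  unfolding C1_curve_on_def
proof (intro conjI ballI)
  show "continuous_on {a..b} \<gamma>'"
    using assms(1) continuous_on_cong[of "{a..b}" "{a..b}" \<gamma>' \<gamma>] assms(2)
    unfolding C1_curve_on_def by simp
  fix ch assume "ch \<in> atlas M"
  then obtain v where v: "continuous_on {t\<in>{a..b}. \<gamma> t \<in> fst ch} v"
    "\<And>t. t\<in>{a..b} \<Longrightarrow> \<gamma> t \<in> fst ch \<Longrightarrow> ((snd ch \<circ> \<gamma>) has_vector_derivative v t) (at t within {a..b})"
    using assms(1) unfolding C1_curve_on_def by blast
  have eq: "{t\<in>{a..b}. \<gamma>' t \<in> fst ch} = {t\<in>{a..b}. \<gamma> t \<in> fst ch}"
    by (rule Collect_cong) (use assms(2) in auto)
  show "\<exists>v. continuous_on {t\<in>{a..b}. \<gamma>' t \<in> fst ch} v \<and>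
        (\<forall>t\<in>{a..b}. \<gamma>' t \<in> fst ch \<longrightarrow>
           ((snd ch \<circ> \<gamma>') has_vector_derivative v t) (at t within {a..b}))"
  proof (intro exI[of _ v] conjI ballI impI)
    show "continuous_on {t \<in> {a..b}. \<gamma>' t \<in> fst ch} v"
      unfolding eq by (rule v)
    show "((snd ch \<circ> \<gamma>') has_vector_derivative v t) (at t within {a..b})"
      if "t \<in> {a..b}" "\<gamma>' t \<in> fst ch" for t
    proof (rule has_vector_derivative_transform[OF that(1)])
      show "(snd ch \<circ> \<gamma>') x = (snd ch \<circ> \<gamma>) x" if "x \<in> {a..b}" for x
        using assms(2)[OF that] by simp
      show "((snd ch \<circ> \<gamma>) has_vector_derivative v t) (at t within {a..b})"
        using that assms(2) by (intro v(2)) simp_all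
    qed
  qed
qed

lemma C1_curve_on_affine:
  assumes "C1_curve_on M a b \<gamma>" "(\<lambda>t. \<alpha> * t + \<beta>) ` {a'..b'} \<subseteq> {a..b}"
  shows "C1_curve_on M a' b' (\<lambda>t. \<gamma> (\<alpha> * t + \<beta>))"
  unfolding C1_curve_on_def
proof (intro conjI ballI)
  let ?m = "\<lambda>t. \<alpha> * t + \<beta>"
  have im: "?m t \<in> {a..b}" if "t \<in> {a'..b'}" for t
    using assms(2) that by blast
  show "continuous_on {a'..b'} (\<lambda>t. \<gamma> (?m t))"
  proof (rule continuous_on_compose2[OF _ _ assms(2)])
    show "continuous_on {a..b} \<gamma>"
      using assms(1) unfolding C1_curve_on_def by blast
  qed (intro continuous_intros)
  fix ch assume "ch \<in> atlas M"
  then obtain v where v: "continuous_on {t\<in>{a..b}. \<gamma> t \<in> fst ch} v"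
    "\<And>t. t\<in>{a..b} \<Longrightarrow> \<gamma> t \<in> fst ch \<Longrightarrow> ((snd ch \<circ> \<gamma>) has_vector_derivative v t) (at t within {a..b})"
    using assms(1) unfolding C1_curve_on_def by blast
  show "\<exists>v. continuous_on {t\<in>{a'..b'}. \<gamma> (?m t) \<in> fst ch} v \<and>
        (\<forall>t\<in>{a'..b'}. \<gamma> (?m t) \<in> fst ch \<longrightarrow>
           ((snd ch \<circ> (\<lambda>t. \<gamma> (?m t))) has_vector_derivative v t) (at t within {a'..b'}))"
  proof (intro exI[of _ "\<lambda>t. \<alpha> *\<^sub>R v (?m t)"] conjI ballI impI)
    show "continuous_on {t \<in> {a'..b'}. \<gamma> (?m t) \<in> fst ch} (\<lambda>t. \<alpha> *\<^sub>R v (?m t))"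
    proof (rule continuous_on_scaleR[OF continuous_on_const continuous_on_compose2[OF v(1)]])
      show "?m ` {t \<in> {a'..b'}. \<gamma> (?m t) \<in> fst ch} \<subseteq> {t \<in> {a..b}. \<gamma> t \<in> fst ch}"
        using im by auto
    qed (intro continuous_intros)
    fix t assume t: "t \<in> {a'..b'}" "\<gamma> (?m t) \<in> fst ch"
    have "(?m has_vector_derivative \<alpha>) (at t within {a'..b'})"
      unfolding has_real_derivative_iff_has_vector_derivative[symmetric]
      by (auto intro!: derivative_eq_intros)
    moreover have "((snd ch \<circ> \<gamma>) has_vector_derivative v (?m t)) (at (?m t) within ?m ` {a'..b'})"
      by (rule has_vector_derivative_within_subset[OF v(2) assms(2)]) (use t im in auto)
    ultimately have "((snd ch \<circ> \<gamma>) \<circ> ?m has_vector_derivative \<alpha> *\<^sub>R v (?m t)) (at t within {a'..b'})"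
      by (rule vector_diff_chain_within)
    then show "((snd ch \<circ> (\<lambda>t. \<gamma> (?m t))) has_vector_derivative \<alpha> *\<^sub>R v (?m t)) (at t within {a'..b'})"
      by (simp add: comp_def)
  qed
qed

lemma pC1_subset: "pC1 a b \<gamma> S \<Longrightarrow> a \<le> c \<Longrightarrow> d \<le> b \<Longrightarrow> pC1 c d \<gamma> S"
  unfolding pC1_def by auto

lemma pC1_cong:
  assumes "pC1 a b \<gamma> S" "\<And>t. t \<in> {a..b} \<Longrightarrow> \<gamma>' t = \<gamma> t"
  shows "pC1 a b \<gamma>' S"
  unfolding pC1_def
proof (intro conjI allI impI)
  show "finite S"
    using assms(1) by (rule pC1_finite)
  fix c d
  assume *: "a \<le> c \<and> c \<le> d \<and> d \<le> b \<and> {c<..<d} \<inter> S = {}"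
  then have "C1_curve_on M c d \<gamma>"
    by (blast intro: pC1D[OF assms(1)])
  then show "C1_curve_on M c d \<gamma>'"
    by (rule C1_curve_on_cong) (rule assms(2), use * in auto)
qed

lemma pC1_join:
  assumes "pC1 a b \<gamma> S" "pC1 b c \<gamma> T"
  shows "pC1 a c \<gamma> (S \<union> T \<union> {b})"
  unfolding pC1_def
proof (intro conjI allI impI)
  show "finite (S \<union> T \<union> {b})"
    using assms pC1_finite by auto
  fix d e assume *: "a \<le> d \<and> d \<le> e \<and> e \<le> c \<and> {d<..<e} \<inter> (S \<union> T \<union> {b}) = {}"
  then have "b \<notin> {d<..<e}"
    by blast
  then consider "e \<le> b" | "b \<le> d"
    by fastforce
  then show "C1_curve_on M d e \<gamma>"
  proof cases
    case 1
    then show ?thesis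
      using * by (intro pC1D[OF assms(1)]) auto
  next
    case 2
    then show ?thesis
      using * by (intro pC1D[OF assms(2)]) auto
  qed
qed

lemma pC1_affine:
  assumes "pC1 a b \<gamma> S" "\<alpha> \<noteq> 0" "(\<lambda>t. \<alpha> * t + \<beta>) ` {a'..b'} \<subseteq> {a..b}"
  shows "pC1 a' b' (\<lambda>t. \<gamma> (\<alpha> * t + \<beta>)) ((\<lambda>t. \<alpha> * t + \<beta>) -` S)"
  unfolding pC1_def
proof (intro conjI allI impI)
  let ?m = "\<lambda>t. \<alpha> * t + \<beta>"
  show "finite (?m -` S)"
    using pC1_finite[OF assms(1)] assms(2) by (intro finite_vimageI) (auto simp: inj_def)
  fix d e assume *: "a' \<le> d \<and> d \<le> e \<and> e \<le> b' \<and> {d<..<e} \<inter> ?m -` S = {}"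
  \<comment> \<open>For negative \<open>\<alpha>\<close> the end points change places; this case
    reverses curves and gives the symmetry of \<open>rdist\<close>.\<close>
  define d' where "d' = min (?m d) (?m e)"
  define e' where "e' = max (?m d) (?m e)"
  have mono: "d' \<le> ?m t \<and> ?m t \<le> e'" if "t \<in> {d..e}" for t
    using that assms(2) unfolding d'_def e'_def
    by (cases "\<alpha> > 0") (auto simp: min_def max_def mult_left_mono mult_left_mono_neg)
  have inner: "{d'<..<e'} \<subseteq> ?m ` {d<..<e}"
  proof
    fix y assume y: "y \<in> {d'<..<e'}"
    have "(y - \<beta>) / \<alpha> \<in> {d<..<e}"
    proof (cases "\<alpha> > 0")
      case True
      have "\<alpha> * d \<le> \<alpha> * e"
        using * True by simp
      then show ?thesis
        using y True by (auto simp: d'_def e'_def field_simps)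
    next
      case False
      then have "\<alpha> < 0" "\<alpha> * e \<le> \<alpha> * d"
        using * assms(2) by (auto simp: mult_left_mono_neg)
      then show ?thesis
        using y by (auto simp: d'_def e'_def field_simps)
    qed
    moreover have "y = ?m ((y - \<beta>) / \<alpha>)"
      using assms(2) by simp
    ultimately show "y \<in> ?m ` {d<..<e}"
      by blast
  qed
  have "?m d \<in> {a..b}" "?m e \<in> {a..b}"
    using assms(3) * by (blast intro: atLeastAtMost_iff[THEN iffD2] order_trans)+
  then have "C1_curve_on M d' e' \<gamma>"
    using inner * by (intro pC1D[OF assms(1)]) (auto simp: d'_def e'_def)
  then show "C1_curve_on M d e (\<lambda>t. \<gamma> (\<alpha> * t + \<beta>))"
    by (rule C1_curve_on_affine) (use mono in auto)
qed

section \<open>Regularity off the break points and integrability of the speed\<close>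

lemma pC1_gap:
  assumes "pC1 a b \<gamma> S"
  obtains d where "d > 0" "\<And>s. s \<in> S \<Longrightarrow> s \<noteq> t \<Longrightarrow> d \<le> dist s t"
proof -
  have "finite ((\<lambda>s. dist s t) ` (S - {t}))"
    using pC1_finite[OF assms] by simp
  then obtain d where "d > 0" "\<forall>x\<in>(\<lambda>s. dist s t) ` (S - {t}). x > 0 \<longrightarrow> d \<le> x"
    using finite_set_avoid[OF pC1_finite[OF assms], of t] by (auto simp: dist_commute)
  then show ?thesis
    by (intro that[of d]) auto
qed

lemma pC1_regular:
  assumes "pC1 a b \<gamma> S" "t \<in> {a<..<b} - S"
  shows "isCont \<gamma> t" "c \<in> atlas M \<Longrightarrow> \<gamma> t \<in> fst c \<Longrightarrow>
    ((snd c \<circ> \<gamma>) has_vector_derivative vector_derivative (snd c \<circ> \<gamma>) (at t)) (at t)"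
proof -
  obtain d where d: "d > 0" "\<And>s. s \<in> S \<Longrightarrow> s \<noteq> t \<Longrightarrow> d \<le> dist s t"
    using pC1_gap[OF assms(1)] by blast
  define e where "e = min d (min (t - a) (b - t))"
  have e: "e > 0"
    using d assms by (auto simp: e_def)
  have C1: "C1_curve_on M (t - e) (t + e) \<gamma>"
  proof (rule pC1D[OF assms(1)])
    show "{t - e<..<t + e} \<inter> S = {}"
      using d(2) assms(2) by (force simp: e_def dist_real_def)
  qed (use e in \<open>auto simp: e_def\<close>)
  have at: "at t within {t - e..t + e} = at t"
    using e by (intro at_within_interior) auto
  show "isCont \<gamma> t"
  proof -
    have "t \<in> {t - e..t + e}"
      using e by simp
    then have "continuous (at t within {t - e..t + e}) \<gamma>"
      using C1 unfolding C1_curve_on_def continuous_on_eq_continuous_within by blast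
    then show ?thesis
      unfolding at .
  qed
  show "((snd c \<circ> \<gamma>) has_vector_derivative vector_derivative (snd c \<circ> \<gamma>) (at t)) (at t)"
    if c: "c \<in> atlas M" "\<gamma> t \<in> fst c"
  proof -
    have "\<exists>v. ((snd c \<circ> \<gamma>) has_vector_derivative v) (at t within {t - e..t + e})"
      using C1 c e unfolding C1_curve_on_def by force
    then obtain v where "((snd c \<circ> \<gamma>) has_vector_derivative v) (at t)"
      using at by auto
    then show ?thesis
      using vector_derivative_at by blast
  qed
qed


lemma pC1_continuous_on:
  assumes "pC1 a b \<gamma> S"
  shows "continuous_on {a..b} \<gamma>"
  unfolding continuous_on_eq_continuous_within
proof
  fix t assume t: "t \<in> {a..b}"
  obtain d where d: "d > 0" "\<And>s. s \<in> S \<Longrightarrow> s \<noteq> t \<Longrightarrow> d \<le> dist s t"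
    using pC1_gap[OF assms(1)] by blast
  define u where "u = max a (t - d)"
  define w where "w = min b (t + d)"
  have "C1_curve_on M u t \<gamma>"
    by (rule pC1D[OF assms]) (use t d in \<open>force simp: u_def dist_real_def\<close>)+
  moreover have "C1_curve_on M t w \<gamma>"
    by (rule pC1D[OF assms]) (use t d in \<open>force simp: w_def dist_real_def\<close>)+
  ultimately have "continuous_on ({u..t} \<union> {t..w}) \<gamma>"
    unfolding C1_curve_on_def by (intro continuous_on_closed_Un) auto
  moreover have "{u..t} \<union> {t..w} = {u..w}"
    using t d by (auto simp: u_def w_def)
  ultimately have "continuous (at t within {u..w}) \<gamma>"
    using t d by (auto simp: continuous_on_eq_continuous_within u_def w_def)
  moreover have "at t within {u..w} = at t within {a..b}"
    by (rule at_within_nhd[of t "ball t d"]) (use t d in \<open>auto simp: u_def w_def dist_real_def\<close>)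
  ultimately show "continuous (at t within {a..b}) \<gamma>"
    by (simp add: continuous_within)
qed

text \<open>A curve need not stay in one chart, so integrability is checked on small intervals
  around each time, where the speed agrees with a continuous function up to two end points.\<close>

lemma C1_speed_integrable:
  assumes C1: "C1_curve_on M a b \<gamma>"
  shows "speed \<gamma> integrable_on {a..b}"
  unfolding cbox_interval[symmetric]
proof (rule integrable_on_little_subintervals, rule ballI)
  fix t assume "t \<in> cbox a b"
  then have t: "t \<in> {a..b}"
    by simp
  have cont: "continuous_on {a..b} \<gamma>"
    using C1 unfolding C1_curve_on_def by blast
  define c where "c = chart_at M (\<gamma> t)"
  have c: "c \<in> atlas M" "\<gamma> t \<in> fst c"
    unfolding c_def using chart_at_atlas mem_chart_at by auto
  then obtain v where v: "continuous_on {t\<in>{a..b}. \<gamma> t \<in> fst c} v"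
    "\<And>t. t\<in>{a..b} \<Longrightarrow> \<gamma> t \<in> fst c \<Longrightarrow> ((snd c \<circ> \<gamma>) has_vector_derivative v t) (at t within {a..b})"
    using C1 unfolding C1_curve_on_def by blast
  have "\<forall>\<^sub>F s in at t within {a..b}. \<gamma> s \<in> fst c"
    using cont t c open_chart[OF c(1)] unfolding continuous_on_def by (blast intro: topological_tendstoD)
  then obtain d where d: "d > 0" "\<And>s. s \<in> {a..b} \<Longrightarrow> dist s t < d \<Longrightarrow> \<gamma> s \<in> fst c"
    unfolding eventually_at using c by metis
  show "\<exists>d>0. \<forall>u w. t \<in> cbox u w \<and> cbox u w \<subseteq> ball t d \<and> cbox u w \<subseteq> cbox a b \<longrightarrow>
          speed \<gamma> integrable_on cbox u w"
  proof (intro exI[of _ d] conjI allI impI d)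
    fix u w assume uw: "t \<in> cbox u w \<and> cbox u w \<subseteq> ball t d \<and> cbox u w \<subseteq> cbox a b"
    then have uw1: "{u..w} \<subseteq> {t\<in>{a..b}. \<gamma> t \<in> fst c}"
      using d by (fastforce simp: subset_iff dist_commute)
    then have x: "continuous_on {u..w} (snd c \<circ> \<gamma>)"
      by (intro continuous_on_compose continuous_on_subset[OF cont]
           continuous_on_subset[OF continuous_on_chart[OF c(1)]]) auto
    have "continuous_on {u..w} (\<lambda>s. sqrt (gram M c ((snd c \<circ> \<gamma>) s) (v s) (v s)))"
      using uw1 by (intro continuous_on_real_sqrt continuous_on_gram_compose c x continuous_on_subset[OF v(1)]) auto
    then have "(\<lambda>s. sqrt (gram M c ((snd c \<circ> \<gamma>) s) (v s) (v s))) integrable_on {u..w}"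
      by (rule integrable_continuous_real)
    \<comment> \<open>\<open>speed\<close> uses two-sided derivatives, whose value at an end of
      \<open>{a..b}\<close> depends on the curve beyond it; the end points are left out as a null
      set.\<close>
    moreover have "speed \<gamma> s = sqrt (gram M c ((snd c \<circ> \<gamma>) s) (v s) (v s))" if s: "s \<in> {u..w} - {u,w}" for s
    proof -
      have "u \<in> {a..b}" "w \<in> {a..b}"
        using s uw by auto
      then have s': "s \<in> interior {a..b}"
        using s by auto
      then have at: "at s within {a..b} = at s"
        by (rule at_within_interior)
      have sm: "s \<in> {a..b}" "\<gamma> s \<in> fst c"
        using s uw1 by auto
      have "isCont \<gamma> s"
        using cont sm at unfolding continuous_on_eq_continuous_within by metis
      then show ?thesis
        using v(2)[OF sm] at speed_chart[OF c(1), of \<gamma> s] sm(2) by simp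
    qed
    ultimately show "speed \<gamma> integrable_on cbox u w"
      unfolding cbox_interval by (subst integrable_spike_finite_eq[where S="{u,w}"]) auto
  qed
qed

text \<open>Near \<open>t\<close> the only possible break is \<open>t\<close> itself, so cutting a
  small interval there leaves two C1 pieces.\<close>

lemma pC1_speed_integrable:
  assumes "pC1 a b \<gamma> S"
  shows "speed \<gamma> integrable_on {a..b}"
  unfolding cbox_interval[symmetric]
proof (rule integrable_on_little_subintervals, rule ballI)
  fix t assume "t \<in> cbox a b"
  then have t: "t \<in> {a..b}"
    by simp
  obtain d where d: "d > 0" "\<And>s. s \<in> S \<Longrightarrow> s \<noteq> t \<Longrightarrow> d \<le> dist s t"
    using pC1_gap[OF assms(1)] by blast
  show "\<exists>d>0. \<forall>u w. t \<in> cbox u w \<and> cbox u w \<subseteq> ball t d \<and> cbox u w \<subseteq> cbox a b \<longrightarrow>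
          speed \<gamma> integrable_on cbox u w"
  proof (intro exI[of _ d] conjI allI impI d(1))
    fix u w assume uw: "t \<in> cbox u w \<and> cbox u w \<subseteq> ball t d \<and> cbox u w \<subseteq> cbox a b"
    then have uw': "u \<le> t" "t \<le> w" "u \<in> ball t d" "w \<in> ball t d" "a \<le> u" "w \<le> b"
      by (auto simp: subset_iff)
    then have "C1_curve_on M u t \<gamma>" "C1_curve_on M t w \<gamma>"
      using d(2) by (intro pC1D[OF assms]; force simp: dist_real_def)+
    then have "speed \<gamma> integrable_on {u..t}" "speed \<gamma> integrable_on {t..w}"
      using C1_speed_integrable by auto
    then show "speed \<gamma> integrable_on cbox u w"
      unfolding cbox_interval by (rule Henstock_Kurzweil_Integration.integrable_combine[OF uw'(1,2)])
  qed
qed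

text \<open>The factor \<open>\<bar>\<alpha>\<bar>\<close> from homogeneity of the norm cancels the
  Jacobian of the affine substitution.\<close>

lemma pC1_affine_length:
  assumes pC1: "pC1 a b \<gamma> S" and \<alpha>: "\<alpha> \<noteq> 0"
    and im: "(\<lambda>t. \<alpha> * t + \<beta>) ` {a'..b'} = {a..b}"
  shows "integral {a'..b'} (speed (\<lambda>t. \<gamma> (\<alpha> * t + \<beta>))) = integral {a..b} (speed \<gamma>)"
proof -
  let ?m = "\<lambda>t. \<alpha> * t + \<beta>"
  have "(speed \<gamma> has_integral integral {a..b} (speed \<gamma>)) (cbox a b)"
    using pC1_speed_integrable[OF pC1] by (simp add: integrable_integral)
  from has_integral_affinity[OF this \<alpha>, of \<beta>]
  have "((\<lambda>x. speed \<gamma> (?m x)) has_integral (1 / \<bar>\<alpha>\<bar>) * integral {a..b} (speed \<gamma>))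
      ((\<lambda>x. (1 / \<alpha>) * x - \<beta> / \<alpha>) ` {a..b})"
    by simp
  moreover have "(\<lambda>x. (1 / \<alpha>) * x - \<beta> / \<alpha>) ` {a..b} = {a'..b'}"
    unfolding im[symmetric] image_image using \<alpha> by (simp add: field_simps)
  ultimately have "((\<lambda>x. speed \<gamma> (?m x)) has_integral (1 / \<bar>\<alpha>\<bar>) * integral {a..b} (speed \<gamma>)) {a'..b'}"
    by simp
  from has_integral_mult_right[OF this, of "\<bar>\<alpha>\<bar>"] \<alpha>
  have 1: "((\<lambda>x. \<bar>\<alpha>\<bar> * speed \<gamma> (?m x)) has_integral integral {a..b} (speed \<gamma>)) {a'..b'}"
    by simp
  \<comment> \<open>Times sent to break points or to the ends of \<open>{a..b}\<close>, where no
    two-sided derivative is known.\<close>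
  define N where "N = ?m -` (S \<union> {a,b})"
  have "finite N"
    unfolding N_def using pC1_finite[OF pC1] \<alpha> by (intro finite_vimageI) (auto simp: inj_def)
  moreover have "speed (\<lambda>t. \<gamma> (?m t)) s = \<bar>\<alpha>\<bar> * speed \<gamma> (?m s)" if "s \<in> {a'..b'} - N" for s
  proof -
    have ms: "?m s \<in> {a<..<b} - S"
      using that im by (force simp: N_def)
    define c where "c = chart_at M (\<gamma> (?m s))"
    have c: "c \<in> atlas M" "\<gamma> (?m s) \<in> fst c"
      unfolding c_def using chart_at_atlas mem_chart_at by auto
    let ?v = "vector_derivative (snd c \<circ> \<gamma>) (at (?m s))"
    have cont: "isCont \<gamma> (?m s)" and der: "((snd c \<circ> \<gamma>) has_vector_derivative ?v) (at (?m s))"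
      using pC1_regular[OF pC1 ms] c by auto
    have "(?m has_vector_derivative \<alpha>) (at s)"
      unfolding has_real_derivative_iff_has_vector_derivative[symmetric]
      by (auto intro!: derivative_eq_intros)
    from vector_diff_chain_at[OF this der]
    have "((snd c \<circ> (\<lambda>t. \<gamma> (?m t))) has_vector_derivative \<alpha> *\<^sub>R ?v) (at s)"
      by (simp add: comp_def)
    moreover have "isCont (\<lambda>t. \<gamma> (?m t)) s"
      using cont by (rule isCont_o2[of s ?m \<gamma>, rotated]) (intro continuous_intros)
    ultimately have "speed (\<lambda>t. \<gamma> (?m t)) s = sqrt (gram M c (snd c (\<gamma> (?m s))) (\<alpha> *\<^sub>R ?v) (\<alpha> *\<^sub>R ?v))"
      using speed_chart[OF c(1), of "\<lambda>t. \<gamma> (?m t)"] c by simp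
    also have "\<dots> = \<bar>\<alpha>\<bar> * sqrt (gram M c (snd c (\<gamma> (?m s))) ?v ?v)"
      using gram_scale[OF c(1), of "snd c (\<gamma> (?m s))"] c by (simp add: real_sqrt_mult)
    also have "\<dots> = \<bar>\<alpha>\<bar> * speed \<gamma> (?m s)"
      using speed_chart[OF c(1) _ cont der] c(2) by simp
    finally show ?thesis .
  qed
  ultimately have "(speed (\<lambda>t. \<gamma> (?m t)) has_integral integral {a..b} (speed \<gamma>)) {a'..b'}"
    using 1 by (rule has_integral_spike_finite)
  then show ?thesis
    by (rule integral_unique)
qed

end

section \<open>The Riemannian distance is a length metric for the manifold topology\<close>

context riemannian
begin

lemma bdd_below_curve_length:
  "bdd_below {curve_length M \<gamma> |\<gamma>. piecewise_C1_curve M \<gamma> \<and> \<gamma> 0 = p \<and> \<gamma> 1 = q}"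
  unfolding curve_length_speed piecewise_C1_curve_iff
  by (rule bdd_belowI[of _ 0]) (auto intro!: integral_nonneg pC1_speed_integrable speed_nonneg)

lemma rdist_le01:
  assumes "pC1 0 1 \<gamma> S"
  shows "rdist M (\<gamma> 0) (\<gamma> 1) \<le> integral {0..1} (speed \<gamma>)"
  unfolding rdist_def
  by (rule cInf_lower[OF _ bdd_below_curve_length])
     (use assms in \<open>auto simp: curve_length_speed piecewise_C1_curve_iff\<close>)

lemma affine_image_01: "(\<lambda>t. (b - a) * t + a) ` {0..1} = {a..b::real}" if "a \<le> b"
  using that by (auto simp: image_affinity_atLeastAtMost)

lemma affine_image_10: "(\<lambda>t. (a - b) * t + b) ` {0..1} = {a..b::real}" if "a \<le> b"
  using that by (auto simp: image_affinity_atLeastAtMost)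

text \<open>An increasing and a decreasing affine map carry the unit interval onto
  \<open>{a..b}\<close>; the decreasing one is the source of symmetry.\<close>

lemma rdist_le:
  assumes "pC1 a b \<gamma> S" "a < b"
  shows "rdist M (\<gamma> a) (\<gamma> b) \<le> integral {a..b} (speed \<gamma>)"
    and "rdist M (\<gamma> b) (\<gamma> a) \<le> integral {a..b} (speed \<gamma>)"
proof -
  have im1: "(\<lambda>t. (b - a) * t + a) ` {0..1} = {a..b}"
    using assms by (intro affine_image_01) auto
  have im2: "(\<lambda>t. (a - b) * t + b) ` {0..1} = {a..b}"
    using assms by (intro affine_image_10) auto
  show "rdist M (\<gamma> a) (\<gamma> b) \<le> integral {a..b} (speed \<gamma>)"
    using rdist_le01[OF pC1_affine[OF assms(1) _ eq_refl[OF im1]]]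
      pC1_affine_length[OF assms(1) _ im1] assms(2) by simp
  show "rdist M (\<gamma> b) (\<gamma> a) \<le> integral {a..b} (speed \<gamma>)"
    using rdist_le01[OF pC1_affine[OF assms(1) _ eq_refl[OF im2]]]
      pC1_affine_length[OF assms(1) _ im2] assms(2) by simp
qed

text \<open>Curves equal on a closed interval may have different two-sided derivatives at its ends,
  hence the exceptional pair.\<close>

lemma integral_speed_cong:
  assumes "\<And>t. t \<in> {a..b} \<Longrightarrow> \<gamma>' t = \<gamma> t"
  shows "integral {a..b} (speed \<gamma>') = integral {a..b} (speed \<gamma>)"
proof (rule integral_spike[of "{a,b}"])
  show "speed \<gamma> t = speed \<gamma>' t" if t: "t \<in> {a..b} - {a, b}" for t
  proof -
    have "\<forall>\<^sub>F s in nhds t. s \<in> {a<..<b}"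
      using t by (intro eventually_nhds_in_open) auto
    then have "\<forall>\<^sub>F s in nhds t. s \<in> UNIV \<longrightarrow>
        (snd (chart_at M (\<gamma> t)) \<circ> \<gamma>) s = (snd (chart_at M (\<gamma> t)) \<circ> \<gamma>') s"
      by eventually_elim (use assms in auto)
    from vector_derivative_cong_eq[OF this refl refl] t assms[of t] show ?thesis
      unfolding speed_def comp_def by auto
  qed
qed auto

lemma join_curves:
  assumes "pC1 0 1 \<gamma>1 S1" "pC1 0 1 \<gamma>2 S2" "\<gamma>1 1 = \<gamma>2 0"
  obtains \<gamma> S where "pC1 0 2 \<gamma> S" "\<gamma> 0 = \<gamma>1 0" "\<gamma> 2 = \<gamma>2 1"
    "integral {0..2} (speed \<gamma>) = integral {0..1} (speed \<gamma>1) + integral {0..1} (speed \<gamma>2)"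
proof -
  \<comment> \<open>The halves are glued on \<open>{0..2}\<close> with no rescaling, as
    \<open>rdist_le\<close> accepts every interval; \<open>1 * t + (-1)\<close> keeps the affine
    shape of the reparametrisation lemmas.\<close>
  define \<gamma> where "\<gamma> t = (if t \<le> 1 then \<gamma>1 t else \<gamma>2 (1 * t + (-1)))" for t
  have im: "(\<lambda>t. 1 * t + (-1)) ` {1..2} = {0..1::real}"
    by (auto simp: image_affinity_atLeastAtMost)
  have eq1: "\<gamma> t = \<gamma>1 t" if "t \<in> {0..1}" for t
    using that by (simp add: \<gamma>_def)
  have eq2: "\<gamma> t = \<gamma>2 (1 * t + (-1))" if "t \<in> {1..2}" for t
    using that assms(3) by (cases "t = 1") (simp_all add: \<gamma>_def)
  obtain T where T: "pC1 1 2 (\<lambda>t. \<gamma>2 (1 * t + (-1))) T"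
    using pC1_affine[OF assms(2) _ eq_refl[OF im]] by auto
  have l1: "pC1 0 1 \<gamma> S1"
    using assms(1) eq1 by (rule pC1_cong)
  have l2: "pC1 1 2 \<gamma> T"
    using T eq2 by (rule pC1_cong)
  have j: "pC1 0 2 \<gamma> (S1 \<union> T \<union> {1})"
    using l1 l2 by (rule pC1_join)
  have "integral {0..2} (speed \<gamma>) = integral {0..1} (speed \<gamma>) + integral {1..2} (speed \<gamma>)"
    using pC1_speed_integrable[OF j]
    by (intro Henstock_Kurzweil_Integration.integral_combine[symmetric]) auto
  also have "integral {0..1} (speed \<gamma>) = integral {0..1} (speed \<gamma>1)"
    using eq1 by (rule integral_speed_cong)
  also have "integral {1..2} (speed \<gamma>) = integral {1..2} (speed (\<lambda>t. \<gamma>2 (1 * t + (-1))))"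
    using eq2 by (rule integral_speed_cong)
  also have "\<dots> = integral {0..1} (speed \<gamma>2)"
    by (rule pC1_affine_length[OF assms(2) _ im]) simp
  finally show ?thesis
    using that[OF j] eq1[of 0] eq2[of 2] by simp
qed

text \<open>Without a connecting curve the infimum defining \<open>rdist\<close> would range over
  the empty set and mean nothing. Connectability is therefore treated as a relation of its own
  before any metric axiom.\<close>

definition joinable :: "'m \<Rightarrow> 'm \<Rightarrow> bool" where
  "joinable p q \<longleftrightarrow> (\<exists>\<gamma> S. pC1 0 1 \<gamma> S \<and> \<gamma> 0 = p \<and> \<gamma> 1 = q)"

lemma joinableI:
  assumes "pC1 a b \<gamma> S" "a < b"
  shows "joinable (\<gamma> a) (\<gamma> b)" "joinable (\<gamma> b) (\<gamma> a)"
proof -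
  have "pC1 0 1 (\<lambda>t. \<gamma> ((b - a) * t + a)) ((\<lambda>t. (b - a) * t + a) -` S)"
    using assms by (intro pC1_affine[OF assms(1)] eq_refl[OF affine_image_01]) auto
  then show "joinable (\<gamma> a) (\<gamma> b)"
    unfolding joinable_def by force
  have "pC1 0 1 (\<lambda>t. \<gamma> ((a - b) * t + b)) ((\<lambda>t. (a - b) * t + b) -` S)"
    using assms by (intro pC1_affine[OF assms(1)] eq_refl[OF affine_image_10]) auto
  then show "joinable (\<gamma> b) (\<gamma> a)"
    unfolding joinable_def by force
qed

lemma joinable_sym: "joinable p q \<Longrightarrow> joinable q p"
  using joinableI(2)[of 0 1] unfolding joinable_def by (metis zero_less_one)

lemma joinable_trans:
  assumes "joinable p q" "joinable q z"
  shows "joinable p z"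
proof -
  obtain \<gamma>1 S1 \<gamma>2 S2 where "pC1 0 1 \<gamma>1 S1" "pC1 0 1 \<gamma>2 S2" "\<gamma>1 0 = p" "\<gamma>1 1 = q" "\<gamma>2 0 = q" "\<gamma>2 1 = z"
    using assms unfolding joinable_def by blast
  then show ?thesis
    using join_curves[of \<gamma>1 S1 \<gamma>2 S2] joinableI(1)[of 0 2] by (metis zero_less_numeral)
qed

lemma segment_curve:
  assumes c: "c \<in> atlas M" and seg: "\<And>t. t \<in> {0..1} \<Longrightarrow> x + t *\<^sub>R u \<in> snd c ` fst c"
  shows "pC1 0 1 (\<lambda>t. chart_inv c (x + t *\<^sub>R u)) {}"
    and "t \<in> {0<..<1} \<Longrightarrow> speed (\<lambda>t. chart_inv c (x + t *\<^sub>R u)) t = sqrt (gram M c (x + t *\<^sub>R u) u u)"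
proof -
  let ?x = "\<lambda>t. x + t *\<^sub>R u"
  let ?\<gamma> = "\<lambda>t. chart_inv c (?x t)"
  have cont: "continuous_on {0..1} ?\<gamma>"
    by (rule continuous_on_compose2[OF continuous_on_chart_inv[OF c]])
       (use seg in \<open>auto intro!: continuous_intros\<close>)
  have x_der: "(?x has_vector_derivative u) (at t within I)" for t I
    by (auto intro!: derivative_eq_intros)
  have mem: "?\<gamma> t \<in> fst c" "snd c (?\<gamma> t) = ?x t" if "t \<in> {0..1}" for t
    using seg[OF that] chart_inv_in[OF c] chart_chart_inv[OF c] by auto
  have der: "((snd c \<circ> ?\<gamma>) has_vector_derivative u) (at t within {0..1})" if "t \<in> {0..1}" for t
    by (rule has_vector_derivative_transform[OF that _ x_der]) (simp add: mem)
  have "C1_curve_on M 0 1 ?\<gamma>"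
    unfolding C1_curve_on_def
  proof (intro conjI ballI cont)
    fix c' assume c': "c' \<in> atlas M"
    show "\<exists>v. continuous_on {t \<in> {0..1}. ?\<gamma> t \<in> fst c'} v \<and>
            (\<forall>t\<in>{0..1}. ?\<gamma> t \<in> fst c' \<longrightarrow>
              ((snd c' \<circ> ?\<gamma>) has_vector_derivative v t) (at t within {0..1}))"
    proof (intro exI[of _ "\<lambda>t. dtrans c c' (?x t) u"] conjI ballI impI)
      show "continuous_on {t \<in> {0..1}. ?\<gamma> t \<in> fst c'} (\<lambda>t. dtrans c c' (?x t) u)"
      proof (rule continuous_on_compose2[OF continuous_on_dtrans[OF c c']])
        show "?x ` {t \<in> {0..1}. ?\<gamma> t \<in> fst c'} \<subseteq> snd c ` (fst c \<inter> fst c')"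
        proof clarify
          fix t :: real assume t: "t \<in> {0..1}" "?\<gamma> t \<in> fst c'"
          then have "?\<gamma> t \<in> fst c \<inter> fst c'" "snd c (?\<gamma> t) = ?x t"
            using mem by blast+
          then show "?x t \<in> snd c ` (fst c \<inter> fst c')"
            by (metis imageI)
        qed
      qed (intro continuous_intros)
      fix t :: real assume t: "t \<in> {0..1}" "?\<gamma> t \<in> fst c'"
      have "continuous (at t within {0..1}) ?\<gamma>"
        using cont t(1) unfolding continuous_on_eq_continuous_within by blast
      from vector_derivative_change_chart[where \<gamma> = ?\<gamma>, OF c c' mem(1)[OF t(1)] t(2) t(1) this der[OF t(1)]]
      show "((snd c' \<circ> ?\<gamma>) has_vector_derivative dtrans c c' (?x t) u) (at t within {0..1})"
        using mem(2)[OF t(1)] by simp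
    qed
  qed
  then show "pC1 0 1 ?\<gamma> {}"
    unfolding pC1_def using C1_curve_on_subset by auto
  assume t: "t \<in> {0<..<1}"
  then have t': "t \<in> {0..1}"
    by simp
  have at: "at t within {0..1} = at t"
    using t by (intro at_within_interior) auto
  have "isCont ?\<gamma> t"
    using cont t' unfolding continuous_on_eq_continuous_within by (metis at)
  then show "speed ?\<gamma> t = sqrt (gram M c (?x t) u u)"
    using speed_chart[OF c, of ?\<gamma> t u] mem[OF t'] der[OF t'] at by simp
qed

lemma segment_in_cball:
  fixes x :: "'a::real_normed_vector"
  assumes "x \<in> cball x0 r" "y \<in> cball x0 r" "t \<in> {0..1}"
  shows "x + t *\<^sub>R (y - x) \<in> cball x0 r"
proof -
  have "x + t *\<^sub>R (y - x) = (1 - t) *\<^sub>R x + t *\<^sub>R y"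
    by (simp add: algebra_simps)
  then show ?thesis
    using convexD_alt[OF convex_cball assms(1,2)] assms(3) by simp
qed

lemma joinable_chart:
  assumes "c \<in> atlas M" "cball x0 r \<subseteq> snd c ` fst c" "x \<in> cball x0 r" "y \<in> cball x0 r"
  shows "joinable (chart_inv c x) (chart_inv c y)"
proof -
  have "pC1 0 1 (\<lambda>t. chart_inv c (x + t *\<^sub>R (y - x))) {}"
    using segment_in_cball[OF assms(3,4)] assms(1,2) by (intro segment_curve) auto
  from joinableI(1)[OF this] show ?thesis
    by simp
qed

lemma rdist_le_chart:
  assumes "c \<in> atlas M" "cball x0 r \<subseteq> snd c ` fst c" "x \<in> cball x0 r" "y \<in> cball x0 r"
    and L: "\<And>x u. x \<in> cball x0 r \<Longrightarrow> sqrt (gram M c x u u) \<le> L * norm u"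
  shows "rdist M (chart_inv c x) (chart_inv c y) \<le> L * norm (y - x)"
proof -
  let ?\<gamma> = "\<lambda>t. chart_inv c (x + t *\<^sub>R (y - x))"
  have *: "pC1 0 1 ?\<gamma> {}"
    using segment_in_cball[OF assms(3,4)] assms(1,2) by (intro segment_curve) auto
  have sp: "speed ?\<gamma> t \<le> L * norm (y - x)" if "t \<in> {0<..<1}" for t
  proof -
    have "speed ?\<gamma> t = sqrt (gram M c (x + t *\<^sub>R (y - x)) (y - x) (y - x))"
      using segment_in_cball[OF assms(3,4)] assms(1,2) that by (intro segment_curve) auto
    also have "\<dots> \<le> L * norm (y - x)"
      using segment_in_cball[OF assms(3,4)] that by (intro L) auto
    finally show ?thesis .
  qed
  have "rdist M (?\<gamma> 0) (?\<gamma> 1) \<le> integral {0..1} (speed ?\<gamma>)"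
    by (rule rdist_le01[OF *])
  \<comment> \<open>The formula for the speed of a segment holds at interior times, so both
    integrals are taken over the open interval.\<close>
  also have "\<dots> \<le> L * norm (y - x)"
  proof (rule has_integral_le)
    have "(speed ?\<gamma> has_integral integral {0..1} (speed ?\<gamma>)) (cbox 0 1)"
      using pC1_speed_integrable[OF *] by (simp add: integrable_integral)
    then show "(speed ?\<gamma> has_integral integral {0..1} (speed ?\<gamma>)) (box 0 1)"
      by (simp only: has_integral_open_interval)
    have "((\<lambda>t. L * norm (y - x)) has_integral L * norm (y - x)) (cbox 0 (1::real))"
      using has_integral_const[of "L * norm (y - x)" 0 "1::real"] by simp
    then show "((\<lambda>t. L * norm (y - x)) has_integral L * norm (y - x)) (box 0 (1::real))"
      by (simp only: has_integral_open_interval)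
  qed (use sp in auto)
  finally show ?thesis
    by simp
qed

lemma chart_cball:
  assumes "open W" "p \<in> W"
  obtains c r where "c \<in> atlas M" "p \<in> fst c" "0 < r" "cball (snd c p) r \<subseteq> snd c ` fst c"
    "chart_inv c ` cball (snd c p) r \<subseteq> W"
proof -
  define c where "c = chart_at M p"
  have c: "c \<in> atlas M" "p \<in> fst c"
    unfolding c_def using chart_at_atlas mem_chart_at by auto
  have "open (snd c ` fst c \<inter> chart_inv c -` W)"
    using c assms by (intro continuous_open_preimage continuous_on_chart_inv open_chart_image)
  moreover have "snd c p \<in> snd c ` fst c \<inter> chart_inv c -` W"
    using c assms by (auto simp: chart_inv_chart)
  ultimately obtain r where "0 < r" "cball (snd c p) r \<subseteq> snd c ` fst c \<inter> chart_inv c -` W"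
    unfolding open_contains_cball by blast
  then show ?thesis
    by (intro that[OF c, of r]) auto
qed

definition chart_ball :: "('m, 'e) chart \<Rightarrow> 'm \<Rightarrow> real \<Rightarrow> 'm set" where
  "chart_ball c p r = fst c \<inter> snd c -` ball (snd c p) r"

lemma open_chart_ball: "c \<in> atlas M \<Longrightarrow> open (chart_ball c p r)"
  unfolding chart_ball_def by (intro continuous_open_preimage continuous_on_chart open_chart open_ball)

lemma mem_chart_ball: "p \<in> fst c \<Longrightarrow> 0 < r \<Longrightarrow> p \<in> chart_ball c p r"
  unfolding chart_ball_def by auto

lemma chart_ball_eq:
  assumes "c \<in> atlas M" "q \<in> chart_ball c p r"
  shows "q = chart_inv c (snd c q)" "snd c q \<in> ball (snd c p) r"
  using assms unfolding chart_ball_def by (auto simp: chart_inv_chart)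

text \<open>Up to the first exit time the curve stays in a compact coordinate ball, where its speed
  is at least \<open>l\<close> times the Euclidean speed of its coordinates, and these travel a
  distance \<open>r\<close>. This lower bound on lengths makes \<open>rdist\<close> separate
  points.\<close>

lemma exit_length:
  assumes c: "c \<in> atlas M" "p \<in> fst c" and r: "0 < r" "cball (snd c p) r \<subseteq> snd c ` fst c"
    and l: "0 < l" "\<And>x u. x \<in> cball (snd c p) r \<Longrightarrow> l * norm u \<le> sqrt (gram M c x u u)"
    and \<gamma>: "pC1 0 1 \<gamma> S" "\<gamma> 0 = p" "\<gamma> 1 \<notin> chart_ball c p r"
  shows "l * r \<le> integral {0..1} (speed \<gamma>)"
proof -
  let ?U = "chart_ball c p r"
  \<comment> \<open>Compact sets are closed in a Hausdorff space, so membership in \<open>V\<close>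
    survives the limit up to the exit time; the curve is then still inside the chart when it leaves
    the open ball.\<close>
  define V where "V = chart_inv c ` cball (snd c p) r"
  define f where "f = snd c \<circ> \<gamma>"
  have cont: "continuous_on {0..1} \<gamma>"
    by (rule pC1_continuous_on[OF \<gamma>(1)])
  have "compact V"
    unfolding V_def using c r
    by (intro compact_continuous_image continuous_on_subset[OF continuous_on_chart_inv]) auto
  then have V: "closed V"
    by (rule compact_imp_closed)
  have UV: "?U \<subseteq> V"
  proof
    fix q assume "q \<in> ?U"
    from chart_ball_eq[OF c(1) this] show "q \<in> V"
      unfolding V_def using mem_ball_imp_mem_cball by blast
  qed
  have V_chart: "q \<in> fst c" "snd c q \<in> cball (snd c p) r" if "q \<in> V" for q
    using that r chart_inv_in[OF c(1)] chart_chart_inv[OF c(1)] unfolding V_def by auto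
  have "closed ({0..1} \<inter> \<gamma> -` (- ?U))"
    using open_chart_ball[OF c(1)] by (intro continuous_closed_preimage cont) auto
  then have "compact ({0..1} \<inter> \<gamma> -` (- ?U))"
    by (metis compact_Icc compact_Int_closed inf.left_idem)
  moreover have "1 \<in> {0..1} \<inter> \<gamma> -` (- ?U)"
    using \<gamma> by simp
  ultimately obtain \<tau> where \<tau>: "\<tau> \<in> {0..1}" "\<gamma> \<tau> \<notin> ?U"
    and first: "\<And>t. t \<in> {0..1} \<Longrightarrow> \<gamma> t \<notin> ?U \<Longrightarrow> \<tau> \<le> t"
    using compact_attains_inf[of "{0..1} \<inter> \<gamma> -` (- ?U)"] by (metis ComplI Int_iff empty_iff vimage_eq ComplD)
  have "0 < \<tau>"
    using \<tau> \<gamma>(2) mem_chart_ball[OF c(2) r(1)] by (cases "\<tau> = 0") auto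
  have sub: "{0..\<tau>} \<subseteq> {0..1}"
    using \<tau> by auto
  have contau: "continuous_on {0..\<tau>} \<gamma>"
    using cont sub by (rule continuous_on_subset)
  have "{0<..<\<tau>} \<subseteq> {0..\<tau>} \<inter> \<gamma> -` V"
  proof
    fix t assume t: "t \<in> {0<..<\<tau>}"
    then have "\<gamma> t \<in> chart_ball c p r"
      using first[of t] \<tau>(1) by fastforce
    then show "t \<in> {0..\<tau>} \<inter> \<gamma> -` V"
      using UV t by auto
  qed
  then have "closure {0<..<\<tau>} \<subseteq> {0..\<tau>} \<inter> \<gamma> -` V"
    by (intro closure_minimal continuous_closed_preimage contau V) auto
  then have inV: "\<gamma> t \<in> V" if "t \<in> {0..\<tau>}" for t
    using that \<open>0 < \<tau>\<close> by auto
  \<comment> \<open>The exit point lies in the closed coordinate ball and outside the open one,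
    hence on the sphere.\<close>
  have f\<tau>: "norm (f \<tau> - f 0) = r"
  proof -
    have "\<gamma> \<tau> \<in> V"
      using inV \<open>0 < \<tau>\<close> by simp
    from V_chart[OF this] \<tau>(2) show ?thesis
      unfolding f_def chart_ball_def comp_def \<gamma>(2) by (simp add: dist_norm norm_minus_commute)
  qed
  have "continuous_on {0..\<tau>} f"
    unfolding f_def using V_chart(1) inV
    by (intro continuous_on_compose contau continuous_on_subset[OF continuous_on_chart[OF c(1)]]) auto
  moreover have regular: "isCont \<gamma> t \<and> (f has_vector_derivative vector_derivative f (at t)) (at t)"
    if "t \<in> {0<..<\<tau>} - S" for t
    unfolding f_def using that \<tau> inV V_chart(1) c(1) by (intro conjI pC1_regular[OF \<gamma>(1)]) auto
  ultimately have ftc: "((\<lambda>t. vector_derivative f (at t)) has_integral (f \<tau> - f 0)) {0..\<tau>}"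
    using pC1_finite[OF \<gamma>(1)] \<open>0 < \<tau>\<close> by (intro fundamental_theorem_of_calculus_interior_strong) auto
  \<comment> \<open>Set to zero where the derivative may not exist, so that the pointwise bound by
    the speed holds at every time.\<close>
  define g where "g t = (if t \<in> {0<..<\<tau>} - S then vector_derivative f (at t) else 0)" for t
  have g: "(g has_integral (f \<tau> - f 0)) {0..\<tau>}"
    by (rule has_integral_spike_finite[OF _ _ ftc, of "S \<union> {0, \<tau>}"])
       (use pC1_finite[OF \<gamma>(1)] in \<open>auto simp: g_def\<close>)
  have int: "speed \<gamma> integrable_on {0..\<tau>}"
    using pC1_subset[OF \<gamma>(1)] \<tau> by (intro pC1_speed_integrable) auto
  have bound: "norm (g t) \<le> speed \<gamma> t / l" for t
  proof (cases "t \<in> {0<..<\<tau>} - S")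
    case True
    then have t: "\<gamma> t \<in> fst c" "snd c (\<gamma> t) \<in> cball (snd c p) r"
      using inV V_chart by auto
    have "speed \<gamma> t = sqrt (gram M c (snd c (\<gamma> t)) (g t) (g t))"
      using True regular[OF True] speed_chart[OF c(1), of \<gamma> t] t(1)
      unfolding f_def g_def by simp
    then have "l * norm (g t) \<le> speed \<gamma> t"
      using l(2)[OF t(2)] by simp
    then show ?thesis
      using l(1) by (simp add: field_simps)
  next
    case False
    then show ?thesis
      using l(1) speed_nonneg[of \<gamma> t] unfolding g_def by (simp only: if_False) simp
  qed
  have "r \<le> integral {0..\<tau>} (\<lambda>t. speed \<gamma> t / l)"
    using integral_norm_bound_integral[OF has_integral_integrable[OF g] _ bound] int
      integral_unique[OF g] f\<tau> by (metis integrable_on_divide)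
  also have "\<dots> = integral {0..\<tau>} (speed \<gamma>) / l"
    by simp
  finally have "l * r \<le> integral {0..\<tau>} (speed \<gamma>)"
    using l(1) by (simp add: field_simps)
  also have "\<dots> \<le> integral {0..1} (speed \<gamma>)"
    using speed_nonneg by (intro integral_subset_le sub int pC1_speed_integrable[OF \<gamma>(1)]) auto
  finally show ?thesis .
qed

text \<open>The points reachable from \<open>p\<close> form an open set with open complement,
  because coordinate segments connect every point to a neighbourhood of it; connectedness does the
  rest.\<close>

lemma joinable_all: "joinable p q"
proof -
  define R where "R = {q. joinable p q}"
  have nbhd: "\<exists>U. open U \<and> q \<in> U \<and> (\<forall>z\<in>U. joinable q z)" for q
  proof -
    obtain c r where c: "c \<in> atlas M" "q \<in> fst c" "0 < r" "cball (snd c q) r \<subseteq> snd c ` fst c"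
      by (rule chart_cball[OF open_UNIV UNIV_I])
    show ?thesis
    proof (intro exI conjI ballI)
      fix z assume "z \<in> chart_ball c q r"
      from chart_ball_eq[OF c(1) this] show "joinable q z"
        using joinable_chart[OF c(1,4), of "snd c q" "snd c z"] chart_inv_chart[OF c(1,2)] c(3) by simp
    qed (use c open_chart_ball mem_chart_ball in auto)
  qed
  have "open R"
    unfolding open_subopen[of R]
  proof
    fix q assume "q \<in> R"
    with nbhd[of q] joinable_trans[of p q] show "\<exists>T. open T \<and> q \<in> T \<and> T \<subseteq> R"
      unfolding R_def by blast
  qed
  moreover have "open (- R)"
    unfolding open_subopen[of "- R"]
  proof
    fix q assume "q \<in> - R"
    then have q: "\<not> joinable p q"
      by (simp add: R_def)
    obtain U where U: "open U" "q \<in> U" "\<forall>z\<in>U. joinable q z"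
      using nbhd[of q] by blast
    have "z \<notin> R" if "z \<in> U" for z
      using U(3) that q joinable_trans[of p z q] joinable_sym[of q z] by (auto simp: R_def)
    then show "\<exists>T. open T \<and> q \<in> T \<and> T \<subseteq> - R"
      using U by blast
  qed
  moreover have "p \<in> R"
    using nbhd[of p] unfolding R_def by blast
  ultimately have "- R = {}"
    using connectedD[OF connected_UNIV, of R "- R"] by auto
  then show ?thesis
    unfolding R_def by auto
qed

lemma rdist_approx:
  assumes "0 < e"
  obtains \<gamma> S where "pC1 0 1 \<gamma> S" "\<gamma> 0 = p" "\<gamma> 1 = q" "integral {0..1} (speed \<gamma>) < rdist M p q + e"
proof -
  let ?L = "{curve_length M \<gamma> |\<gamma>. piecewise_C1_curve M \<gamma> \<and> \<gamma> 0 = p \<and> \<gamma> 1 = q}"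
  have "?L \<noteq> {}"
    using joinable_all[of p q] unfolding joinable_def piecewise_C1_curve_iff by blast
  moreover have "Inf ?L < rdist M p q + e"
    using assms unfolding rdist_def by simp
  ultimately show ?thesis
    using that cInf_lessD[of ?L] unfolding curve_length_speed piecewise_C1_curve_iff by blast
qed

section \<open>Metric axioms and agreement of the topologies\<close>

lemma rdist_nonneg: "0 \<le> rdist M p q"
proof -
  have "{curve_length M \<gamma> |\<gamma>. piecewise_C1_curve M \<gamma> \<and> \<gamma> 0 = p \<and> \<gamma> 1 = q} \<noteq> {}"
    using joinable_all[of p q] unfolding joinable_def piecewise_C1_curve_iff by blast
  then show ?thesis
    unfolding rdist_def curve_length_speed piecewise_C1_curve_iff
    by (rule cInf_greatest) (auto intro!: integral_nonneg pC1_speed_integrable speed_nonneg)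
qed

lemma rdist_sym: "rdist M p q = rdist M q p"
proof -
  have "rdist M q p \<le> rdist M p q" for p q
  proof (rule field_le_epsilon)
    fix e :: real assume "0 < e"
    then obtain \<gamma> S where "pC1 0 1 \<gamma> S" "\<gamma> 0 = p" "\<gamma> 1 = q" "integral {0..1} (speed \<gamma>) < rdist M p q + e"
      by (rule rdist_approx)
    then show "rdist M q p \<le> rdist M p q + e"
      using rdist_le(2)[of 0 1 \<gamma> S] by simp
  qed
  then show ?thesis
    by (intro antisym)
qed

lemma rdist_triangle: "rdist M p z \<le> rdist M p q + rdist M q z"
proof (rule field_le_epsilon)
  fix e :: real assume "0 < e"
  then have e: "0 < e / 2"
    by simp
  obtain \<gamma>1 S1 where 1: "pC1 0 1 \<gamma>1 S1" "\<gamma>1 0 = p" "\<gamma>1 1 = q"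
    "integral {0..1} (speed \<gamma>1) < rdist M p q + e / 2"
    using rdist_approx[OF e] by blast
  obtain \<gamma>2 S2 where 2: "pC1 0 1 \<gamma>2 S2" "\<gamma>2 0 = q" "\<gamma>2 1 = z"
    "integral {0..1} (speed \<gamma>2) < rdist M q z + e / 2"
    using rdist_approx[OF e] by blast
  obtain \<gamma> S where "pC1 0 2 \<gamma> S" "\<gamma> 0 = \<gamma>1 0" "\<gamma> 2 = \<gamma>2 1"
    "integral {0..2} (speed \<gamma>) = integral {0..1} (speed \<gamma>1) + integral {0..1} (speed \<gamma>2)"
    using join_curves[OF 1(1) 2(1)] 1(3) 2(2) by metis
  then show "rdist M p z \<le> rdist M p q + rdist M q z + e"
    using rdist_le(1)[of 0 2 \<gamma> S] 1 2 by simp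
qed

text \<open>By \<open>exit_length\<close> a curve from \<open>p\<close> shorter than
  \<open>l * r\<close> cannot leave the coordinate ball. This gives one half of the comparison of
  topologies and, with \<open>W\<close> the complement of a point, definiteness of the
  distance.\<close>

lemma rdist_separates:
  assumes "open W" "p \<in> W"
  obtains e where "0 < e" "\<And>q. rdist M p q < e \<Longrightarrow> q \<in> W"
proof -
  obtain c r where c: "c \<in> atlas M" "p \<in> fst c" and r: "0 < r" "cball (snd c p) r \<subseteq> snd c ` fst c"
    and W: "chart_inv c ` cball (snd c p) r \<subseteq> W"
    by (rule chart_cball[OF assms])
  obtain l where l: "0 < l" "\<And>x u. x \<in> cball (snd c p) r \<Longrightarrow> l * norm u \<le> sqrt (gram M c x u u)"
    using gram_bounds[OF c(1) r(2)] by metis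
  show ?thesis
  proof (rule that[of "l * r"])
    show "0 < l * r"
      using l r by simp
    fix q assume q: "rdist M p q < l * r"
    have "q \<in> chart_ball c p r"
    proof (rule ccontr)
      assume *: "q \<notin> chart_ball c p r"
      obtain \<gamma> S where "pC1 0 1 \<gamma> S" "\<gamma> 0 = p" "\<gamma> 1 = q"
        "integral {0..1} (speed \<gamma>) < rdist M p q + (l * r - rdist M p q)"
        using rdist_approx[of "l * r - rdist M p q" p q] q by auto
      then show False
        using exit_length[OF c r l, of \<gamma> S] * by simp
    qed
    from chart_ball_eq[OF c(1) this] W show "q \<in> W"
      using mem_ball_imp_mem_cball by blast
  qed
qed

text \<open>The upper norm bound controls the length of coordinate segments; this is the other half
  of the comparison.\<close>

lemma rdist_small_nbhd:
  assumes "0 < e"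
  obtains U where "open U" "p \<in> U" "\<And>q. q \<in> U \<Longrightarrow> rdist M p q < e"
proof -
  obtain c r where c: "c \<in> atlas M" "p \<in> fst c" and r: "0 < r" "cball (snd c p) r \<subseteq> snd c ` fst c"
    by (rule chart_cball[OF open_UNIV UNIV_I])
  obtain L where L: "0 < L" "\<And>x u. x \<in> cball (snd c p) r \<Longrightarrow> sqrt (gram M c x u u) \<le> L * norm u"
    using gram_bounds[OF c(1) r(2)] by metis
  define s where "s = min r (e / L)"
  have s: "0 < s" "s \<le> r" "L * s \<le> e"
    using assms r L by (auto simp: s_def min_def field_simps)
  show ?thesis
  proof (rule that[of "chart_ball c p s"])
    fix q assume "q \<in> chart_ball c p s"
    note q = chart_ball_eq[OF c(1) this]
    have "rdist M (chart_inv c (snd c p)) (chart_inv c (snd c q)) \<le> L * norm (snd c q - snd c p)"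
      using q(2) s r by (intro rdist_le_chart[OF c(1) r(2) _ _ L(2)]) auto
    also have "\<dots> < L * s"
      using q(2) L(1) by (simp add: dist_norm norm_minus_commute)
    finally show "rdist M p q < e"
      using s q(1) chart_inv_chart[OF c] by simp
  qed (use c s open_chart_ball mem_chart_ball in auto)
qed

lemma rdist_eq_0: "rdist M p q = 0 \<longleftrightarrow> p = q"
proof
  assume 0: "rdist M p q = 0"
  show "p = q"
  proof (rule ccontr)
    assume "p \<noteq> q"
    then have "p \<in> - {q}"
      by simp
    then obtain e where "0 < e" "\<And>z. rdist M p z < e \<Longrightarrow> z \<in> - {q}"
      using rdist_separates[OF open_Compl[OF closed_singleton], of p q] by metis
    from this(2)[of q] this(1) 0 show False
      by simp
  qed
next
  assume pq: "p = q"
  show "rdist M p q = 0"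
  proof (rule antisym[OF field_le_epsilon rdist_nonneg])
    fix e :: real assume "0 < e"
    then obtain U where "p \<in> U" "\<And>z. z \<in> U \<Longrightarrow> rdist M p z < e"
      using rdist_small_nbhd[of e p] by metis
    from this(2)[OF this(1)] show "rdist M p q \<le> 0 + e"
      using pq by simp
  qed
qed

sublocale rd: Metric_space UNIV "rdist M"
  by unfold_locales (auto simp: rdist_nonneg rdist_eq_0 rdist_triangle intro: rdist_sym)

lemma rd_mtopology: "rd.mtopology = euclidean"
proof -
  have "openin rd.mtopology U \<longleftrightarrow> open U" for U
  proof
    assume U: "openin rd.mtopology U"
    show "open U"
      unfolding open_subopen[of U]
    proof
      fix p assume "p \<in> U"
      then obtain e where "0 < e" "rd.mball p e \<subseteq> U"
        using U unfolding rd.openin_mtopology by blast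
      moreover obtain V where "open V" "p \<in> V" "\<And>q. q \<in> V \<Longrightarrow> rdist M p q < e"
        using rdist_small_nbhd[OF \<open>0 < e\<close>, of p] by metis
      ultimately show "\<exists>T. open T \<and> p \<in> T \<and> T \<subseteq> U"
        by (intro exI[of _ V]) auto
    qed
  next
    assume U: "open U"
    show "openin rd.mtopology U"
      unfolding rd.openin_mtopology
    proof (intro conjI allI impI)
      fix p assume "p \<in> U"
      then obtain e where "0 < e" "\<And>q. rdist M p q < e \<Longrightarrow> q \<in> U"
        using rdist_separates[OF U] by metis
      then show "\<exists>r>0. rd.mball p r \<subseteq> U"
        by (intro exI[of _ e]) auto
    qed auto
  qed
  then show ?thesis
    by (simp add: topology_eq)
qed

lemma continuous_on_rdist: "continuous_on UNIV (rdist M p)"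
proof -
  have "isCont (rdist M p) q" for q
    unfolding isCont_def tendsto_iff
  proof (intro allI impI)
    fix e :: real assume "0 < e"
    then obtain U where U: "open U" "q \<in> U" "\<And>z. z \<in> U \<Longrightarrow> rdist M q z < e"
      using rdist_small_nbhd[of e q] by metis
    have "\<forall>\<^sub>F z in at q. z \<in> U"
      using U(1,2) by (rule eventually_at_in_open')
    then show "\<forall>\<^sub>F z in at q. dist (rdist M p z) (rdist M p q) < e"
    proof eventually_elim
      case (elim z)
      from U(3)[OF elim] show ?case
        using rdist_triangle[of p z q] rdist_triangle[of p q z] rdist_sym[of q z]
        by (simp add: dist_real_def abs_if)
    qed
  qed
  then show ?thesis
    by (simp add: continuous_at_imp_continuous_on)
qed

text \<open>The substitute for a minimising geodesic: on an almost shortest curve the intermediate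
  value theorem finds a point at distance exactly \<open>s\<close>, and the part of the curve before
  it has length at least \<open>s\<close>, so less than \<open>e\<close> remains.\<close>

lemma rdist_between:
  assumes "rdist M p q < s + e" "0 \<le> s" "0 < e"
  obtains z where "rdist M p z \<le> s" "rdist M z q < e"
proof (cases "rdist M p q \<le> s")
  case True
  then show ?thesis
    using assms by (intro that[of q]) (auto simp: rdist_eq_0)
next
  case False
  obtain \<gamma> S where \<gamma>: "pC1 0 1 \<gamma> S" "\<gamma> 0 = p" "\<gamma> 1 = q"
    "integral {0..1} (speed \<gamma>) < rdist M p q + (s + e - rdist M p q)"
    using rdist_approx[of "s + e - rdist M p q" p q] assms by auto
  have "continuous_on {0..1} (\<lambda>t. rdist M p (\<gamma> t))"
    by (rule continuous_on_compose2[OF continuous_on_rdist pC1_continuous_on[OF \<gamma>(1)]]) auto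
  moreover have "rdist M p (\<gamma> 0) \<le> s"
    using assms \<gamma> by (simp add: rdist_eq_0)
  ultimately obtain t where t: "0 \<le> t" "t \<le> 1" "rdist M p (\<gamma> t) = s"
    using IVT'[of "\<lambda>t. rdist M p (\<gamma> t)" 0 s 1] False \<gamma> by auto
  have "t \<noteq> 1"
    using t False \<gamma> by auto
  then have t1: "t < 1"
    using t by simp
  have "s \<le> integral {0..t} (speed \<gamma>)"
  proof (cases "t = 0")
    case True
    then show ?thesis
      using t \<gamma> by (simp add: rdist_eq_0)
  next
    case False
    then show ?thesis
      using rdist_le(1)[of 0 t \<gamma> S] pC1_subset[OF \<gamma>(1), of 0 t] t \<gamma> by simp
  qed
  moreover have "rdist M (\<gamma> t) q \<le> integral {t..1} (speed \<gamma>)"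
    using rdist_le(1)[of t 1 \<gamma> S] pC1_subset[OF \<gamma>(1), of t 1] t t1 \<gamma> by simp
  moreover have "integral {0..t} (speed \<gamma>) + integral {t..1} (speed \<gamma>) = integral {0..1} (speed \<gamma>)"
    using pC1_speed_integrable[OF \<gamma>(1)] t
    by (intro Henstock_Kurzweil_Integration.integral_combine) auto
  ultimately show ?thesis
    using \<gamma> t by (intro that[of "\<gamma> t"]) auto
qed

end

section \<open>Closed balls are compact\<close>

context Metric_space
begin

text \<open>The Hopf--Rinow--Cohn-Vossen argument: the set of radii \<open>r\<close> for which the closed ball is
  compact is closed under suprema by completeness (total boundedness is inherited from slightly
  smaller balls) and can be extended beyond any of its members by local compactness.\<close>

lemma compactin_mcball_length_space:
  assumes complete: "mcomplete"
    and loc: "\<And>x. x \<in> M \<Longrightarrow> \<exists>r>0. compactin mtopology (mcball x r)"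
    and between: "\<And>x y s e. \<lbrakk>x \<in> M; y \<in> M; d x y < s + e; 0 \<le> s; 0 < e\<rbrakk> \<Longrightarrow>
      \<exists>z\<in>M. d x z \<le> s \<and> d z y < e"
    and p: "p \<in> M"
  shows "compactin mtopology (mcball p R)"
proof (rule ccontr)
  assume R: "\<not> compactin mtopology (mcball p R)"
  define A where "A = {r. compactin mtopology (mcball p r)}"
  have down: "s \<in> A" if "r \<in> A" "s \<le> r" for r s
    using that closed_compactin[of mtopology "mcball p r" "mcball p s"] mcball_subset_concentric[of s r p]
    by (auto simp: A_def)
  have bdd: "r \<le> R" if "r \<in> A" for r
    using down[OF that, of R] R by (force simp: A_def)
  obtain r0 where r0: "0 < r0" "r0 \<in> A"
    using loc[OF p] by (auto simp: A_def)
  define \<rho> where "\<rho> = Sup A"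
  have bddA: "bdd_above A"
    using bdd by (rule bdd_aboveI)
  have "0 < \<rho>"
    using r0 cSup_upper[OF _ bddA, of r0] by (simp add: \<rho>_def)
  have below: "s \<in> A" if "s < \<rho>" for s
    using that less_cSup_iff[OF _ bddA, of s] r0 down unfolding \<rho>_def
    by (metis empty_iff less_eq_real_def)
  have tb: "mtotally_bounded (mcball p \<rho>)"
    unfolding mtotally_bounded_def
  proof (intro allI impI)
    fix \<epsilon> :: real assume \<epsilon>: "0 < \<epsilon>"
    \<comment> \<open>A compact ball of slightly smaller radius supplies the net: by
      \<open>between\<close>, each point of the ball of radius \<open>\<rho>\<close> is within
      \<epsilon>/2 of it. The maximum with 0 keeps the radius admissible for
      \<open>between\<close>.\<close>
    define s where "s = max 0 (\<rho> - \<epsilon> / 4)"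
    have s: "0 \<le> s" "s < \<rho>" "\<rho> < s + \<epsilon> / 2"
      using \<epsilon> \<open>0 < \<rho>\<close> by (auto simp: s_def)
    have tbs: "mtotally_bounded (mcball p s)"
      using below[OF s(2)] compactin_imp_mtotally_bounded by (simp add: A_def)
    have "\<exists>K. finite K \<and> K \<subseteq> mcball p s \<and> mcball p s \<subseteq> (\<Union>x\<in>K. mball x (\<epsilon> / 2))"
      using tbs \<epsilon> by (simp add: mtotally_bounded_def)
    then obtain K where K: "finite K" "K \<subseteq> mcball p s" "mcball p s \<subseteq> (\<Union>x\<in>K. mball x (\<epsilon> / 2))"
      by (elim exE conjE)
    show "\<exists>K. finite K \<and> K \<subseteq> mcball p \<rho> \<and> mcball p \<rho> \<subseteq> (\<Union>x\<in>K. mball x \<epsilon>)"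
    proof (intro exI[of _ K] conjI K(1) subsetI)
      show "x \<in> mcball p \<rho>" if "x \<in> K" for x
        using K(2) that s by auto
      fix y assume y: "y \<in> mcball p \<rho>"
      then obtain z where z: "z \<in> M" "d p z \<le> s" "d z y < \<epsilon> / 2"
        using between[OF p, of y s "\<epsilon> / 2"] s \<epsilon> by auto
      then obtain x where x: "x \<in> K" "z \<in> mball x (\<epsilon> / 2)"
        using K(3) p by auto
      then have "d x y < \<epsilon>"
        using triangle[of x z y] z y by auto
      then show "y \<in> (\<Union>x\<in>K. mball x \<epsilon>)"
        using x y by auto
    qed
  qed
  have comp: "compactin mtopology (mcball p \<rho>)"
    using tb mtotally_bounded_eq_compact_closure_of[OF complete] closure_of_closedin[OF closedin_mcball]
    by metis
  obtain rad where rad: "0 < rad x" "compactin mtopology (mcball x (rad x))" if "x \<in> M" for x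
    using loc by metis
  let ?U = "(\<lambda>x. mball x (rad x)) ` mcball p \<rho>"
  have "mcball p \<rho> \<subseteq> \<Union>?U"
    using rad by auto
  from compactinD[OF comp _ this] obtain F where F: "finite F" "F \<subseteq> ?U" "mcball p \<rho> \<subseteq> \<Union>F"
    by auto
  then obtain B where B: "finite B" "B \<subseteq> mcball p \<rho>" "F = (\<lambda>x. mball x (rad x)) ` B"
    using finite_subset_image by metis
  \<comment> \<open>The Lebesgue number gives one margin \<open>\<delta>\<close> for all centres, so
    the finite union of compact balls also covers a ball of larger radius.\<close>
  obtain \<delta> where \<delta>: "0 < \<delta>" "\<And>x. x \<in> mcball p \<rho> \<Longrightarrow> \<exists>U\<in>F. mball x \<delta> \<subseteq> U"
    using lebesgue_number[OF comp F(3)] B(3) by (metis (no_types, lifting) imageE openin_mball)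
  let ?K = "\<Union>x\<in>B. mcball x (rad x)"
  have "compactin mtopology ?K"
    using B rad(2) by (intro compactin_Union) auto
  moreover have "mcball p (\<rho> + \<delta> / 2) \<subseteq> ?K"
  proof
    fix y assume y: "y \<in> mcball p (\<rho> + \<delta> / 2)"
    then obtain z where z: "z \<in> M" "d p z \<le> \<rho>" "d z y < \<delta>"
      using between[OF p, of y \<rho> \<delta>] \<open>0 < \<rho>\<close> \<delta>(1) by auto
    then obtain x where "x \<in> B" "mball z \<delta> \<subseteq> mball x (rad x)"
      using \<delta>(2)[of z] p B(3) by auto
    then show "y \<in> ?K"
      using z y by force
  qed
  ultimately have "\<rho> + \<delta> / 2 \<in> A"
    unfolding A_def using closed_compactin[OF _ _ closedin_mcball] by blast
  then show False
    using cSup_upper[OF _ bddA, of "\<rho> + \<delta> / 2"] \<delta>(1) by (simp add: \<rho>_def)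
qed

end

lemma (in riemannian) compact_closed_ball:
  assumes "rd.mcomplete"
  shows "compact {q. rdist M p q \<le> R}"
proof -
  have "compactin rd.mtopology (rd.mcball p R)"
  proof (rule rd.compactin_mcball_length_space[OF assms])
    fix x
    obtain c r where c: "c \<in> atlas M" "x \<in> fst c" and r: "0 < r" "cball (snd c x) r \<subseteq> snd c ` fst c"
      by (rule chart_cball[OF open_UNIV UNIV_I])
    let ?V = "chart_inv c ` cball (snd c x) r"
    have V: "compact ?V"
      using c r by (intro compact_continuous_image continuous_on_subset[OF continuous_on_chart_inv]) auto
    have sub: "chart_ball c x r \<subseteq> ?V"
    proof
      fix q assume "q \<in> chart_ball c x r"
      from chart_ball_eq[OF c(1) this] show "q \<in> ?V"
        using mem_ball_imp_mem_cball by blast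
    qed
    obtain e where e: "0 < e" "\<And>q. rdist M x q < e \<Longrightarrow> q \<in> chart_ball c x r"
      using rdist_separates[OF open_chart_ball[OF c(1)] mem_chart_ball[OF c(2) r(1)]] by metis
    have "rd.mcball x (e / 2) \<subseteq> ?V"
      using e sub by force
    moreover have "compactin rd.mtopology ?V"
      unfolding rd_mtopology compactin_euclidean_iff by (rule V)
    ultimately have "compactin rd.mtopology (rd.mcball x (e / 2))"
      using closed_compactin rd.closedin_mcball by metis
    then show "\<exists>r>0. compactin rd.mtopology (rd.mcball x r)"
      using e(1) by (intro exI[of _ "e / 2"]) auto
  next
    fix x y s e
    assume "rdist M x y < s + e" "0 \<le> s" "0 < e"
    then obtain z where "rdist M x z \<le> s" "rdist M z y < e"
      by (rule rdist_between)
    then show "\<exists>z\<in>UNIV. rdist M x z \<le> s \<and> rdist M z y < e"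
      by blast
  qed auto
  moreover have "rd.mcball p R = {q. rdist M p q \<le> R}"
    by auto
  ultimately show ?thesis
    by (simp add: rd_mtopology)
qed

section \<open>Consistency of sample Frechet means along a fixed sequence\<close>

context riemannian
begin

text \<open>Young's inequality inside the squared triangle inequality. The loss is a factor close to
  1 and a term in \<open>rdist M q p\<close> alone, so the bound survives averaging over
  \<open>x\<close>; \<eta> = 1 gives crude bounds.\<close>

lemma rdist_power2_le:
  assumes "0 < \<eta>"
  shows "(rdist M x p)\<^sup>2 \<le> (1 + \<eta>) * (rdist M x q)\<^sup>2 + (1 + 1 / \<eta>) * (rdist M q p)\<^sup>2"
proof -
  let ?a = "rdist M x q" and ?b = "rdist M q p"
  have "(rdist M x p)\<^sup>2 \<le> (?a + ?b)\<^sup>2"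
    using rdist_triangle[of x p q] rdist_nonneg by (intro power_mono) auto
  also have "\<dots> \<le> (1 + \<eta>) * ?a\<^sup>2 + (1 + 1 / \<eta>) * ?b\<^sup>2"
  proof -
    have "0 \<le> (\<eta> * ?a - ?b)\<^sup>2 / \<eta>"
      using assms by simp
    also have "\<dots> = \<eta> * ?a\<^sup>2 - 2 * ?a * ?b + ?b\<^sup>2 / \<eta>"
      using assms by (simp add: power2_eq_square field_simps)
    finally show ?thesis
      by (simp add: power2_eq_square algebra_simps)
  qed
  finally show ?thesis .
qed

text \<open>Pointwise convergence on a dense set suffices because the comparison inequality holds
  for the averages with the same constants as for \<open>F\<close>; this takes the place of uniform
  convergence.\<close>

lemma frechet_mean_consistency:
  fixes F :: "'m \<Rightarrow> real"
  assumes complete: "rd.mcomplete"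
    and F: "\<And>\<eta> p q. 0 < \<eta> \<Longrightarrow> F p \<le> (1 + \<eta>) * F q + (1 + 1 / \<eta>) * (rdist M q p)\<^sup>2"
    and unique: "\<And>p. F p \<le> F \<mu> \<Longrightarrow> p = \<mu>"
    and D: "\<And>U. open U \<Longrightarrow> U \<noteq> {} \<Longrightarrow> \<exists>p\<in>D. p \<in> U"
    and conv: "\<And>p. p \<in> insert \<mu> D \<Longrightarrow> (\<lambda>n. 1 / real n * (\<Sum>k=1..n. (rdist M (x k) p)\<^sup>2)) \<longlonglongrightarrow> F p"
    and mean: "\<And>n. 1 \<le> n \<Longrightarrow> is_sample_frechet_mean M n x (m n)"
  shows "m \<longlonglongrightarrow> \<mu>"
proof (rule ccontr)
  define G where "G n p = 1 / real n * (\<Sum>k=1..n. (rdist M (x k) p)\<^sup>2)" for n p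
  have G: "G n p \<le> (1 + \<eta>) * G n q + (1 + 1 / \<eta>) * (rdist M q p)\<^sup>2" if "0 < \<eta>" "1 \<le> n" for \<eta> n p q
  proof -
    have "(\<Sum>k=1..n. (rdist M (x k) p)\<^sup>2)
        \<le> (\<Sum>k=1..n. (1 + \<eta>) * (rdist M (x k) q)\<^sup>2 + (1 + 1 / \<eta>) * (rdist M q p)\<^sup>2)"
      by (intro sum_mono rdist_power2_le that)
    also have "\<dots> = (1 + \<eta>) * (\<Sum>k=1..n. (rdist M (x k) q)\<^sup>2) + real n * ((1 + 1 / \<eta>) * (rdist M q p)\<^sup>2)"
      by (simp add: sum.distrib sum_distrib_left)
    finally show ?thesis
      using that unfolding G_def by (simp add: field_simps)
  qed
  have min: "G n (m n) \<le> G n q" if "1 \<le> n" for n q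
    using mean[OF that] unfolding is_sample_frechet_mean_def G_def by blast
  have Gmu: "(\<lambda>n. G n \<mu>) \<longlonglongrightarrow> F \<mu>"
    unfolding G_def by (rule conv) simp
  then obtain C where C: "\<And>n. G n \<mu> \<le> C"
    using convergent_imp_Bseq[THEN BseqD] unfolding convergent_def
    by (metis abs_le_D1 real_norm_def)
  \<comment> \<open>Averaging the triangle inequality between \<open>m n\<close> and
    \<open>\<mu>\<close> over the samples bounds their squared distance by 2 G(m n) + 2 G(\<mu>),
    and minimality makes this at most 4 G(\<mu>).\<close>
  have bounded: "rdist M \<mu> (m n) \<le> sqrt (4 * C)" if n: "1 \<le> n" for n
  proof -
    have "(rdist M (m n) \<mu>)\<^sup>2 \<le> 2 * (rdist M (x k) (m n))\<^sup>2 + 2 * (rdist M (x k) \<mu>)\<^sup>2" for k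
      using rdist_power2_le[of 1 "m n" \<mu> "x k"] rdist_sym[of "m n" "x k"] by simp
    then have "(\<Sum>k=1..n. (rdist M (m n) \<mu>)\<^sup>2)
        \<le> (\<Sum>k=1..n. 2 * (rdist M (x k) (m n))\<^sup>2 + 2 * (rdist M (x k) \<mu>)\<^sup>2)"
      by (intro sum_mono) auto
    then have "(rdist M (m n) \<mu>)\<^sup>2 \<le> 2 * G n (m n) + 2 * G n \<mu>"
      using n unfolding G_def by (simp add: sum.distrib field_simps flip: sum_distrib_left)
    also have "\<dots> \<le> 4 * C"
      using min[OF n, of \<mu>] C[of n] by simp
    finally show ?thesis
      using rdist_sym[of \<mu> "m n"] by (simp add: real_le_rsqrt)
  qed
  \<comment> \<open>If convergence fails, infinitely many means stay outside a neighbourhood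
    \<open>U\<close>; compactness produces a limit point \<open>q\<close> outside \<open>U\<close>,
    which is then shown to minimise \<open>F\<close>.\<close>
  assume "\<not> m \<longlonglongrightarrow> \<mu>"
  then obtain U where U: "open U" "\<mu> \<in> U" "\<not> (\<forall>\<^sub>F n in sequentially. m n \<in> U)"
    unfolding tendsto_def by blast
  then have inf: "\<exists>n\<ge>N. m n \<notin> U" for N
    unfolding eventually_sequentially by blast
  then have "\<forall>N. \<exists>n. n \<ge> Suc N \<and> m n \<notin> U"
    by blast
  from choice[OF this] obtain s where s: "\<And>N. s N \<ge> Suc N" "\<And>N. m (s N) \<notin> U"
    by blast
  let ?K = "{q. rdist M \<mu> q \<le> sqrt (4 * C)}"
  have "seq_compact ?K"
    using compact_closed_ball[OF complete] by (rule compact_imp_seq_compact)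
  moreover have "\<forall>N. m (s N) \<in> ?K"
    using bounded s(1) by (metis One_nat_def le_trans mem_Collect_eq not_less_eq_eq zero_le)
  ultimately obtain q r where q: "strict_mono r" "((\<lambda>N. m (s N)) \<circ> r) \<longlonglongrightarrow> q"
    using seq_compactE[of ?K "\<lambda>N. m (s N)"] by metis
  define t where "t N = s (r N)" for N
  have tlim: "(\<lambda>N. m (t N)) \<longlonglongrightarrow> q"
    using q(2) by (simp add: t_def comp_def)
  have t: "filterlim t at_top sequentially"
  proof (rule filterlim_at_top_mono[OF filterlim_subseq[OF q(1)]])
    show "\<forall>\<^sub>F N in sequentially. r N \<le> t N"
      using s(1) by (auto simp: t_def intro!: always_eventually intro: Suc_leD)
  qed
  have qU: "q \<notin> U"
  proof
    assume "q \<in> U"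
    then have "\<forall>\<^sub>F N in sequentially. m (t N) \<in> U"
      using tlim U(1) by (intro topological_tendstoD)
    then show False
      using s(2) by (auto simp: t_def eventually_sequentially)
  qed
  have dlim: "(\<lambda>N. rdist M p (m (t N))) \<longlonglongrightarrow> rdist M p q" for p
    using continuous_on_rdist[of p] tlim by (rule continuous_on_tendsto_compose) auto
  \<comment> \<open>The average at \<open>p\<close> is compared with the one at the sample mean, the
    latter by minimality with the one at \<open>\<mu>\<close>, and then the limit is taken.\<close>
  have step: "F p \<le> (1 + \<eta>) * F \<mu> + (1 + 1 / \<eta>) * (rdist M p q)\<^sup>2" if "p \<in> D" "0 < \<eta>" for p \<eta>
  proof (rule LIMSEQ_le)
    show "(\<lambda>N. G (t N) p) \<longlonglongrightarrow> F p"
      using conv[of p] that t unfolding G_def by (intro filterlim_compose[OF _ t]) auto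
    show "(\<lambda>N. (1 + \<eta>) * G (t N) \<mu> + (1 + 1 / \<eta>) * (rdist M p (m (t N)))\<^sup>2)
        \<longlonglongrightarrow> (1 + \<eta>) * F \<mu> + (1 + 1 / \<eta>) * (rdist M p q)\<^sup>2"
      by (intro tendsto_intros dlim filterlim_compose[OF Gmu t])
    have "G (t N) p \<le> (1 + \<eta>) * G (t N) \<mu> + (1 + 1 / \<eta>) * (rdist M p (m (t N)))\<^sup>2" for N
    proof -
      have N: "1 \<le> t N"
        using s(1)[of "r N"] by (simp add: t_def)
      have "(1 + \<eta>) * G (t N) (m (t N)) \<le> (1 + \<eta>) * G (t N) \<mu>"
        using min[OF N] that(2) by (intro mult_left_mono) auto
      then show ?thesis
        using G[OF that(2) N, of p "m (t N)"] unfolding rdist_sym[of p "m (t N)"] by linarith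
    qed
    then show "\<exists>N. \<forall>n\<ge>N. G (t n) p \<le> (1 + \<eta>) * G (t n) \<mu> + (1 + 1 / \<eta>) * (rdist M p (m (t n)))\<^sup>2"
      by blast
  qed
  \<comment> \<open>Two comparisons, from \<open>q\<close> to a nearby \<open>p\<close> in
    \<open>D\<close> and from \<open>p\<close> to the sample means, account for the square; the
    distance from \<open>p\<close> to \<open>q\<close> is sent to zero before \<eta>.\<close>
  have "F q \<le> (1 + \<eta>)\<^sup>2 * F \<mu>" if \<eta>: "0 < \<eta>" for \<eta>
  proof (rule field_le_epsilon)
    fix e :: real assume e: "0 < e"
    \<comment> \<open>\<open>K\<close> collects the coefficients of the squared distance: (1 +
      \<eta>)(1 + 1/\<eta>) + (1 + 1/\<eta>).\<close>
    define K where "K = (2 + \<eta>) * (1 + 1 / \<eta>)"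
    have K: "0 < K"
      using \<eta> by (simp add: K_def add_pos_pos)
    have "0 < sqrt (e / K)"
      using e K by simp
    then obtain V where V: "open V" "q \<in> V" "\<And>z. z \<in> V \<Longrightarrow> rdist M q z < sqrt (e / K)"
      using rdist_small_nbhd[of "sqrt (e / K)" q] by metis
    obtain p where p: "p \<in> D" "p \<in> V"
      using D[OF V(1)] V(2) by blast
    have "rdist M p q \<le> sqrt (e / K)"
      using V(3)[OF p(2)] rdist_sym[of p q] by simp
    then have "(rdist M p q)\<^sup>2 \<le> e / K"
      using rdist_nonneg[of p q] e K
      by (metis divide_nonneg_pos less_eq_real_def power_mono real_sqrt_pow2)
    then have Kd: "K * (rdist M p q)\<^sup>2 \<le> e"
      using K by (simp add: field_simps)
    have "F q \<le> (1 + \<eta>) * F p + (1 + 1 / \<eta>) * (rdist M p q)\<^sup>2"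
      by (rule F[OF \<eta>])
    also have "\<dots> \<le> (1 + \<eta>) * ((1 + \<eta>) * F \<mu> + (1 + 1 / \<eta>) * (rdist M p q)\<^sup>2) + (1 + 1 / \<eta>) * (rdist M p q)\<^sup>2"
      using step[OF p(1) \<eta>] \<eta> by (intro add_right_mono mult_left_mono) auto
    also have "\<dots> = (1 + \<eta>)\<^sup>2 * F \<mu> + K * (rdist M p q)\<^sup>2"
      unfolding K_def power2_eq_square by algebra
    finally show "F q \<le> (1 + \<eta>)\<^sup>2 * F \<mu> + e"
      using Kd by simp
  qed
  moreover have "((\<lambda>\<eta>. (1 + \<eta>)\<^sup>2 * F \<mu>) \<longlongrightarrow> (1 + 0)\<^sup>2 * F \<mu>) (at_right 0)"
    by (intro tendsto_intros)
  ultimately have "F q \<le> F \<mu>"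
    using tendsto_lowerbound[of "\<lambda>\<eta>. (1 + \<eta>)\<^sup>2 * F \<mu>" "F \<mu>" "at_right 0" "F q"]
    by (simp add: eventually_at_right_less eventually_mono[OF eventually_at_right_less])
  then show False
    using unique[of q] qU U(2) by simp
qed

end

section \<open>The maximal ergodic lemma\<close>

locale measure_preserving = prob_space M for M :: "'a measure" +
  fixes T :: "'a \<Rightarrow> 'a"
  assumes T_measurable [measurable]: "T \<in> M \<rightarrow>\<^sub>M M"
    and distr_T: "distr M M T = M"
begin

lemma integral_T:
  fixes f :: "'a \<Rightarrow> real"
  assumes [measurable]: "f \<in> borel_measurable M"
  shows "(\<integral>x. f (T x) \<partial>M) = (\<integral>x. f x \<partial>M)"
  using integral_distr[of T M M f] by (simp add: distr_T)

lemma integrable_T: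
  fixes f :: "'a \<Rightarrow> real"
  assumes "integrable M f"
  shows "integrable M (\<lambda>x. f (T x))"
  using integrable_distr[of T M M f] assms by (simp add: distr_T)

lemma T_power_measurable [measurable]: "(T ^^ n) \<in> M \<rightarrow>\<^sub>M M"
  by (induction n) auto

definition birkhoff_sum :: "('a \<Rightarrow> real) \<Rightarrow> nat \<Rightarrow> 'a \<Rightarrow> real" where
  "birkhoff_sum f n x = (\<Sum>k<n. f ((T ^^ k) x))"

lemma birkhoff_sum_measurable [measurable]:
  "f \<in> borel_measurable M \<Longrightarrow> birkhoff_sum f n \<in> borel_measurable M"
  unfolding birkhoff_sum_def by (intro borel_measurable_sum measurable_compose[OF T_power_measurable])

lemma birkhoff_sum_Suc: "birkhoff_sum f (Suc n) x = f x + birkhoff_sum f n (T x)"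
  unfolding birkhoff_sum_def by (simp only: sum.lessThan_Suc_shift funpow_Suc_right) simp

text \<open>The maximum of the first \<open>n\<close> Birkhoff sums, the empty one included.\<close>

primrec birkhoff_max :: "('a \<Rightarrow> real) \<Rightarrow> nat \<Rightarrow> 'a \<Rightarrow> real" where
  "birkhoff_max f 0 x = 0"
| "birkhoff_max f (Suc n) x = max 0 (f x + birkhoff_max f n (T x))"

lemma birkhoff_max_nonneg: "0 \<le> birkhoff_max f n x"
  by (cases n) auto

lemma birkhoff_max_Suc_mono: "birkhoff_max f n x \<le> birkhoff_max f (Suc n) x"
proof (induction n arbitrary: x)
  case (Suc n)
  have "f x + birkhoff_max f n (T x) \<le> f x + birkhoff_max f (Suc n) (T x)"
    using Suc by (intro add_left_mono)
  then show ?case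
    by (simp only: birkhoff_max.simps max.mono order_refl)
qed simp

lemma birkhoff_max_mono: "m \<le> n \<Longrightarrow> birkhoff_max f m x \<le> birkhoff_max f n x"
  by (rule lift_Suc_mono_le[of "\<lambda>n. birkhoff_max f n x"]) (rule birkhoff_max_Suc_mono)

lemma birkhoff_sum_le_max: "birkhoff_sum f n x \<le> birkhoff_max f n x"
proof (induction n arbitrary: x)
  case 0
  then show ?case by (simp add: birkhoff_sum_def)
next
  case (Suc n)
  from Suc[of "T x"] show ?case
    by (simp add: birkhoff_sum_Suc)
qed

lemma integrable_birkhoff_max:
  assumes "integrable M f"
  shows "integrable M (birkhoff_max f n)"
proof (induction n)
  case (Suc n)
  have "integrable M (\<lambda>x. max 0 (f x + birkhoff_max f n (T x)))"
    using Suc assms integrable_T by (intro integrable_max Bochner_Integration.integrable_add) auto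
  then show ?case
    by (simp add: fun_eq_iff[symmetric] cong: Bochner_Integration.integrable_cong)
qed (simp add: cong: Bochner_Integration.integrable_cong)

text \<open>Garsia's argument: where the maximum is positive it equals \<open>f x\<close> plus the
  maximum over one step less at \<open>T x\<close>, hence is at most \<open>f x\<close> plus the
  full maximum at \<open>T x\<close>; elsewhere it is zero. After integration the two maxima cancel
  by invariance.\<close>

lemma maximal_ergodic:
  assumes f: "integrable M f"
  shows "0 \<le> (\<integral>x. f x * indicator {x. 0 < birkhoff_max f n x} x \<partial>M)"
proof (cases n)
  case (Suc m)
  note int = integrable_birkhoff_max[OF f]
  have [measurable]: "f \<in> borel_measurable M" "birkhoff_max f n \<in> borel_measurable M"
    using f int[of n] by auto
  have "0 = (\<integral>x. birkhoff_max f n x - birkhoff_max f n (T x) \<partial>M)"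
    using int[of n] integrable_T[OF int[of n]] by (simp add: integral_T)
  also have "\<dots> \<le> (\<integral>x. f x * indicator {x. 0 < birkhoff_max f n x} x \<partial>M)"
  proof (rule integral_mono)
    show "integrable M (\<lambda>x. birkhoff_max f n x - birkhoff_max f n (T x))"
      using int[of n] integrable_T[OF int[of n]] by simp
    have "integrable M (\<lambda>x. f x * indicator {x\<in>space M. 0 < birkhoff_max f n x} x)"
      using f by (intro integrable_real_mult_indicator) auto
    then show "integrable M (\<lambda>x. f x * indicator {x. 0 < birkhoff_max f n x} x)"
      by (rule Bochner_Integration.integrable_cong[THEN iffD1, rotated -1]) (auto simp: indicator_def)
    fix x
    show "birkhoff_max f n x - birkhoff_max f n (T x) \<le> f x * indicator {x. 0 < birkhoff_max f n x} x"
    proof (cases "0 < birkhoff_max f n x")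
      case True
      then have "birkhoff_max f n x = f x + birkhoff_max f m (T x)"
        unfolding Suc by (auto simp: max_def split: if_splits)
      moreover have "birkhoff_max f m (T x) \<le> birkhoff_max f n (T x)"
        unfolding Suc by (rule birkhoff_max_Suc_mono)
      ultimately show ?thesis
        using True by simp
    next
      case False
      then show ?thesis
        using birkhoff_max_nonneg[of f n "T x"] by simp
    qed
  qed
  finally show ?thesis .
qed simp

text \<open>As \<open>n\<close> grows, the sets where the maximum is positive fill the space almost
  surely. Applied to a function minus a constant, this excludes that its averages keep exceeding a
  level above its mean.\<close>

lemma integral_nonneg_if_birkhoff_sum_pos:
  assumes f: "integrable M f" and pos: "AE x in M. \<exists>n. 0 < birkhoff_sum f n x"
  shows "0 \<le> (\<integral>x. f x \<partial>M)"
proof (rule LIMSEQ_le_const)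
  have [measurable]: "f \<in> borel_measurable M" "birkhoff_max f n \<in> borel_measurable M" for n
    using f integrable_birkhoff_max[OF f, of n] by auto
  show "(\<lambda>n. \<integral>x. f x * indicator {x. 0 < birkhoff_max f n x} x \<partial>M) \<longlonglongrightarrow> (\<integral>x. f x \<partial>M)"
  proof (rule integral_dominated_convergence[where w = "\<lambda>x. \<bar>f x\<bar>"])
    show "(\<lambda>x. f x * indicator {x. 0 < birkhoff_max f n x} x) \<in> borel_measurable M" for n
      by measurable
    show "integrable M (\<lambda>x. \<bar>f x\<bar>)"
      using f by simp
    show "AE x in M. norm (f x * indicator {x. 0 < birkhoff_max f n x} x) \<le> \<bar>f x\<bar>" for n
      by (auto simp: indicator_def)
    show "AE x in M. (\<lambda>n. f x * indicator {x. 0 < birkhoff_max f n x} x) \<longlonglongrightarrow> f x"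
      using pos
    proof eventually_elim
      case (elim x)
      then obtain N where N: "0 < birkhoff_sum f N x" ..
      have "f x * indicator {x. 0 < birkhoff_max f n x} x = f x" if "N \<le> n" for n
        using N birkhoff_sum_le_max[of f N x] birkhoff_max_mono[OF that, of f x] by simp
      then show ?case
        by (intro tendsto_eventually) (auto simp: eventually_sequentially)
    qed
  qed measurable
  show "\<exists>N. \<forall>n\<ge>N. 0 \<le> (\<integral>x. f x * indicator {x. 0 < birkhoff_max f n x} x \<partial>M)"
    using maximal_ergodic[OF f] by blast
qed

text \<open>The maximal ergodic lemma for \<open>f - l\<close>. The bound covers all
  \<open>n\<close> at once, which lets an L1 error control all averages.\<close>

lemma maximal_inequality:
  assumes f: "integrable M f" and nonneg: "\<And>x. 0 \<le> f x" and l: "0 < l"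
  shows "prob {x\<in>space M. \<exists>n. real n * l < birkhoff_sum f n x} \<le> (\<integral>x. f x \<partial>M) / l"
proof -
  have [measurable]: "f \<in> borel_measurable M"
    using f by auto
  define g where "g x = f x - l" for x
  have g: "integrable M g"
    unfolding g_def using f by simp
  have [measurable]: "g \<in> borel_measurable M" "birkhoff_max g n \<in> borel_measurable M" for n
    using g integrable_birkhoff_max[OF g, of n] by auto
  define E where "E n = {x\<in>space M. 0 < birkhoff_max g n x}" for n
  have [measurable]: "E n \<in> sets M" for n
    unfolding E_def by measurable
  have bound: "prob (E n) \<le> (\<integral>x. f x \<partial>M) / l" for n
  proof -
    have "0 \<le> (\<integral>x. g x * indicator {x. 0 < birkhoff_max g n x} x \<partial>M)"
      by (rule maximal_ergodic[OF g])
    also have "\<dots> = (\<integral>x. f x * indicator (E n) x - l * indicator (E n) x \<partial>M)"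
      by (intro Bochner_Integration.integral_cong) (auto simp: g_def E_def indicator_def)
    also have "\<dots> = (\<integral>x. f x * indicator (E n) x \<partial>M) - l * prob (E n)"
      using f by (subst Bochner_Integration.integral_diff)
        (auto intro!: integrable_real_mult_indicator simp: finite_measure.emeasure_finite less_top[symmetric])
    also have "(\<integral>x. f x * indicator (E n) x \<partial>M) \<le> (\<integral>x. f x \<partial>M)"
      using f nonneg by (intro integral_mono integrable_real_mult_indicator) (auto simp: indicator_def)
    finally show ?thesis
      using l by (simp add: field_simps)
  qed
  have sub: "{x\<in>space M. \<exists>n. real n * l < birkhoff_sum f n x} \<subseteq> (\<Union>n. E n)"
  proof clarsimp
    fix x n assume x: "x \<in> space M" and "real n * l < birkhoff_sum f n x"
    then have "0 < birkhoff_sum g n x"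
      unfolding birkhoff_sum_def g_def by (simp add: sum_subtractf)
    then show "\<exists>n. x \<in> E n"
      using birkhoff_sum_le_max[of g n x] x by (auto simp: E_def intro!: exI[of _ n])
  qed
  have "incseq E"
    using birkhoff_max_mono by (fastforce simp: E_def incseq_def intro: less_le_trans)
  then have "(\<lambda>n. prob (E n)) \<longlonglongrightarrow> prob (\<Union>n. E n)"
    by (intro finite_Lim_measure_incseq) auto
  then have "prob (\<Union>n. E n) \<le> (\<integral>x. f x \<partial>M) / l"
    by (rule LIMSEQ_le_const2) (use bound in blast)
  moreover have "prob {x\<in>space M. \<exists>n. real n * l < birkhoff_sum f n x} \<le> prob (\<Union>n. E n)"
    by (rule finite_measure_mono[OF sub]) auto
  ultimately show ?thesis
    by simp
qed

end

section \<open>Stationary autoregression on a vector space\<close>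

text \<open>The innovation sequence is realised on the product space, an initial value with the
  invariant law \<open>\<nu>\<close> on an extra factor; one step of the recursion is then a measure preserving
  map of the product.\<close>

locale autoregression =
  fixes \<rho> \<nu> :: "'e::euclidean_space measure" and \<phi> :: real
  assumes prob_\<rho>: "prob_space \<rho>" and prob_\<nu>: "prob_space \<nu>"
    and sets_\<rho> [simp, measurable_cong]: "sets \<rho> = sets borel"
    and sets_\<nu> [simp, measurable_cong]: "sets \<nu> = sets borel"
    and \<phi>: "\<bar>\<phi>\<bar> < 1"
    and invariant: "distr (\<nu> \<Otimes>\<^sub>M \<rho>) borel (\<lambda>(y, e). \<phi> *\<^sub>R y + e) = \<nu>"
begin

lemma space_\<rho> [simp]: "space \<rho> = UNIV" and space_\<nu> [simp]: "space \<nu> = UNIV"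
  using sets_eq_imp_space_eq[OF sets_\<rho>] sets_eq_imp_space_eq[OF sets_\<nu>] by auto

sublocale R: prob_space \<rho> by (rule prob_\<rho>)
sublocale N: prob_space \<nu> by (rule prob_\<nu>)
sublocale seq: sequence_space \<rho> ..

abbreviation Q :: "('e \<times> (nat \<Rightarrow> 'e)) measure" where
  "Q \<equiv> \<nu> \<Otimes>\<^sub>M seq.S"

sublocale Q: pair_prob_space \<nu> seq.S ..

definition step :: "'e \<times> (nat \<Rightarrow> 'e) \<Rightarrow> 'e \<times> (nat \<Rightarrow> 'e)" where
  "step = (\<lambda>(y, e). (\<phi> *\<^sub>R y + e 0, \<lambda>n. e (Suc n)))"

lemma space_S [simp]: "space seq.S = UNIV"
  by (simp add: space_PiM)

lemma step_measurable: "step \<in> Q \<rightarrow>\<^sub>M Q"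
  unfolding step_def case_prod_beta
proof (rule measurable_Pair)
  show "(\<lambda>x. \<lambda>n. snd x (Suc n)) \<in> Q \<rightarrow>\<^sub>M seq.S"
    by (rule measurable_PiM_single') (auto simp: space_PiM)
qed measurable

text \<open>Splitting off the first innovation leaves a sequence of the same product law,
  independent of it. The new first component depends only on the initial value and that innovation,
  and has law \<nu> by \<open>invariant\<close>.\<close>

lemma distr_step: "distr Q Q step = Q"
proof (rule pair_measure_eqI[symmetric])
  fix A B assume A [measurable]: "A \<in> sets \<nu>" and B [measurable]: "B \<in> sets seq.S"
  from A B have AB: "A \<times> B \<in> sets Q"
    by (rule pair_measureI)
  note [measurable] = step_measurable AB
  have cn [measurable]: "(\<lambda>(s, \<omega>). case_nat s \<omega>) \<in> \<rho> \<Otimes>\<^sub>M seq.S \<rightarrow>\<^sub>M seq.S"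
    by measurable
  have sh [measurable]: "(\<lambda>e n. e (Suc n)) \<in> seq.S \<rightarrow>\<^sub>M seq.S"
    by (rule measurable_PiM_single') (auto simp: space_PiM)
  have "emeasure (distr Q Q step) (A \<times> B) = (\<integral>\<^sup>+z. indicator (A \<times> B) z \<partial>distr Q Q step)"
    by (intro nn_integral_indicator[symmetric]) (simp only: sets_distr AB)
  also have "\<dots> = (\<integral>\<^sup>+z. indicator (A \<times> B) (step z) \<partial>Q)"
    by (rule nn_integral_distr) measurable
  also have "\<dots> = (\<integral>\<^sup>+z. indicator A (\<phi> *\<^sub>R fst z + snd z 0) * indicator B (\<lambda>n. snd z (Suc n)) \<partial>Q)"
    by (intro nn_integral_cong) (auto simp: step_def indicator_def split: prod.split)
  also have "\<dots> = (\<integral>\<^sup>+y. \<integral>\<^sup>+e. indicator A (\<phi> *\<^sub>R y + e 0) * indicator B (\<lambda>n. e (Suc n)) \<partial>seq.S \<partial>\<nu>)"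
    by (subst seq.P.nn_integral_fst[symmetric]) (auto intro!: measurable_compose[OF measurable_snd sh])
  also have "\<dots> = (\<integral>\<^sup>+y. \<integral>\<^sup>+s. indicator A (\<phi> *\<^sub>R y + s) * emeasure seq.S B \<partial>\<rho> \<partial>\<nu>)"
  proof (intro nn_integral_cong)
    fix y
    have [measurable]: "(\<lambda>e. indicator B (\<lambda>n. e (Suc n)) :: ennreal) \<in> borel_measurable seq.S"
      by (rule measurable_compose[OF sh]) simp
    have "(\<integral>\<^sup>+e. indicator A (\<phi> *\<^sub>R y + e 0) * indicator B (\<lambda>n. e (Suc n)) \<partial>seq.S)
        = (\<integral>\<^sup>+e. indicator A (\<phi> *\<^sub>R y + e 0) * indicator B (\<lambda>n. e (Suc n))
            \<partial>distr (\<rho> \<Otimes>\<^sub>M seq.S) seq.S (\<lambda>(s, \<omega>). case_nat s \<omega>))"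
      by (simp only: seq.PiM_iter)
    also have "\<dots> = (\<integral>\<^sup>+z. indicator A (\<phi> *\<^sub>R y + fst z) * indicator B (snd z) \<partial>(\<rho> \<Otimes>\<^sub>M seq.S))"
      by (subst nn_integral_distr) (auto simp: case_prod_beta)
    also have "\<dots> = (\<integral>\<^sup>+s. \<integral>\<^sup>+e. indicator A (\<phi> *\<^sub>R y + s) * indicator B e \<partial>seq.S \<partial>\<rho>)"
      by (subst seq.P.nn_integral_fst[symmetric]) auto
    also have "\<dots> = (\<integral>\<^sup>+s. indicator A (\<phi> *\<^sub>R y + s) * emeasure seq.S B \<partial>\<rho>)"
      by (intro nn_integral_cong) (simp add: nn_integral_cmult)
    finally show "(\<integral>\<^sup>+e. indicator A (\<phi> *\<^sub>R y + e 0) * indicator B (\<lambda>n. e (Suc n)) \<partial>seq.S)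
        = (\<integral>\<^sup>+s. indicator A (\<phi> *\<^sub>R y + s) * emeasure seq.S B \<partial>\<rho>)" .
  qed
  also have "\<dots> = (\<integral>\<^sup>+y. \<integral>\<^sup>+s. indicator A (\<phi> *\<^sub>R y + s) \<partial>\<rho> \<partial>\<nu>) * emeasure seq.S B"
    by (simp add: nn_integral_multc)
  also have "(\<integral>\<^sup>+y. \<integral>\<^sup>+s. indicator A (\<phi> *\<^sub>R y + s) \<partial>\<rho> \<partial>\<nu>)
      = (\<integral>\<^sup>+z. indicator A (\<phi> *\<^sub>R fst z + snd z) \<partial>(\<nu> \<Otimes>\<^sub>M \<rho>))"
    by (subst R.nn_integral_fst[symmetric]) auto
  also have "\<dots> = (\<integral>\<^sup>+y. indicator A y \<partial>distr (\<nu> \<Otimes>\<^sub>M \<rho>) borel (\<lambda>(y, e). \<phi> *\<^sub>R y + e))"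
    by (subst nn_integral_distr) (auto simp: case_prod_beta)
  also have "\<dots> = emeasure \<nu> A"
    unfolding invariant using A by (rule nn_integral_indicator)
  finally show "emeasure \<nu> A * emeasure seq.S B = emeasure (distr Q Q step) (A \<times> B)"
    by simp
qed (auto simp: N.sigma_finite_measure_axioms seq.P.sigma_finite_measure_axioms)

sublocale mp: measure_preserving Q step
  by unfold_locales (auto simp: step_measurable distr_step)

definition Y :: "nat \<Rightarrow> 'e \<times> (nat \<Rightarrow> 'e) \<Rightarrow> 'e" where
  "Y k z = fst ((step ^^ k) z)"

lemma Y_measurable [measurable]: "Y k \<in> Q \<rightarrow>\<^sub>M borel"
  unfolding Y_def by (intro measurable_compose[OF mp.T_power_measurable]) measurable

lemma snd_step_power: "snd ((step ^^ k) z) n = snd z (n + k)"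
  by (induction k arbitrary: n) (auto simp: step_def case_prod_beta)

lemma Y_0 [simp]: "Y 0 z = fst z"
  by (simp add: Y_def)

lemma Y_Suc: "Y (Suc k) z = \<phi> *\<^sub>R Y k z + snd z k"
  using snd_step_power[of k z 0] by (simp add: Y_def step_def case_prod_beta)

lemma birkhoff_sum_Y: "mp.birkhoff_sum (\<lambda>z. f (fst z)) n z = (\<Sum>k<n. f (Y k z))"
  unfolding mp.birkhoff_sum_def Y_def ..

lemma integral_fst:
  fixes f :: "'e \<Rightarrow> real"
  assumes [measurable]: "f \<in> borel_measurable \<nu>"
  shows "(\<integral>z. f (fst z) \<partial>Q) = (\<integral>y. f y \<partial>\<nu>)"
  using integral_distr[of fst Q \<nu> f] by (simp add: seq.P.distr_pair_fst)

lemma integrable_fst: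
  fixes f :: "'e \<Rightarrow> real"
  assumes "integrable \<nu> f"
  shows "integrable Q (\<lambda>z. f (fst z))"
  using integrable_distr[of fst Q \<nu> f] assms by (simp add: seq.P.distr_pair_fst)

lemma AE_snd:
  assumes "AE e in seq.S. P e"
  shows "AE z in Q. P (snd z)"
proof (rule AE_distrD[of snd Q seq.S])
  have "distr Q seq.S snd = seq.S"
  proof (rule measure_eqI)
    fix A assume A: "A \<in> sets (distr Q seq.S snd)"
    then have "snd -` A \<inter> space Q = space \<nu> \<times> A"
      by (auto simp: space_pair_measure)
    then show "emeasure (distr Q seq.S snd) A = emeasure seq.S A"
      using A by (simp add: emeasure_distr seq.P.emeasure_pair_measure_Times N.emeasure_space_1[simplified])
  qed simp
  then show "AE e in distr Q seq.S snd. P e"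
    using assms by (simp only:)
qed simp

text \<open>Averages begin at time 0, to match Birkhoff sums; times \<open>1..n\<close> are reached
  later through invariance of \<open>Q\<close> under \<open>step\<close>.\<close>

definition LLN :: "('e \<Rightarrow> real) \<Rightarrow> bool" where
  "LLN f \<longleftrightarrow> (AE z in Q. (\<lambda>n. 1 / real n * (\<Sum>k<n. f (Y k z))) \<longlonglongrightarrow> (\<integral>y. f y \<partial>\<nu>))"

end

section \<open>The strong law for functions of a stationary autoregression\<close>

text \<open>A form of \<open>limsup a > c\<close> that is stable under perturbations tending to zero.\<close>

definition exceeds :: "real \<Rightarrow> (nat \<Rightarrow> real) \<Rightarrow> bool" where
  "exceeds c a \<longleftrightarrow> (\<exists>j. \<forall>N. \<exists>n\<ge>N. c + 1 / real (Suc j) < a n)"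

lemma exceeds_perturb:
  assumes "exceeds c a" "(\<lambda>n. a n - b n) \<longlonglongrightarrow> 0"
  shows "exceeds c b"
proof -
  obtain j where j: "\<And>N. \<exists>n\<ge>N. c + 1 / real (Suc j) < a n"
    using assms(1) unfolding exceeds_def by blast
  \<comment> \<open>Passing from \<open>j\<close> to \<open>Suc j\<close> lowers the margin by
    \<open>\<delta>\<close>, which is the room for the perturbation.\<close>
  define \<delta> where "\<delta> = 1 / real (Suc j) - 1 / real (Suc (Suc j))"
  have "1 / real (Suc (Suc j)) < 1 / real (Suc j)"
    by (intro divide_strict_left_mono) auto
  then have "0 < \<delta>"
    unfolding \<delta>_def by simp
  then obtain N0 where N0: "\<And>n. N0 \<le> n \<Longrightarrow> \<bar>a n - b n\<bar> < \<delta>"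
    using LIMSEQ_D[OF assms(2)] by auto
  have "\<exists>n\<ge>N. c + 1 / real (Suc (Suc j)) < b n" for N
  proof -
    obtain n where n: "max N N0 \<le> n" "c + 1 / real (Suc j) < a n"
      using j by blast
    have "N0 \<le> n"
      using n(1) by simp
    from N0[OF this] n show ?thesis
      unfolding \<delta>_def by (intro exI[of _ n]) (auto simp: abs_less_iff)
  qed
  then show ?thesis
    unfolding exceeds_def by blast
qed

lemma exceeds_iff_perturb:
  assumes "(\<lambda>n. a n - b n) \<longlonglongrightarrow> 0"
  shows "exceeds c a \<longleftrightarrow> exceeds c b"
proof -
  have "(\<lambda>n. b n - a n) \<longlonglongrightarrow> 0"
    using tendsto_minus[OF assms] by simp
  then show ?thesis
    using assms exceeds_perturb by blast
qed

definition average :: "('e \<Rightarrow> real) \<Rightarrow> (nat \<Rightarrow> 'e) \<Rightarrow> nat \<Rightarrow> real" where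
  "average g u n = 1 / real n * (\<Sum>k<n. g (u k))"

text \<open>Trajectories driven by the same innovations approach each other geometrically, so the
  differences of a Lipschitz function are summable and vanish after division by \<open>n\<close>.
  The recursion is asked for from \<open>m\<close> on, so finitely many innovations may
  differ.\<close>

lemma average_contraction:
  fixes u v :: "nat \<Rightarrow> 'e::real_normed_vector"
  assumes \<phi>: "\<bar>\<phi>\<bar> < 1"
    and step: "\<And>k. m \<le> k \<Longrightarrow> u (Suc k) - v (Suc k) = \<phi> *\<^sub>R (u k - v k)"
    and g: "\<And>x y. \<bar>g x - g y\<bar> \<le> L * norm (x - y)"
  shows "(\<lambda>n. average g u n - average g v n) \<longlonglongrightarrow> 0"
proof -
  have norm: "norm (u (k + m) - v (k + m)) = \<bar>\<phi>\<bar> ^ k * norm (u m - v m)" for k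
    by (induction k) (simp_all add: step)
  define D where "D k = g (u k) - g (v k)" for k
  have "summable (\<lambda>k. D (k + m))"
  proof (rule summable_comparison_test')
    show "summable (\<lambda>k. L * norm (u m - v m) * \<bar>\<phi>\<bar> ^ k)"
      using \<phi> by (intro summable_mult summable_geometric) simp
    show "norm (D (k + m)) \<le> L * norm (u m - v m) * \<bar>\<phi>\<bar> ^ k" for k
      using g[of "u (k + m)" "v (k + m)"] norm[of k] by (simp add: D_def mult_ac)
  qed
  then have "summable D"
    by (simp only: summable_iff_shift)
  then have "(\<lambda>n. \<Sum>k<n. D k) \<longlonglongrightarrow> suminf D"
    by (rule summable_LIMSEQ)
  moreover have "(\<lambda>n. 1 / real n) \<longlonglongrightarrow> 0"
    by (rule lim_1_over_n)
  ultimately have "(\<lambda>n. 1 / real n * (\<Sum>k<n. D k)) \<longlonglongrightarrow> 0 * suminf D"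
    by (intro tendsto_mult)
  then show ?thesis
    by (simp add: average_def D_def sum_subtractf right_diff_distrib)
qed

context autoregression
begin

lemma LLN_average: "LLN f \<longleftrightarrow> (AE z in Q. average f (\<lambda>k. Y k z) \<longlonglongrightarrow> (\<integral>y. f y \<partial>\<nu>))"
  unfolding LLN_def average_def ..

text \<open>Starting afresh at time \<open>m\<close> makes the process depend only on the innovations from \<open>m\<close> on
  and, by contraction, does not change the limiting behaviour of averages.  This is what puts the
  exceedance events below into the tail \<open>\<sigma>\<close>-algebra.\<close>

primrec late :: "nat \<Rightarrow> nat \<Rightarrow> (nat \<Rightarrow> 'e) \<Rightarrow> 'e" where
  "late m 0 e = 0"
| "late m (Suc k) e = \<phi> *\<^sub>R late m k e + (if m \<le> k then e k else 0)"

abbreviation (input) coord_sets :: "nat \<Rightarrow> (nat \<Rightarrow> 'e) set set" where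
  "coord_sets i \<equiv> {(\<lambda>e. e i) -` A \<inter> space seq.S | A. A \<in> sets \<rho>}"

lemma indep_coord_sets: "seq.indep_sets coord_sets UNIV"
proof -
  have "distr seq.S \<rho> (\<lambda>e. e i) = \<rho>" for i
    by (rule distr_PiM_component[of UNIV "\<lambda>_. \<rho>"]) (auto simp: prob_\<rho>)
  moreover have "(\<lambda>e :: nat \<Rightarrow> 'e. \<lambda>i\<in>UNIV. e i) = (\<lambda>e. e)"
    by (simp add: restrict_def)
  ultimately have "distr seq.S (PiM UNIV (\<lambda>i. \<rho>)) (\<lambda>e. \<lambda>i\<in>UNIV. e i)
      = (\<Pi>\<^sub>M i\<in>UNIV. distr seq.S \<rho> (\<lambda>e. e i))"
    by (simp only: distr_id2)
  then have "seq.indep_vars (\<lambda>_. \<rho>) (\<lambda>i e. e i) UNIV"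
    by (subst seq.P.indep_vars_iff_distr_eq_PiM) auto
  then show ?thesis
    unfolding seq.P.indep_vars_def2 by blast
qed

lemma late_in_tail:
  assumes [measurable]: "g \<in> borel_measurable borel"
    and g: "\<And>x y. \<bar>g x - g y\<bar> \<le> L * norm (x - y)"
  shows "{e. exceeds c (average g (\<lambda>k. late 0 k e))} \<in> seq.tail_events coord_sets"
  unfolding seq.P.tail_events_def
proof
  fix m
  \<comment> \<open>The sigma-algebra of the coordinates from \<open>m\<close> on, for which
    \<open>late m\<close> is measurable.\<close>
  define N where "N = sigma UNIV (\<Union> (coord_sets ` {m..}))"
  have N: "sets N = sigma_sets UNIV (\<Union> (coord_sets ` {m..}))" "space N = UNIV"
    unfolding N_def by auto
  have coord: "(\<lambda>e. e i) \<in> N \<rightarrow>\<^sub>M borel" if "m \<le> i" for i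
  proof (rule measurableI)
    fix A :: "'e set" assume "A \<in> sets borel"
    then have "(\<lambda>e. e i) -` A \<inter> space N \<in> \<Union> (coord_sets ` {m..})"
      using that N(2) by auto
    then show "(\<lambda>e. e i) -` A \<inter> space N \<in> sets N"
      unfolding N(1) by (rule sigma_sets.Basic)
  qed simp
  have [measurable]: "late m k \<in> N \<rightarrow>\<^sub>M borel" for k
  proof (induction k)
    case (Suc k)
    have "(\<lambda>e. if m \<le> k then e k else 0) \<in> N \<rightarrow>\<^sub>M borel"
      using coord by (cases "m \<le> k") auto
    with Suc have "(\<lambda>e. \<phi> *\<^sub>R late m k e + (if m \<le> k then e k else 0)) \<in> N \<rightarrow>\<^sub>M borel"
      by measurable
    then show ?case
      by (simp only: late.simps(2)[abs_def])
  qed (simp add: late.simps(1)[abs_def])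
  have "exceeds c (average g (\<lambda>k. late 0 k e)) \<longleftrightarrow> exceeds c (average g (\<lambda>k. late m k e))" for e
    by (intro exceeds_iff_perturb average_contraction[OF \<phi> _ g, of m]) (auto simp: algebra_simps)
  moreover have "{e \<in> space N. exceeds c (average g (\<lambda>k. late m k e))} \<in> sets N"
    unfolding exceeds_def average_def by measurable
  ultimately show "{e. exceeds c (average g (\<lambda>k. late 0 k e))}
      \<in> sigma_sets (space seq.S) (\<Union> (coord_sets ` {m..}))"
    using N by simp
qed

text \<open>\<open>Y\<close> and \<open>late 0\<close> have the same innovations and differ in the
  initial value only, which averages forget; so the event is the preimage of a tail event of the
  independent coordinates.\<close>

lemma zero_one:
  assumes [measurable]: "g \<in> borel_measurable borel"
    and g: "\<And>x y. \<bar>g x - g y\<bar> \<le> L * norm (x - y)"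
  shows "(AE z in Q. exceeds c (average g (\<lambda>k. Y k z))) \<or> (AE z in Q. \<not> exceeds c (average g (\<lambda>k. Y k z)))"
proof -
  let ?V = "{e. exceeds c (average g (\<lambda>k. late 0 k e))}"
  have tail: "?V \<in> seq.tail_events coord_sets"
    by (rule late_in_tail[OF assms])
  have sa: "sigma_algebra (space seq.S) (coord_sets i)" for i
  proof -
    have "coord_sets i = sets (vimage_algebra (space seq.S) (\<lambda>e. e i) \<rho>)"
      by (subst sets_vimage_algebra2) auto
    then show ?thesis
      using sets.sigma_algebra_axioms[of "vimage_algebra (space seq.S) (\<lambda>e. e i) \<rho>"]
      by (simp only: space_vimage_algebra)
  qed
  have "coord_sets i \<subseteq> sets seq.S" for i
  proof clarify
    fix A assume "A \<in> sets \<rho>"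
    then show "(\<lambda>e. e i) -` A \<inter> space seq.S \<in> sets seq.S"
      by (intro measurable_sets[of "\<lambda>e. e i" seq.S \<rho>] measurable_component_singleton) auto
  qed
  then have V: "?V \<in> sets seq.S"
    using seq.P.tail_events_sets[of coord_sets] tail by blast
  have "seq.prob ?V = 0 \<or> seq.prob ?V = 1"
    by (rule seq.P.kolmogorov_0_1_law[OF sa indep_coord_sets tail])
  then have "(AE e in seq.S. e \<notin> ?V) \<or> (AE e in seq.S. e \<in> ?V)"
    using seq.P.prob_eq_0[OF V] seq.P.prob_eq_1[OF V] by blast
  then have "(AE z in Q. snd z \<in> ?V) \<or> (AE z in Q. snd z \<notin> ?V)"
    using AE_snd by blast
  moreover have "snd z \<in> ?V \<longleftrightarrow> exceeds c (average g (\<lambda>k. Y k z))" for z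
    unfolding mem_Collect_eq
    by (intro exceeds_iff_perturb average_contraction[OF \<phi> _ g, of 0]) (auto simp: algebra_simps Y_Suc)
  ultimately show ?thesis
    by simp
qed

text \<open>By the 0-1 law exceedance would otherwise occur almost surely; then some Birkhoff sum of
  \<open>g - ?c\<close> is positive almost surely, so this function has nonnegative mean, whereas
  its mean is \<open>- \<delta>\<close>.\<close>

lemma averages_not_exceeding:
  assumes [measurable]: "g \<in> borel_measurable borel"
    and g: "\<And>x y. \<bar>g x - g y\<bar> \<le> L * norm (x - y)"
    and int: "integrable \<nu> g" and \<delta>: "0 < \<delta>"
  shows "AE z in Q. \<not> exceeds ((\<integral>y. g y \<partial>\<nu>) + \<delta>) (average g (\<lambda>k. Y k z))"
proof (rule ccontr)
  let ?c = "(\<integral>y. g y \<partial>\<nu>) + \<delta>"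
  assume "\<not> ?thesis"
  then have exc: "AE z in Q. exceeds ?c (average g (\<lambda>k. Y k z))"
    using zero_one[OF assms(1) g, of ?c] by blast
  have int': "integrable \<nu> (\<lambda>y. g y - ?c)"
    using int by simp
  have "0 \<le> (\<integral>z. g (fst z) - ?c \<partial>Q)"
  proof (rule mp.integral_nonneg_if_birkhoff_sum_pos)
    show "integrable Q (\<lambda>z. g (fst z) - ?c)"
      using integrable_fst[OF int'] by simp
    show "AE z in Q. \<exists>n. 0 < mp.birkhoff_sum (\<lambda>z. g (fst z) - ?c) n z"
      using exc
    proof eventually_elim
      case (elim z)
      then obtain j where "\<And>N. \<exists>n\<ge>N. ?c + 1 / real (Suc j) < average g (\<lambda>k. Y k z) n"
        unfolding exceeds_def by blast
      then obtain n where n: "1 \<le> n" "?c + 1 / real (Suc j) < average g (\<lambda>k. Y k z) n"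
        by blast
      have "?c < average g (\<lambda>k. Y k z) n"
        by (rule le_less_trans[OF _ n(2)]) simp
      then have "real n * ?c < (\<Sum>k<n. g (Y k z))"
        using n(1) by (simp add: average_def field_simps)
      then have "0 < mp.birkhoff_sum (\<lambda>z. g (fst z) - ?c) n z"
        unfolding birkhoff_sum_Y[of "\<lambda>y. g y - ?c"] by (simp add: sum_subtractf)
      then show ?case ..
    qed
  qed
  also have "(\<integral>z. g (fst z) - ?c \<partial>Q) = (\<integral>y. g y - ?c \<partial>\<nu>)"
    by (rule integral_fst[of "\<lambda>y. g y - ?c"]) simp
  also have "\<dots> = - \<delta>"
    using int by (simp add: N.prob_space[simplified])
  finally show False
    using \<delta> by simp
qed

lemma LLN_Lipschitz:
  assumes [measurable]: "g \<in> borel_measurable borel"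
    and g: "\<And>x y. \<bar>g x - g y\<bar> \<le> L * norm (x - y)"
    and int: "integrable \<nu> g"
  shows "LLN g"
  unfolding LLN_average
proof -
  let ?I = "\<integral>y. g y \<partial>\<nu>"
  have up: "AE z in Q. \<forall>i. \<not> exceeds (?I + 1 / real (Suc i)) (average g (\<lambda>k. Y k z))"
    unfolding AE_all_countable by (intro allI averages_not_exceeding[OF assms]) simp
  have "AE z in Q. \<not> exceeds ((\<integral>y. - g y \<partial>\<nu>) + 1 / real (Suc i)) (average (\<lambda>y. - g y) (\<lambda>k. Y k z))" for i
  proof (rule averages_not_exceeding)
    show "\<bar>- g x - - g y\<bar> \<le> L * norm (x - y)" for x y
      using g[of x y] by simp
  qed (use int in simp_all)
  then have low: "AE z in Q. \<forall>i. \<not> exceeds (- ?I + 1 / real (Suc i)) (\<lambda>n. - average g (\<lambda>k. Y k z) n)"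
    unfolding AE_all_countable by (simp add: average_def[abs_def] sum_negf)
  show "AE z in Q. average g (\<lambda>k. Y k z) \<longlonglongrightarrow> ?I"
    using up low
  proof eventually_elim
    case (elim z)
    let ?a = "average g (\<lambda>k. Y k z)"
    show ?case
    proof (rule LIMSEQ_I)
      fix r :: real assume "0 < r"
      then obtain i where i: "1 / real (Suc i) < r / 2"
        using nat_approx_posE[of "r / 2"] by auto
      \<comment> \<open>One \<open>1 / real (Suc i)\<close> is the level tested, the other is the
        margin in the definition of \<open>exceeds\<close>, taken at \<open>j = i\<close>.\<close>
      obtain N1 where N1: "\<And>n. N1 \<le> n \<Longrightarrow> ?a n \<le> ?I + 1 / real (Suc i) + 1 / real (Suc i)"
        using elim(1) unfolding exceeds_def not_ex not_all not_less by (metis not_le)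
      obtain N2 where N2: "\<And>n. N2 \<le> n \<Longrightarrow> - ?a n \<le> - ?I + 1 / real (Suc i) + 1 / real (Suc i)"
        using elim(2) unfolding exceeds_def not_ex not_all not_less by (metis not_le)
      show "\<exists>no. \<forall>n\<ge>no. norm (?a n - ?I) < r"
      proof (intro exI allI impI)
        fix n assume n: "max N1 N2 \<le> n"
        then show "norm (?a n - ?I) < r"
          using N1[of n] N2[of n] i by (simp add: abs_less_iff)
      qed
    qed
  qed
qed

text \<open>The Banach principle: the maximal inequality controls, for all \<open>n\<close>
  simultaneously, the averages of the error by its L1 norm. The exceptional set for \<open>f\<close>
  has probability at most that norm divided by \<open>\<delta>\<close>, which tends to 0 along the
  approximation.\<close>

lemma LLN_L1_limit:
  assumes f: "integrable \<nu> f" and s: "\<And>i. integrable \<nu> (s i)"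
    and lim: "(\<lambda>i::nat. \<integral>y. \<bar>f y - s i y\<bar> \<partial>\<nu>) \<longlonglongrightarrow> 0"
    and LLN: "\<And>i. LLN (s i)"
  shows "LLN f"
proof -
  let ?I = "\<integral>y. f y \<partial>\<nu>"
  have [measurable]: "f \<in> borel_measurable borel" "s i \<in> borel_measurable borel" for i
    using f s[of i] by (auto dest!: borel_measurable_integrable)
  have bad_null: "AE z in Q. \<exists>N. \<forall>n\<ge>N. \<bar>average f (\<lambda>k. Y k z) n - ?I\<bar> \<le> 3 * \<delta>" if \<delta>: "0 < \<delta>" for \<delta>
  proof -
    \<comment> \<open>Of the three parts of a deviation above \<open>3 * \<delta>\<close>, the
      averages of \<open>s i\<close> about their mean (for large \<open>n\<close>) and the
      difference of the means are below \<open>\<delta>\<close>, so the averages of the error exceed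
      \<open>\<delta>\<close>.\<close>
    define B where "B = {z\<in>space Q. \<not> (\<exists>N. \<forall>n\<ge>N. \<bar>average f (\<lambda>k. Y k z) n - ?I\<bar> \<le> 3 * \<delta>)}"
    have [measurable]: "B \<in> sets Q"
      unfolding B_def average_def by measurable
    have bound: "Q.prob B \<le> (\<integral>y. \<bar>f y - s i y\<bar> \<partial>\<nu>) / \<delta>"
      if i: "(\<integral>y. \<bar>f y - s i y\<bar> \<partial>\<nu>) < \<delta>" for i
    proof -
      define h where "h y = \<bar>f y - s i y\<bar>" for y
      have h: "integrable \<nu> h"
        unfolding h_def using f s by simp
      have [measurable]: "h \<in> borel_measurable borel"
        unfolding h_def by measurable
      let ?C = "{z\<in>space Q. \<exists>n. real n * \<delta> < mp.birkhoff_sum (\<lambda>z. h (fst z)) n z}"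
      have mean: "\<bar>(\<integral>y. s i y \<partial>\<nu>) - ?I\<bar> < \<delta>"
      proof -
        have "\<bar>(\<integral>y. s i y \<partial>\<nu>) - ?I\<bar> = \<bar>\<integral>y. f y - s i y \<partial>\<nu>\<bar>"
          using f s by simp
        also have "\<dots> \<le> (\<integral>y. \<bar>f y - s i y\<bar> \<partial>\<nu>)"
          by (rule integral_abs_bound)
        finally show ?thesis
          using i by simp
      qed
      have "AE z in Q. z \<in> B \<longrightarrow> z \<in> ?C"
        using LLN[of i] unfolding LLN_average
      proof (rule eventually_mono, intro impI)
        fix z assume lim: "average (s i) (\<lambda>k. Y k z) \<longlonglongrightarrow> (\<integral>y. s i y \<partial>\<nu>)" and z: "z \<in> B"
        obtain N where N: "\<And>n. N \<le> n \<Longrightarrow> \<bar>average (s i) (\<lambda>k. Y k z) n - (\<integral>y. s i y \<partial>\<nu>)\<bar> < \<delta>"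
          using LIMSEQ_D[OF lim \<delta>] by auto
        have "\<exists>n\<ge>max N 1. 3 * \<delta> < \<bar>average f (\<lambda>k. Y k z) n - ?I\<bar>"
          using z unfolding B_def by (simp only: mem_Collect_eq not_ex not_all not_imp not_le)
        then obtain n where n: "max N 1 \<le> n" "3 * \<delta> < \<bar>average f (\<lambda>k. Y k z) n - ?I\<bar>"
          by blast
        have "\<delta> < \<bar>average f (\<lambda>k. Y k z) n - average (s i) (\<lambda>k. Y k z) n\<bar>"
          using N[of n] n mean by linarith
        also have "\<dots> = \<bar>1 / real n * (\<Sum>k<n. f (Y k z) - s i (Y k z))\<bar>"
          by (simp add: average_def sum_subtractf right_diff_distrib)
        also have "\<dots> \<le> 1 / real n * (\<Sum>k<n. h (Y k z))"
          unfolding h_def abs_mult by (intro mult_mono sum_abs) auto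
        finally have "real n * \<delta> < (\<Sum>k<n. h (Y k z))"
          using n by (simp add: field_simps)
        then show "z \<in> ?C"
          using z unfolding birkhoff_sum_Y[of h] B_def by auto
      qed
      moreover have "?C \<in> sets Q"
        by measurable
      ultimately have "Q.prob B \<le> Q.prob ?C"
        by (rule Q.P.finite_measure_mono_AE)
      also have "\<dots> \<le> (\<integral>z. h (fst z) \<partial>Q) / \<delta>"
        by (intro mp.maximal_inequality integrable_fst h \<delta>) (simp add: h_def)
      also have "(\<integral>z. h (fst z) \<partial>Q) = (\<integral>y. h y \<partial>\<nu>)"
        by (rule integral_fst) simp
      finally show ?thesis
        unfolding h_def .
    qed
    have "(\<lambda>i. (\<integral>y. \<bar>f y - s i y\<bar> \<partial>\<nu>) / \<delta>) \<longlonglongrightarrow> 0 / \<delta>"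
      using \<delta> by (intro tendsto_divide lim) auto
    moreover have "\<exists>N. \<forall>i\<ge>N. Q.prob B \<le> (\<integral>y. \<bar>f y - s i y\<bar> \<partial>\<nu>) / \<delta>"
      using order_tendstoD(2)[OF lim \<delta>] bound unfolding eventually_sequentially by blast
    ultimately have "Q.prob B \<le> 0"
      using LIMSEQ_le_const by fastforce
    then have "Q.prob B = 0"
      using measure_nonneg[of Q B] by simp
    then have "AE z in Q. z \<notin> B"
      using Q.P.prob_eq_0[OF \<open>B \<in> sets Q\<close>] by blast
    then show ?thesis
      by (rule AE_mp) (auto simp: B_def intro!: AE_I2)
  qed
  have "AE z in Q. \<forall>j. \<exists>N. \<forall>n\<ge>N. \<bar>average f (\<lambda>k. Y k z) n - ?I\<bar> \<le> 3 * (1 / real (Suc j))"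
    unfolding AE_all_countable by (intro allI bad_null) simp
  then show ?thesis
    unfolding LLN_average
  proof eventually_elim
    case (elim z)
    show ?case
    proof (rule LIMSEQ_I)
      fix r :: real assume "0 < r"
      then obtain j where j: "1 / real (Suc j) < r / 3"
        using nat_approx_posE[of "r / 3"] by auto
      obtain N where "\<forall>n\<ge>N. \<bar>average f (\<lambda>k. Y k z) n - ?I\<bar> \<le> 3 * (1 / real (Suc j))"
        using elim by blast
      then show "\<exists>no. \<forall>n\<ge>no. norm (average f (\<lambda>k. Y k z) n - ?I) < r"
        using j by (intro exI[of _ N]) fastforce
    qed
  qed
qed

lemma LLN_dominated:
  assumes f: "integrable \<nu> f" and s: "\<And>i::nat. integrable \<nu> (s i)" and w: "integrable \<nu> w"
    and bound: "\<And>i y. \<bar>s i y\<bar> \<le> w y" and lim: "\<And>y. (\<lambda>i. s i y) \<longlonglongrightarrow> f y"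
    and LLN: "\<And>i. LLN (s i)"
  shows "LLN f"
proof (rule LLN_L1_limit[OF f s _ LLN])
  have "(\<lambda>i. \<integral>y. \<bar>f y - s i y\<bar> \<partial>\<nu>) \<longlonglongrightarrow> (\<integral>y. 0 \<partial>\<nu>)"
  proof (rule integral_dominated_convergence[where w = "\<lambda>y. \<bar>f y\<bar> + w y"])
    show "integrable \<nu> (\<lambda>y. \<bar>f y\<bar> + w y)"
      using f w by simp
    show "AE y in \<nu>. (\<lambda>i. \<bar>f y - s i y\<bar>) \<longlonglongrightarrow> 0"
    proof (intro AE_I2)
      fix y
      have "(\<lambda>i. \<bar>f y - s i y\<bar>) \<longlonglongrightarrow> \<bar>f y - f y\<bar>"
        by (intro tendsto_intros lim)
      then show "(\<lambda>i. \<bar>f y - s i y\<bar>) \<longlonglongrightarrow> 0"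
        by simp
    qed
    show "AE y in \<nu>. norm \<bar>f y - s i y\<bar> \<le> \<bar>f y\<bar> + w y" for i
    proof (intro AE_I2)
      fix y
      show "norm \<bar>f y - s i y\<bar> \<le> \<bar>f y\<bar> + w y"
        using bound[of i y] abs_triangle_ineq4[of "f y" "s i y"] by simp
    qed
    show "(\<lambda>y. \<bar>f y - s i y\<bar>) \<in> borel_measurable \<nu>" for i
      using f s[of i] by measurable
  qed simp
  then show "(\<lambda>i. \<integral>y. \<bar>f y - s i y\<bar> \<partial>\<nu>) \<longlonglongrightarrow> 0"
    by simp
qed

section \<open>Indicators and integrable functions\<close>

lemma LLN_add:
  assumes "integrable \<nu> f" "integrable \<nu> g" "LLN f" "LLN g"
  shows "LLN (\<lambda>y. f y + g y)"
proof -
  have "AE z in Q. average (\<lambda>y. f y + g y) (\<lambda>k. Y k z) \<longlonglongrightarrow> (\<integral>y. f y \<partial>\<nu>) + (\<integral>y. g y \<partial>\<nu>)"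
    using assms(3,4) unfolding LLN_average
  proof eventually_elim
    case (elim z)
    from tendsto_add[OF elim] show ?case
      by (simp add: average_def[abs_def] sum.distrib add_divide_distrib)
  qed
  then show ?thesis
    unfolding LLN_average using assms(1,2) by simp
qed

lemma LLN_cmult:
  assumes "LLN f"
  shows "LLN (\<lambda>y. f y * c)"
proof -
  have "AE z in Q. average (\<lambda>y. f y * c) (\<lambda>k. Y k z) \<longlonglongrightarrow> (\<integral>y. f y \<partial>\<nu>) * c"
    using assms unfolding LLN_average
  proof eventually_elim
    case (elim z)
    from tendsto_mult_right[OF elim, of c] show ?case
      by (simp add: average_def[abs_def] sum_distrib_right[symmetric] mult.assoc)
  qed
  then show ?thesis
    unfolding LLN_average by simp
qed

lemma LLN_const: "LLN (\<lambda>y. c)"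
  by (rule LLN_Lipschitz[of _ 0]) auto

lemma integrable_indicator:
  assumes "A \<in> sets borel"
  shows "integrable \<nu> (indicator A :: 'e \<Rightarrow> real)"
  using assms by (intro N.integrable_const_bound[of _ 1] borel_measurable_indicator) (auto simp: indicator_def)

lemma LLN_indicator_open:
  assumes "open U"
  shows "LLN (indicator U)"
proof (cases "U = UNIV")
  \<comment> \<open>\<open>infdist\<close> to the empty set is 0 by convention, so the whole space
    is treated apart.\<close>
  case True
  then show ?thesis
    using LLN_const[of 1] by (simp add: indicator_def[abs_def])
next
  case False
  \<comment> \<open>Truncated multiples of the distance to the complement: Lipschitz with constant
    \<open>i\<close>, and equal to 1 from some index on at each point of the open set
    \<open>U\<close>.\<close>
  define s where "s i y = min 1 (real i * infdist y (- U))" for i :: nat and y :: 'e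
  have s_meas [measurable]: "s i \<in> borel_measurable borel" for i
    unfolding s_def by (intro borel_measurable_continuous_onI continuous_intros)
  have s_range: "0 \<le> s i y" "s i y \<le> 1" for i y
    by (auto simp: s_def infdist_nonneg)
  have s_int: "integrable \<nu> (s i)" for i
    by (rule N.integrable_const_bound[of _ 1]) (use s_range in auto)
  show ?thesis
  proof (rule LLN_dominated[of _ s "\<lambda>_. 1"])
    show "integrable \<nu> (indicator U :: 'e \<Rightarrow> real)"
      using assms by (intro integrable_indicator) simp
    show "LLN (s i)" for i
    proof (rule LLN_Lipschitz[OF s_meas _ s_int])
      fix x y :: 'e
      have "\<bar>s i x - s i y\<bar> \<le> \<bar>real i * infdist x (- U) - real i * infdist y (- U)\<bar>"
        unfolding s_def by (simp add: min_def)
      also have "\<dots> = real i * \<bar>infdist x (- U) - infdist y (- U)\<bar>"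
        by (simp add: abs_mult flip: right_diff_distrib)
      also have "\<dots> \<le> real i * norm (x - y)"
        using infdist_triangle_abs[of x "- U" y] by (intro mult_left_mono) (auto simp: dist_norm)
      finally show "\<bar>s i x - s i y\<bar> \<le> real i * norm (x - y)" .
    qed
    show "\<bar>s i y\<bar> \<le> 1" for i y
      using s_range[of i y] by simp
    show "(\<lambda>i. s i y) \<longlonglongrightarrow> indicator U y" for y
    proof (cases "y \<in> U")
      case True
      then have d: "0 < infdist y (- U)"
        using assms \<open>U \<noteq> UNIV\<close> by (intro infdist_pos_not_in_closed) auto
      obtain m where m: "1 / infdist y (- U) < real m"
        using reals_Archimedean2 by blast
      have "s i y = 1" if "m \<le> i" for i
      proof -
        have "1 < real m * infdist y (- U)"
          using m d by (simp add: field_simps)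
        also have "\<dots> \<le> real i * infdist y (- U)"
          using that d by (intro mult_right_mono) auto
        finally show ?thesis
          by (simp add: s_def)
      qed
      then have "\<forall>\<^sub>F i in sequentially. s i y = 1"
        unfolding eventually_sequentially by blast
      then show ?thesis
        using True by (simp add: tendsto_eventually)
    next
      case False
      then show ?thesis
        by (simp add: s_def)
    qed
  qed (use s_int in auto)
qed

text \<open>Open sets are stable under intersection and generate the Borel sets, so it suffices that
  the sets with a strong law are closed under complements and countable disjoint unions, the latter
  by dominated convergence.\<close>

lemma LLN_indicator:
  assumes "A \<in> sets borel"
  shows "LLN (indicator A)"
proof -
  note int = integrable_indicator
  have "Int_stable {S::'e set. open S}"
    by (auto simp: Int_stable_def)
  moreover have "{S::'e set. open S} \<subseteq> Pow UNIV"
    by simp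
  moreover have "A \<in> sigma_sets UNIV {S. open S}"
    using assms by (simp add: sets_borel)
  ultimately show ?thesis
  proof (induction rule: sigma_sets_induct_disjoint)
    case (basic U)
    then show ?case
      by (simp add: LLN_indicator_open)
  next
    case empty
    show ?case
      using LLN_const[of 0] by (simp add: indicator_def[abs_def])
  next
    case (compl A)
    then have A: "A \<in> sets borel"
      by (simp add: sets_borel)
    have "LLN (\<lambda>y. 1 + indicator A y * (- 1))"
      using int[OF A] compl by (intro LLN_add LLN_const LLN_cmult) auto
    moreover have "(\<lambda>y. 1 + indicator A y * (- 1)) = (indicator (UNIV - A) :: 'e \<Rightarrow> real)"
      by (auto simp: indicator_def)
    ultimately show ?case
      by simp
  next
    case (union A)
    then have A: "A i \<in> sets borel" for i
      by (auto simp: sets_borel)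
    have fin: "LLN (indicator (\<Union>i<n. A i))" for n
    proof (induction n)
      case 0
      then show ?case
        using LLN_const[of 0] by (simp add: indicator_def[abs_def])
    next
      case (Suc n)
      have "A n \<inter> A i = {}" if "i < n" for i
        using union(1) that by (auto simp: disjoint_family_on_def)
      then have "(\<lambda>y. indicator (\<Union>i<n. A i) y + indicator (A n) y) = (indicator (\<Union>i<Suc n. A i) :: 'e \<Rightarrow> real)"
        by (fastforce simp: indicator_def lessThan_Suc fun_eq_iff)
      moreover have "LLN (\<lambda>y. indicator (\<Union>i<n. A i) y + indicator (A n) y)"
        using A by (intro LLN_add int Suc union(3)) auto
      ultimately show ?case
        by simp
    qed
    show ?case
    proof (rule LLN_dominated[of _ "\<lambda>n. indicator (\<Union>i<n. A i)" "\<lambda>_. 1"])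
      show "(\<lambda>n. indicator (\<Union>i<n. A i) y) \<longlonglongrightarrow> (indicator (\<Union>i. A i) y :: real)" for y
        by (rule LIMSEQ_indicator_UN)
      show "integrable \<nu> (indicator (\<Union>i. A i) :: 'e \<Rightarrow> real)"
        "integrable \<nu> (indicator (\<Union>i<n. A i) :: 'e \<Rightarrow> real)" for n
        using A by (auto intro!: int)
      show "\<bar>indicator (\<Union>i<n. A i) y\<bar> \<le> (1::real)" for n y
        by (simp add: indicator_def)
    qed (use fin in auto)
  qed
qed

theorem LLN_integrable:
  assumes "integrable \<nu> f"
  shows "LLN f"
  using assms
proof (induction rule: integrable_induct)
  case (base A c)
  then show ?case
    using LLN_cmult[OF LLN_indicator, of A c] by simp
next
  case (add f g)
  then show ?case
    by (intro LLN_add)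
next
  case (lim f s)
  show ?case
    using lim by (intro LLN_dominated[of f s "\<lambda>y. 2 * \<bar>f y\<bar>"]) auto
qed

end

section \<open>Transfer to a given probability space\<close>

lemma (in prob_space) distr_initial_innovations:
  fixes W :: "'a \<Rightarrow> 'e::euclidean_space" and \<epsilon> :: "nat \<Rightarrow> 'a \<Rightarrow> 'e"
  assumes W [measurable]: "W \<in> M \<rightarrow>\<^sub>M borel" and \<epsilon>: "\<And>n. 1 \<le> n \<Longrightarrow> \<epsilon> n \<in> M \<rightarrow>\<^sub>M borel"
    and indep: "indep_vars (\<lambda>_. borel) \<epsilon> {1..}"
    and ident: "\<And>n. 1 \<le> n \<Longrightarrow> distr M borel (\<epsilon> n) = distr M borel (\<epsilon> 1)"
    and indep0: "indep_set (sets (vimage_algebra (space M) W borel))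
       (sets (vimage_algebra (space M) (\<lambda>\<omega>. \<lambda>n\<in>{1..}. \<epsilon> n \<omega>) (PiM {1..} (\<lambda>_. borel))))"
  defines "\<nu> \<equiv> distr M borel W" and "\<rho> \<equiv> distr M borel (\<epsilon> 1)"
  defines "Q \<equiv> \<nu> \<Otimes>\<^sub>M (\<Pi>\<^sub>M i\<in>(UNIV::nat set). \<rho>)"
  shows "distr M Q (\<lambda>\<omega>. (W \<omega>, \<lambda>n. \<epsilon> (Suc n) \<omega>)) = Q"
    and "(\<lambda>\<omega>. (W \<omega>, \<lambda>n. \<epsilon> (Suc n) \<omega>)) \<in> M \<rightarrow>\<^sub>M Q"
proof -
  let ?S = "\<Pi>\<^sub>M i\<in>(UNIV::nat set). \<rho>"
  let ?E = "\<lambda>\<omega> n. \<epsilon> (Suc n) \<omega>"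
  have sets_\<rho> [simp, measurable_cong]: "sets \<rho> = sets borel" and sets_\<nu> [simp, measurable_cong]: "sets \<nu> = sets borel"
    by (simp_all add: \<rho>_def \<nu>_def)
  have space_\<rho> [simp]: "space \<rho> = UNIV"
    by (simp add: \<rho>_def)
  have prob_\<rho>: "prob_space \<rho>" and prob_\<nu>: "prob_space \<nu>"
    unfolding \<rho>_def \<nu>_def by (intro prob_space_distr \<epsilon> W; simp)+
  interpret \<rho>: prob_space \<rho> by fact
  interpret \<nu>: prob_space \<nu> by fact
  interpret S: prob_space ?S
    by (intro prob_space_PiM prob_\<rho>)
  have E [measurable]: "?E \<in> M \<rightarrow>\<^sub>M ?S"
    by (rule measurable_PiM_single') (use \<epsilon> in \<open>auto simp: space_PiM\<close>)
  have distrE: "distr M ?S ?E = ?S"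
  proof -
    let ?E1 = "\<lambda>\<omega>. \<lambda>n\<in>{1..}. \<epsilon> n \<omega>"
    have E1: "?E1 \<in> M \<rightarrow>\<^sub>M PiM {1..} (\<lambda>_. borel)"
      using \<epsilon> by (intro measurable_restrict) auto
    \<comment> \<open>The innovations carry indices from 1 on, the coordinates of the product space
      start at 0.\<close>
    have sh: "(\<lambda>e. \<lambda>n\<in>UNIV. e (Suc n)) \<in> PiM {1..} (\<lambda>_. borel) \<rightarrow>\<^sub>M ?S"
      by (intro measurable_restrict) (auto intro!: measurable_component_singleton)
    have "distr M (PiM {1..} (\<lambda>_. borel)) ?E1 = (\<Pi>\<^sub>M n\<in>{1..}. distr M borel (\<epsilon> n))"
      using indep \<epsilon> by (subst indep_vars_iff_distr_eq_PiM'[symmetric]) auto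
    also have "\<dots> = PiM {1..} (\<lambda>_. \<rho>)"
      unfolding \<rho>_def by (intro PiM_cong refl ident) simp
    finally have E1_distr: "distr M (PiM {1..} (\<lambda>_. borel)) ?E1 = PiM {1..} (\<lambda>_. \<rho>)" .
    have "?S = distr (PiM {1..} (\<lambda>_. \<rho>)) ?S (\<lambda>e. \<lambda>n\<in>UNIV. e (Suc n))"
      by (rule distr_PiM_reindex[symmetric]) (auto simp: prob_\<rho>)
    also have "\<dots> = distr M ?S ((\<lambda>e. \<lambda>n\<in>UNIV. e (Suc n)) \<circ> ?E1)"
      unfolding E1_distr[symmetric] by (rule distr_distr[OF sh E1])
    also have "\<dots> = distr M ?S ?E"
      by (intro distr_cong refl) (simp add: restrict_def)
    finally show ?thesis ..
  qed
  show Z [measurable]: "(\<lambda>\<omega>. (W \<omega>, ?E \<omega>)) \<in> M \<rightarrow>\<^sub>M Q"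
    unfolding Q_def by measurable
  show "distr M Q (\<lambda>\<omega>. (W \<omega>, ?E \<omega>)) = Q"
    unfolding Q_def
  proof (rule pair_measure_eqI[symmetric])
    fix A C assume A: "A \<in> sets \<nu>" and C: "C \<in> sets ?S"
    have a: "W -` A \<inter> space M \<in> sets (vimage_algebra (space M) W borel)"
      using A by (intro in_vimage_algebra) simp
    \<comment> \<open>The event is rewritten through the sequence indexed from 1, the form in which
      independence from the initial value is given.\<close>
    have sh: "(\<lambda>e n. e (Suc n)) \<in> PiM {1..} (\<lambda>_. borel) \<rightarrow>\<^sub>M ?S"
      by (rule measurable_PiM_single') (auto simp: space_PiM intro!: measurable_component_singleton)
    have "(\<lambda>\<omega>. \<lambda>n\<in>{1..}. \<epsilon> n \<omega>) -` ((\<lambda>e n. e (Suc n)) -` C \<inter> space (PiM {1..} (\<lambda>_. borel))) \<inter> space M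
        \<in> sets (vimage_algebra (space M) (\<lambda>\<omega>. \<lambda>n\<in>{1..}. \<epsilon> n \<omega>) (PiM {1..} (\<lambda>_. borel)))"
      by (intro in_vimage_algebra measurable_sets[OF sh C])
    also have "(\<lambda>\<omega>. \<lambda>n\<in>{1..}. \<epsilon> n \<omega>) -` ((\<lambda>e n. e (Suc n)) -` C \<inter> space (PiM {1..} (\<lambda>_. borel))) \<inter> space M
        = ?E -` C \<inter> space M"
      by (auto simp: space_PiM)
    finally have c: "?E -` C \<inter> space M
        \<in> sets (vimage_algebra (space M) (\<lambda>\<omega>. \<lambda>n\<in>{1..}. \<epsilon> n \<omega>) (PiM {1..} (\<lambda>_. borel)))" .
    have "emeasure (distr M (\<nu> \<Otimes>\<^sub>M ?S) (\<lambda>\<omega>. (W \<omega>, ?E \<omega>))) (A \<times> C)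
        = emeasure M ((W -` A \<inter> space M) \<inter> (?E -` C \<inter> space M))"
      using A C Z unfolding Q_def by (subst emeasure_distr) (auto intro!: arg_cong[of _ _ "emeasure M"])
    also have "\<dots> = ennreal (prob (W -` A \<inter> space M) * prob (?E -` C \<inter> space M))"
      using indep_setD[OF indep0 a c] by (simp add: emeasure_eq_measure)
    also have "\<dots> = emeasure M (W -` A \<inter> space M) * emeasure M (?E -` C \<inter> space M)"
      by (simp add: emeasure_eq_measure ennreal_mult)
    also have "\<dots> = emeasure \<nu> A * emeasure ?S C"
    proof -
      have "emeasure ?S C = emeasure (distr M ?S ?E) C"
        by (simp only: distrE)
      also have "\<dots> = emeasure M (?E -` C \<inter> space M)"
        using C by (intro emeasure_distr E)
      finally show ?thesis
        using A unfolding \<nu>_def by (simp add: emeasure_distr)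
    qed
    finally show "emeasure \<nu> A * emeasure ?S C
        = emeasure (distr M (\<nu> \<Otimes>\<^sub>M ?S) (\<lambda>\<omega>. (W \<omega>, ?E \<omega>))) (A \<times> C)"
      by simp
  qed (auto simp: \<nu>.sigma_finite_measure_axioms S.sigma_finite_measure_axioms)
qed

text \<open>The law of \<open>W 0\<close> is invariant because \<open>W 1\<close> has the same law
  and arises from \<open>W 0\<close> by one step with an independent innovation. The strong law of
  the canonical process is then pulled back along the map sending \<omega> to its initial value and
  innovations.\<close>

theorem (in prob_space) autoregression_strong_law:
  fixes W :: "nat \<Rightarrow> 'a \<Rightarrow> 'e::euclidean_space" and \<epsilon> :: "nat \<Rightarrow> 'a \<Rightarrow> 'e" and f :: "'e \<Rightarrow> real"
  assumes W [measurable]: "\<And>n. W n \<in> M \<rightarrow>\<^sub>M borel" and \<epsilon>: "\<And>n. 1 \<le> n \<Longrightarrow> \<epsilon> n \<in> M \<rightarrow>\<^sub>M borel"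
    and indep: "indep_vars (\<lambda>_. borel) \<epsilon> {1..}"
    and ident: "\<And>n. 1 \<le> n \<Longrightarrow> distr M borel (\<epsilon> n) = distr M borel (\<epsilon> 1)"
    and indep0: "indep_set (sets (vimage_algebra (space M) (W 0) borel))
       (sets (vimage_algebra (space M) (\<lambda>\<omega>. \<lambda>n\<in>{1..}. \<epsilon> n \<omega>) (PiM {1..} (\<lambda>_. borel))))"
    and \<phi>: "\<bar>\<phi>\<bar> < 1"
    and rec: "AE \<omega> in M. \<forall>n. W (Suc n) \<omega> = \<phi> *\<^sub>R W n \<omega> + \<epsilon> (Suc n) \<omega>"
    and stat: "distr M borel (W 1) = distr M borel (W 0)"
    and f [measurable]: "f \<in> borel_measurable borel" and int: "integrable M (\<lambda>\<omega>. f (W 0 \<omega>))"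
  shows "AE \<omega> in M. (\<lambda>n. 1 / real n * (\<Sum>k=1..n. f (W k \<omega>))) \<longlonglongrightarrow> (\<integral>\<omega>. f (W 0 \<omega>) \<partial>M)"
proof -
  define \<nu> where "\<nu> = distr M borel (W 0)"
  define \<rho> where "\<rho> = distr M borel (\<epsilon> 1)"
  let ?S = "\<Pi>\<^sub>M i\<in>(UNIV::nat set). \<rho>"
  define Z where "Z \<omega> = (W 0 \<omega>, \<lambda>n. \<epsilon> (Suc n) \<omega>)" for \<omega>
  have \<epsilon>1 [measurable]: "\<epsilon> 1 \<in> M \<rightarrow>\<^sub>M borel"
    by (rule \<epsilon>) simp
  have distrZ: "distr M (\<nu> \<Otimes>\<^sub>M ?S) Z = \<nu> \<Otimes>\<^sub>M ?S" and Z: "Z \<in> M \<rightarrow>\<^sub>M \<nu> \<Otimes>\<^sub>M ?S"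
    using distr_initial_innovations[OF W \<epsilon> indep ident indep0] unfolding \<nu>_def \<rho>_def Z_def[abs_def] by auto
  have sets_\<rho> [simp, measurable_cong]: "sets \<rho> = sets borel" and sets_\<nu> [simp, measurable_cong]: "sets \<nu> = sets borel"
    by (simp_all add: \<rho>_def \<nu>_def)
  have prob_\<rho>: "prob_space \<rho>" and prob_\<nu>: "prob_space \<nu>"
    unfolding \<rho>_def \<nu>_def by (intro prob_space_distr \<epsilon>1 W)+
  have first: "distr (\<nu> \<Otimes>\<^sub>M ?S) (\<nu> \<Otimes>\<^sub>M \<rho>) (\<lambda>(y, e). (y, e 0)) = \<nu> \<Otimes>\<^sub>M \<rho>"
  proof -
    have c: "distr ?S \<rho> (\<lambda>e. e 0) = \<rho>"
      by (rule distr_PiM_component[of UNIV "\<lambda>_. \<rho>"]) (auto simp: prob_\<rho>)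
    have "distr \<nu> \<nu> (\<lambda>y. y) \<Otimes>\<^sub>M distr ?S \<rho> (\<lambda>e. e 0)
        = distr (\<nu> \<Otimes>\<^sub>M ?S) (\<nu> \<Otimes>\<^sub>M \<rho>) (\<lambda>(y, e). (y, e 0))"
      by (rule pair_measure_distr)
         (auto simp: c prob_\<rho> prob_space_imp_sigma_finite intro: measurable_component_singleton)
    then show ?thesis
      by (simp only: c distr_id)
  qed
  have invariant: "distr (\<nu> \<Otimes>\<^sub>M \<rho>) borel (\<lambda>(y, e). \<phi> *\<^sub>R y + e) = \<nu>"
  proof -
    have m1: "(\<lambda>(y, e). (y, e 0)) \<in> \<nu> \<Otimes>\<^sub>M ?S \<rightarrow>\<^sub>M \<nu> \<Otimes>\<^sub>M \<rho>"
      by measurable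
    have m2: "(\<lambda>(y, e). \<phi> *\<^sub>R y + e) \<in> \<nu> \<Otimes>\<^sub>M \<rho> \<rightarrow>\<^sub>M borel"
      by measurable
    have "distr (\<nu> \<Otimes>\<^sub>M \<rho>) borel (\<lambda>(y, e). \<phi> *\<^sub>R y + e)
        = distr (distr (distr M (\<nu> \<Otimes>\<^sub>M ?S) Z) (\<nu> \<Otimes>\<^sub>M \<rho>) (\<lambda>(y, e). (y, e 0))) borel (\<lambda>(y, e). \<phi> *\<^sub>R y + e)"
      by (simp only: distrZ first)
    also have "\<dots> = distr M borel (\<lambda>\<omega>. \<phi> *\<^sub>R W 0 \<omega> + \<epsilon> 1 \<omega>)"
      using Z m1 m2 by (subst distr_distr, simp, simp)+ (simp add: comp_def Z_def)
    also have "\<dots> = distr M borel (W 1)"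
    proof (rule distr_cong_AE)
      show "AE \<omega> in M. \<phi> *\<^sub>R W 0 \<omega> + \<epsilon> 1 \<omega> = W 1 \<omega>"
        using rec by eventually_elim simp
    qed (auto intro!: W \<epsilon>1[simplified] borel_measurable_add)
    finally show ?thesis
      by (simp only: stat \<nu>_def)
  qed
  interpret autoregression \<rho> \<nu> \<phi>
    by (rule autoregression.intro[OF prob_\<rho> prob_\<nu> sets_\<rho> sets_\<nu> \<phi> invariant])
  have int': "integrable \<nu> f"
    unfolding \<nu>_def using int by (simp add: integrable_distr_eq)
  have integral: "(\<integral>y. f y \<partial>\<nu>) = (\<integral>\<omega>. f (W 0 \<omega>) \<partial>M)"
    unfolding \<nu>_def by (rule integral_distr) measurable
  \<comment> \<open>Sums over the times 1 to n are sums from time 0 started at the image of the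
    point under \<open>step\<close>, which preserves \<open>Q\<close>.\<close>
  have Y_step: "Y k (step z) = Y (Suc k) z" for k z
    unfolding Y_def by (simp only: funpow_Suc_right comp_def)
  have "AE z in Q. (\<lambda>n. 1 / real n * (\<Sum>k<n. f (Y (Suc k) z))) \<longlonglongrightarrow> (\<integral>y. f y \<partial>\<nu>)"
    using LLN_integrable[OF int'] unfolding LLN_def Y_step[symmetric]
    by (intro AE_distrD[OF step_measurable]) (simp only: distr_step)
  then have "AE \<omega> in M. (\<lambda>n. 1 / real n * (\<Sum>k<n. f (Y (Suc k) (Z \<omega>)))) \<longlonglongrightarrow> (\<integral>y. f y \<partial>\<nu>)"
    by (intro AE_distrD[OF Z]) (simp only: distrZ)
  with rec show ?thesis
  proof eventually_elim
    case (elim \<omega>)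
    have "Y k (Z \<omega>) = W k \<omega>" for k
      by (induction k) (use elim(1) in \<open>auto simp: Y_Suc Z_def\<close>)
    moreover have "(\<Sum>k<n. f (W (Suc k) \<omega>)) = (\<Sum>k=1..n. f (W k \<omega>))" for n
      by (rule sum.reindex_bij_witness[of _ "\<lambda>k. k - 1" Suc]) auto
    ultimately show ?case
      using elim(2) integral by simp
  qed
qed

section \<open>The logarithm within the injectivity radius\<close>

context riemannian
begin

lemma open_tangent_ball: "open (tangent_ball M p r)"
proof -
  have "bounded_bilinear (metric M p)"
    using bilinear_metric bilinear_conv_bounded_bilinear by blast
  then have "continuous_on UNIV (\<lambda>v. metric M p v v)"
    by (rule bounded_bilinear.continuous_on[OF _ continuous_on_id continuous_on_id])
  then have "continuous_on UNIV (\<lambda>v. ennreal (rnorm M p v))"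
    unfolding rnorm_def by (intro continuous_on_ennreal continuous_on_real_sqrt)
  then show ?thesis
    unfolding tangent_ball_def by (intro open_Collect_less continuous_on_const)
qed

text \<open>The supremum defining the injectivity radius need not be attained, so a diffeomorphism
  is at hand only on some ball containing the given vectors, chosen anew each time; injectivity
  needs two vectors in a common ball.\<close>

lemma tangent_ball_diffeo:
  assumes "u \<in> tangent_ball M p (inj_radius M)" "v \<in> tangent_ball M p (inj_radius M)"
  obtains r where "u \<in> tangent_ball M p r" "v \<in> tangent_ball M p r"
    "diffeo_onto_image M (tangent_ball M p r) (rexp M p)"
proof -
  have "max (ennreal (rnorm M p u)) (ennreal (rnorm M p v)) < inj_radius M"
    using assms by (simp add: tangent_ball_def)
  also have "inj_radius M \<le> inj_radius_at M p"
    unfolding inj_radius_def by (rule INF_lower) simp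
  finally obtain r where "max (ennreal (rnorm M p u)) (ennreal (rnorm M p v)) < r"
    "diffeo_onto_image M (tangent_ball M p r) (rexp M p)"
    unfolding inj_radius_at_def less_Sup_iff by blast
  then show ?thesis
    by (intro that[of r]) (auto simp: tangent_ball_def)
qed

lemma inj_on_rexp: "inj_on (rexp M p) (tangent_ball M p (inj_radius M))"
proof (rule inj_onI)
  fix u v assume uv: "u \<in> tangent_ball M p (inj_radius M)" "v \<in> tangent_ball M p (inj_radius M)"
    and eq: "rexp M p u = rexp M p v"
  obtain r where "u \<in> tangent_ball M p r" "v \<in> tangent_ball M p r"
    "diffeo_onto_image M (tangent_ball M p r) (rexp M p)"
    using uv by (rule tangent_ball_diffeo)
  then show "u = v"
    using eq unfolding diffeo_onto_image_def by (meson inj_onD)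
qed

lemma rlog_rexp: "v \<in> tangent_ball M p (inj_radius M) \<Longrightarrow> rlog M p (rexp M p v) = v"
  unfolding rlog_def by (rule inv_into_f_f[OF inj_on_rexp])

lemma continuous_on_rexp: "continuous_on (tangent_ball M p (inj_radius M)) (rexp M p)"
proof (rule continuous_at_imp_continuous_on, rule ballI)
  fix v assume v: "v \<in> tangent_ball M p (inj_radius M)"
  obtain r where "v \<in> tangent_ball M p r" "diffeo_onto_image M (tangent_ball M p r) (rexp M p)"
    using tangent_ball_diffeo[OF v v] by metis
  then show "isCont (rexp M p) v"
    using open_tangent_ball[of p r] unfolding diffeo_onto_image_def
    by (meson continuous_on_eq_continuous_at)
qed

lemma continuous_on_inverse_diffeo:
  assumes "diffeo_onto_image M D f"
  shows "continuous_on (f ` D) (inv_into D f)"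
proof (rule continuous_at_imp_continuous_on, rule ballI)
  fix q assume q: "q \<in> f ` D"
  let ?c = "chart_at M q"
  have c: "?c \<in> atlas M" "q \<in> fst ?c"
    using chart_at_atlas mem_chart_at by auto
  let ?W = "fst ?c \<inter> f ` D"
  have W: "open ?W"
    using assms open_chart[OF c(1)] unfolding diffeo_onto_image_def by blast
  have "smooth_on (snd ?c ` ?W) (inv_into D f \<circ> chart_inv ?c)"
    using assms c(1) unfolding diffeo_onto_image_def by blast
  then have hc: "continuous_on (snd ?c ` ?W) (inv_into D f \<circ> chart_inv ?c)"
    by (rule smooth_on_imp_continuous_on)
  have "continuous_on ?W ((inv_into D f \<circ> chart_inv ?c) \<circ> snd ?c)"
    by (rule continuous_on_compose[OF continuous_on_subset[OF continuous_on_chart[OF c(1)]] hc]) blast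
  then have "continuous_on ?W (inv_into D f)"
    by (rule continuous_on_cong[THEN iffD1, OF refl, rotated]) (simp add: chart_inv_chart[OF c(1)])
  then show "isCont (inv_into D f) q"
    using W c(2) q by (simp add: continuous_on_eq_continuous_at)
qed

lemma rlog_local:
  assumes "q \<in> rexp M p ` tangent_ball M p (inj_radius M)"
  obtains W where "open W" "q \<in> W" "W \<subseteq> rexp M p ` tangent_ball M p (inj_radius M)"
    "continuous_on W (rlog M p)"
proof -
  let ?B = "tangent_ball M p (inj_radius M)"
  obtain v where v: "v \<in> ?B" "q = rexp M p v"
    using assms by blast
  obtain r where r: "v \<in> tangent_ball M p r" "diffeo_onto_image M (tangent_ball M p r) (rexp M p)"
    using tangent_ball_diffeo[OF v(1) v(1)] by metis
  let ?D = "tangent_ball M p r"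
  let ?h = "inv_into ?D (rexp M p)"
  have D: "open (rexp M p ` ?D)" "inj_on (rexp M p) ?D"
    using r(2) unfolding diffeo_onto_image_def by auto
  have h: "continuous_on (rexp M p ` ?D) ?h"
    using r(2) by (rule continuous_on_inverse_diffeo)
  \<comment> \<open>The local radius \<open>r\<close> may exceed the global
    \<open>inj_radius M\<close>; the preimage of \<open>?B\<close> keeps those points at which the
    local inverse is the value of \<open>rlog\<close>.\<close>
  define W where "W = rexp M p ` ?D \<inter> ?h -` ?B"
  have inv: "rexp M p (?h x) = x" if "x \<in> rexp M p ` ?D" for x
    using that by (rule f_inv_into_f)
  have eq: "rlog M p x = ?h x" if "x \<in> W" for x
    using that rlog_rexp[of "?h x" p] inv[of x] unfolding W_def by auto
  show ?thesis
  proof (rule that[of W])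
    show "open W"
      unfolding W_def by (intro continuous_open_preimage h D open_tangent_ball)
    show "q \<in> W"
      using v r(1) inv_into_f_f[OF D(2) r(1)] unfolding W_def by auto
    show "W \<subseteq> rexp M p ` ?B"
    proof
      fix x assume "x \<in> W"
      then have "?h x \<in> ?B" "rexp M p (?h x) = x"
        using inv unfolding W_def by auto
      then show "x \<in> rexp M p ` ?B"
        by (metis imageI)
    qed
    have "continuous_on W ?h"
      by (rule continuous_on_subset[OF h]) (auto simp: W_def)
    then show "continuous_on W (rlog M p)"
      by (rule continuous_on_cong[THEN iffD1, OF refl, rotated]) (simp add: eq)
  qed
qed

lemma open_rexp_image: "open (rexp M p ` tangent_ball M p (inj_radius M))"
  unfolding open_subopen[of "rexp M p ` tangent_ball M p (inj_radius M)"]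
proof
  fix q assume "q \<in> rexp M p ` tangent_ball M p (inj_radius M)"
  then obtain W where "open W" "q \<in> W" "W \<subseteq> rexp M p ` tangent_ball M p (inj_radius M)"
    using rlog_local by metis
  then show "\<exists>T. open T \<and> q \<in> T \<and> T \<subseteq> rexp M p ` tangent_ball M p (inj_radius M)"
    by blast
qed

lemma continuous_on_rlog: "continuous_on (rexp M p ` tangent_ball M p (inj_radius M)) (rlog M p)"
proof (rule continuous_at_imp_continuous_on, rule ballI)
  fix q assume "q \<in> rexp M p ` tangent_ball M p (inj_radius M)"
  then obtain W where "open W" "q \<in> W" "continuous_on W (rlog M p)"
    using rlog_local by metis
  then show "isCont (rlog M p) q"
    by (simp add: continuous_on_eq_continuous_at)
qed

section \<open>The strong law for the squared distances\<close>

lemma rdist_measurable: "(\<lambda>x. rdist M x p) \<in> borel_measurable borel"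
  using borel_measurable_continuous_onI[OF continuous_on_rdist[of p]] by (simp add: rdist_sym[of _ p])

lemma R_AR_strong_law:
  assumes P: "prob_space P" and ar: "R_AR M P \<mu> \<phi> \<epsilon> X" and \<phi>: "\<bar>\<phi>\<bar> < 1"
    and stat: "stationary_with P X \<Lambda>"
    and h [measurable]: "h \<in> borel_measurable borel" and int: "integrable P (\<lambda>\<omega>. h (X 0 \<omega>))"
  shows "AE \<omega> in P. (\<lambda>n. 1 / real n * (\<Sum>k=1..n. h (X k \<omega>))) \<longlonglongrightarrow> (\<integral>\<omega>. h (X 0 \<omega>) \<partial>P)"
proof -
  interpret prob_space P by fact
  let ?B = "tangent_ball M \<mu> (inj_radius M)"
  let ?e = "rexp M \<mu>"
  note ar' = ar[unfolded R_AR_def]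
  have X [measurable]: "X n \<in> borel_measurable P" for n
    using ar' by blast
  have \<epsilon>: "\<epsilon> n \<in> borel_measurable P" if "1 \<le> n" for n
    using ar' that by blast
  obtain r where r: "r \<le> inj_radius M" and upd: "\<And>n. 1 \<le> n \<Longrightarrow> AE \<omega> in P.
           X n \<omega> = ?e (\<phi> *\<^sub>R rlog M \<mu> (X (n - 1) \<omega>) + \<epsilon> n \<omega>) \<and>
           X n \<omega> \<in> geodesic_ball M \<mu> r \<and>
           ennreal (rnorm M \<mu> (\<phi> *\<^sub>R rlog M \<mu> (X (n - 1) \<omega>) + \<epsilon> n \<omega>)) < r"
    using ar' by blast
  have upd': "AE \<omega> in P. X (Suc n) \<omega> \<in> ?e ` ?B \<and>
      rlog M \<mu> (X (Suc n) \<omega>) = \<phi> *\<^sub>R rlog M \<mu> (X n \<omega>) + \<epsilon> (Suc n) \<omega>" for n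
    using upd[of "Suc n", OF le_add1[of 1 n, unfolded plus_1_eq_Suc]]
  proof eventually_elim
    case (elim \<omega>)
    then have "\<phi> *\<^sub>R rlog M \<mu> (X n \<omega>) + \<epsilon> (Suc n) \<omega> \<in> ?B"
      using r by (auto simp: tangent_ball_def)
    then show ?case
      using elim rlog_rexp by auto
  qed
  have law: "distr P borel (X n) = \<Lambda>" for n
    using stat unfolding stationary_with_def by blast
  have im [measurable]: "?e ` ?B \<in> sets borel"
    by (rule borel_open[OF open_rexp_image])
  \<comment> \<open>The update places \<open>X 1\<close> in the image of the tangent ball; equality
    of laws carries this back to \<open>X 0\<close>.\<close>
  have "AE \<omega> in P. X 1 \<omega> \<in> ?e ` ?B"
    using upd'[of 0] by eventually_elim simp
  then have "AE x in distr P borel (X 1). x \<in> ?e ` ?B"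
    by (subst AE_distr_iff) auto
  then have "AE x in distr P borel (X 0). x \<in> ?e ` ?B"
    by (simp only: law)
  then have X0: "AE \<omega> in P. X 0 \<omega> \<in> ?e ` ?B"
    by (rule AE_distrD[OF X])
  have inB: "AE \<omega> in P. \<forall>n. X n \<omega> \<in> ?e ` ?B"
    unfolding AE_all_countable
  proof
    fix n
    show "AE \<omega> in P. X n \<omega> \<in> ?e ` ?B"
    proof (cases n)
      case (Suc m)
      show ?thesis
        using upd'[of m] unfolding Suc by eventually_elim simp
    qed (simp add: X0)
  qed
  \<comment> \<open>Measurable extensions to all points; along the process the default values
    \<open>0\<close> and \<open>\<mu>\<close> are met on null sets only.\<close>
  define Lg where "Lg q = (if q \<in> ?e ` ?B then rlog M \<mu> q else 0)" for q
  define E where "E v = (if v \<in> ?B then ?e v else \<mu>)" for v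
  have Lg [measurable]: "Lg \<in> borel \<rightarrow>\<^sub>M borel"
    unfolding Lg_def by (intro borel_measurable_continuous_on_if im continuous_on_rlog continuous_on_const)
  have E [measurable]: "E \<in> borel \<rightarrow>\<^sub>M borel"
    unfolding E_def by (intro borel_measurable_continuous_on_if borel_open open_tangent_ball
        continuous_on_rexp continuous_on_const)
  have E_Lg: "E (Lg q) = q" if "q \<in> ?e ` ?B" for q
    using that rlog_rexp unfolding E_def Lg_def by auto
  have rec: "AE \<omega> in P. \<forall>n. Lg (X (Suc n) \<omega>) = \<phi> *\<^sub>R Lg (X n \<omega>) + \<epsilon> (Suc n) \<omega>"
  proof -
    have "AE \<omega> in P. \<forall>n. X (Suc n) \<omega> \<in> ?e ` ?B \<and>
        rlog M \<mu> (X (Suc n) \<omega>) = \<phi> *\<^sub>R rlog M \<mu> (X n \<omega>) + \<epsilon> (Suc n) \<omega>"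
      unfolding AE_all_countable using upd' by blast
    then show ?thesis
      using inB
    proof eventually_elim
      case (elim \<omega>)
      show ?case
      proof
        fix n
        have "X n \<omega> \<in> ?e ` ?B" "X (Suc n) \<omega> \<in> ?e ` ?B"
          "rlog M \<mu> (X (Suc n) \<omega>) = \<phi> *\<^sub>R rlog M \<mu> (X n \<omega>) + \<epsilon> (Suc n) \<omega>"
          using elim by blast+
        then show "Lg (X (Suc n) \<omega>) = \<phi> *\<^sub>R Lg (X n \<omega>) + \<epsilon> (Suc n) \<omega>"
          unfolding Lg_def by (simp only: if_True)
      qed
    qed
  qed
  have EX: "AE \<omega> in P. \<forall>n. E (Lg (X n \<omega>)) = X n \<omega>"
    using inB by eventually_elim (use E_Lg in blast)
  have indep0: "indep_set (sets (vimage_algebra (space P) (\<lambda>\<omega>. Lg (X 0 \<omega>)) borel))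
       (sets (vimage_algebra (space P) (\<lambda>\<omega>. \<lambda>n\<in>{1..}. \<epsilon> n \<omega>) (PiM {1..} (\<lambda>_. borel))))"
    (is "indep_set ?A ?C")
  proof -
    have ind: "indep_set (sets (vimage_algebra (space P) (X 0) borel)) ?C"
      using ar' by blast
    have "?A \<subseteq> sets (vimage_algebra (space P) (X 0) borel)"
    proof
      fix S assume "S \<in> ?A"
      then obtain A where A: "A \<in> sets borel" "S = (\<lambda>\<omega>. Lg (X 0 \<omega>)) -` A \<inter> space P"
        by (subst (asm) sets_vimage_algebra2) auto
      have "X 0 -` (Lg -` A) \<inter> space P \<in> sets (vimage_algebra (space P) (X 0) borel)"
        using measurable_sets[OF Lg A(1)] by (intro in_vimage_algebra) simp
      then show "S \<in> sets (vimage_algebra (space P) (X 0) borel)"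
        unfolding A(2) by (simp add: vimage_def)
    qed
    then show ?thesis
      using ind unfolding indep_set_def
      by (elim indep_sets_mono_sets) (auto split: bool.split)
  qed
  \<comment> \<open>\<open>h\<close> composed with \<open>E\<close> becomes the test function of the
    autoregression; \<open>E\<close> may jump at the boundary of the ball, which is why the strong
    law for integrable functions is used.\<close>
  have int': "integrable P (\<lambda>\<omega>. h (E (Lg (X 0 \<omega>))))"
    by (rule integrable_cong_AE_imp[OF int]) (use EX in \<open>auto elim!: eventually_mono\<close>)
  have lawL: "distr P borel (\<lambda>\<omega>. Lg (X n \<omega>)) = distr \<Lambda> borel Lg" for n
    unfolding law[of n, symmetric] by (subst distr_distr) (auto simp: comp_def)
  have "AE \<omega> in P. (\<lambda>n. 1 / real n * (\<Sum>k=1..n. h (E (Lg (X k \<omega>)))))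
      \<longlonglongrightarrow> (\<integral>\<omega>. h (E (Lg (X 0 \<omega>))) \<partial>P)"
  proof (rule autoregression_strong_law[where W = "\<lambda>n \<omega>. Lg (X n \<omega>)", OF _ \<epsilon> _ _ indep0 \<phi> rec])
    show "indep_vars (\<lambda>_. borel) \<epsilon> {1..}"
      using ar' by blast
    show "distr P borel (\<epsilon> n) = distr P borel (\<epsilon> 1)" if "1 \<le> n" for n
      using ar' that by blast
    show "distr P borel (\<lambda>\<omega>. Lg (X 1 \<omega>)) = distr P borel (\<lambda>\<omega>. Lg (X 0 \<omega>))"
      by (simp only: lawL)
  qed (use int' in auto)
  moreover have "(\<integral>\<omega>. h (E (Lg (X 0 \<omega>))) \<partial>P) = (\<integral>\<omega>. h (X 0 \<omega>) \<partial>P)"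
    using EX by (intro integral_cong_AE) (auto elim!: eventually_mono)
  ultimately show ?thesis
    using EX by (auto elim: eventually_elim2)
qed

lemma frechet_functional_integral:
  assumes "X0 \<in> borel_measurable P" "distr P borel X0 = \<Lambda>"
    and "integrable P (\<lambda>\<omega>. (rdist M (X0 \<omega>) p)\<^sup>2)"
  shows "frechet_functional M \<Lambda> p = ennreal (\<integral>\<omega>. (rdist M (X0 \<omega>) p)\<^sup>2 \<partial>P)"
proof -
  note [measurable] = assms(1) rdist_measurable
  have "frechet_functional M \<Lambda> p = (\<integral>\<^sup>+\<omega>. ennreal ((rdist M (X0 \<omega>) p)\<^sup>2) \<partial>P)"
    unfolding frechet_functional_def assms(2)[symmetric] by (intro nn_integral_distr) measurable
  also have "\<dots> = ennreal (\<integral>\<omega>. (rdist M (X0 \<omega>) p)\<^sup>2 \<partial>P)"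
    using assms(3) by (intro nn_integral_eq_integral) auto
  finally show ?thesis .
qed

end

theorem theorem4p4:
  fixes M :: "('m::{t2_space,second_countable_topology}, 'e::euclidean_space) riem"
    and P :: "'w measure"
    and \<mu> :: 'm
    and \<phi> :: real
    and \<epsilon> :: "nat \<Rightarrow> 'w \<Rightarrow> 'e"
    and X :: "nat \<Rightarrow> 'w \<Rightarrow> 'm"
    and \<Lambda> :: "'m measure"
    and \<mu>s :: "nat \<Rightarrow> 'w \<Rightarrow> 'm"
  assumes "complete_riemannian_manifold M"
    and "prob_space P"
    and "R_AR M P \<mu> \<phi> \<epsilon> X"
    and "\<bar>\<phi>\<bar> < 1"
    and "stationary_with P X \<Lambda>"
    and "is_frechet_mean M \<Lambda> \<mu>"
    and "\<And>p. is_frechet_mean M \<Lambda> p \<Longrightarrow> p = \<mu>"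
    and "\<And>n \<omega>. n \<ge> 1 \<Longrightarrow> \<omega> \<in> space P \<Longrightarrow>
           is_sample_frechet_mean M n (\<lambda>k. X k \<omega>) (\<mu>s n \<omega>)"
  shows "AE \<omega> in P. (\<lambda>n. \<mu>s n \<omega>) \<longlonglongrightarrow> \<mu>"
proof -
  interpret riemannian M
    using assms(1) unfolding complete_riemannian_manifold_def by unfold_locales blast
  interpret prob_space P by fact
  have complete: "rd.mcomplete"
    using assms(1) unfolding complete_riemannian_manifold_def by blast
  have X: "X 0 \<in> borel_measurable P" and int\<mu>: "integrable P (\<lambda>\<omega>. (rdist M (X 0 \<omega>) \<mu>)\<^sup>2)"
    using assms(3) unfolding R_AR_def by blast+
  note [measurable] = X rdist_measurable
  define F where "F p = (\<integral>\<omega>. (rdist M (X 0 \<omega>) p)\<^sup>2 \<partial>P)" for p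
  \<comment> \<open>Finiteness at \<open>\<mu>\<close> spreads to every \<open>p\<close> by the case
    \<eta> = 1 of \<open>rdist_power2_le\<close>.\<close>
  have int: "integrable P (\<lambda>\<omega>. (rdist M (X 0 \<omega>) p)\<^sup>2)" for p
  proof (rule Bochner_Integration.integrable_bound)
    show "integrable P (\<lambda>\<omega>. 2 * (rdist M (X 0 \<omega>) \<mu>)\<^sup>2 + 2 * (rdist M \<mu> p)\<^sup>2)"
      using int\<mu> by simp
    show "AE \<omega> in P. norm ((rdist M (X 0 \<omega>) p)\<^sup>2)
        \<le> norm (2 * (rdist M (X 0 \<omega>) \<mu>)\<^sup>2 + 2 * (rdist M \<mu> p)\<^sup>2)"
      using rdist_power2_le[of 1 _ p \<mu>] by (intro AE_I2) simp
  qed measurable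
  have ff: "frechet_functional M \<Lambda> p = ennreal (F p)" for p
    unfolding F_def using assms(5) int[of p] unfolding stationary_with_def
    by (intro frechet_functional_integral X) auto
  have F: "F p \<le> (1 + \<eta>) * F q + (1 + 1 / \<eta>) * (rdist M q p)\<^sup>2" if "0 < \<eta>" for \<eta> p q
  proof -
    have "F p \<le> (\<integral>\<omega>. (1 + \<eta>) * (rdist M (X 0 \<omega>) q)\<^sup>2 + (1 + 1 / \<eta>) * (rdist M q p)\<^sup>2 \<partial>P)"
      unfolding F_def using int by (intro integral_mono rdist_power2_le that) auto
    also have "\<dots> = (1 + \<eta>) * F q + (1 + 1 / \<eta>) * (rdist M q p)\<^sup>2"
      unfolding F_def using int by (simp add: prob_space)
    finally show ?thesis .
  qed
  \<comment> \<open>A point whose value does not exceed that of \<open>\<mu>\<close> is itself a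
    Frechet mean, so uniqueness of the mean applies.\<close>
  have unique: "p = \<mu>" if "F p \<le> F \<mu>" for p
  proof (rule assms(7))
    show "is_frechet_mean M \<Lambda> p"
      unfolding is_frechet_mean_def
    proof
      fix q
      have "frechet_functional M \<Lambda> p \<le> frechet_functional M \<Lambda> \<mu>"
        unfolding ff using that by (rule ennreal_leI)
      also have "\<dots> \<le> frechet_functional M \<Lambda> q"
        using assms(6) unfolding is_frechet_mean_def by blast
      finally show "frechet_functional M \<Lambda> p \<le> frechet_functional M \<Lambda> q" .
    qed
  qed
  obtain D :: "'m set" where D: "countable D" "\<And>U. open U \<Longrightarrow> U \<noteq> {} \<Longrightarrow> \<exists>p\<in>D. p \<in> U"
    using countable_dense_setE by blast
  have "AE \<omega> in P. (\<lambda>n. 1 / real n * (\<Sum>k=1..n. (rdist M (X k \<omega>) p)\<^sup>2)) \<longlonglongrightarrow> F p" for p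
    unfolding F_def
    by (rule R_AR_strong_law[OF assms(2-5), of "\<lambda>x. (rdist M x p)\<^sup>2"]) (use int in auto)
  \<comment> \<open>Countably many base points share one null set of exceptional \<omega>.\<close>
  then have "AE \<omega> in P. \<forall>p\<in>insert \<mu> D.
      (\<lambda>n. 1 / real n * (\<Sum>k=1..n. (rdist M (X k \<omega>) p)\<^sup>2)) \<longlonglongrightarrow> F p"
    using D(1) by (subst AE_ball_countable) auto
  with AE_space show ?thesis
  proof eventually_elim
    case (elim \<omega>)
    show ?case
      by (rule frechet_mean_consistency[OF complete F unique D(2), where x = "\<lambda>k. X k \<omega>"])
         (use elim assms(8) in auto)
  qed
qed

end
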